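(* Let $\mathcal{J}$ be a 2-category and $D \colon \mathcal{J} \to \mathcal{C}at$ a functor. Then, for an ordinary category $\mathbf{B}$, \[ \mathrm{Lax}(D,\Delta\mathbf{B}) \simeq \left[\textstyle\int D,\, d_*\mathbf{B}\right] \simeq \left[\pi_*\textstyle\int D,\, \mathbf{B}\right] \] and \[ \mathrm{Ps}(D,\Delta\mathbf{B}) \simeq \left[\textstyle\int D,\, d_*\mathbf{B}\right]_{S^{-1}} \simeq \left[\pi_*\textstyle\int D,\, \mathbf{B}\right]_{S^{-1}} \simeq \left[(\pi_*\textstyle\int D)[S^{-1}],\, \mathbf{B}\right], \] so that the lax colimit of $D$ is $\pi_*\int D$, and the colimit of $D$ is obtained by inverting the images of the opcartesian morphisms of $\int D$ in this category.
   Context: Everything is weak by default: 2-category = bicategory, functor = pseudofunctor, and "colimit" means bicategorical (conical) colimit. The 2-category of elements $\int D$: an object is a pair of $j\in\mathcal{J}$ and $x\in Dj$; a morphism from $x\in Dj$ to $y\in Di$ is a morphism $m\colon j\to i$ of $\mathcal{J}$ together with a morphism $f\colon m_*x\to y$ in $Di$, where $m_*x=(Dm)(x)$; a 2-cell $(m,m_*x\to y)\Rightarrow(n,n_*x\to y)$ is a 2-cell $\alpha\colon m\Rightarrow n$ such that $\alpha_*x\colon m_*x\to n_*x$ makes the triangle over $y$ commute. The morphism $(m,f)$ is opcartesian if $f$ is invertible; $S$ is the class of opcartesian morphisms (or their images in $\pi_*\int D$). $\Delta\mathbf{B}$ is the constant functor at $\mathbf{B}$. $\mathrm{Lax}(D,\Delta\mathbf{B})$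 is the category of lax transformations and modifications, where a lax transformation $\alpha$ has components $\alpha_i\colon Di\to\mathbf{B}$ and coherent natural transformations $\alpha_m\colon\alpha_i\Rightarrow\alpha_j\circ Dm$ for $m\colon i\to j$; $\mathrm{Ps}(D,\Delta\mathbf{B})$ is its full subcategory of those with all $\alpha_m$ invertible. The lax colimit and colimit of $D$ are the categories representing (naturally in $\mathbf{B}$) these two constructions. For a 2-category $\mathcal{X}$, $\pi_*\mathcal{X}$ is the ordinary category with the same objects obtained by applying the connected-components functor $\pi\colon\mathbf{Cat}\to\mathbf{Set}$ to hom-categories; $d_*\mathbf{B}$ is $\mathbf{B}$ regarded as a locally discrete 2-category. $[-,-]$ denotes functor categories, $[-,-]_{S^{-1}}$ the full subcategory on the functors inverting the elements of $S$, and $\mathbf{C}[S^{-1}]$ the category of fractions (localization). *)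

theory Defs
  imports Main "HOL-Library.FuncSet"
begin

section \<open>Categories, functors, natural transformations\<close>

text \<open>
  A record carries its carriers explicitly; its operations are only meaningful on them.
  \<open>Cmp C g f\<close> is the composite of \<open>g\<close> after \<open>f\<close>.
  The size distinction between a category and the 2-category of categories is rendered by types:
  the categories with objects and arrows in given (arbitrary) types \<open>'o\<close> and \<open>'a\<close> play
  the role of the small categories of some universe.
\<close>

record ('o, 'a) cat =
  Ob :: "'o set"
  Ar :: "'a set"
  Dom :: "'a \<Rightarrow> 'o"
  Cod :: "'a \<Rightarrow> 'o"
  Idt :: "'o \<Rightarrow> 'a"
  Cmp :: "'a \<Rightarrow> 'a \<Rightarrow> 'a"

definition hom :: "('o, 'a) cat \<Rightarrow> 'o \<Rightarrow> 'o \<Rightarrow> 'a set" where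
  "hom C x y = {f \<in> Ar C. Dom C f = x \<and> Cod C f = y}"

locale category =
  fixes C :: "('o, 'a) cat"
  assumes Dom_in: "f \<in> Ar C \<Longrightarrow> Dom C f \<in> Ob C"
    and Cod_in: "f \<in> Ar C \<Longrightarrow> Cod C f \<in> Ob C"
    and Idt_in: "x \<in> Ob C \<Longrightarrow> Idt C x \<in> hom C x x"
    and Cmp_in: "f \<in> hom C x y \<Longrightarrow> g \<in> hom C y z \<Longrightarrow> Cmp C g f \<in> hom C x z"
    and Cmp_Idt_left: "f \<in> hom C x y \<Longrightarrow> Cmp C (Idt C y) f = f"
    and Cmp_Idt_right: "f \<in> hom C x y \<Longrightarrow> Cmp C f (Idt C x) = f"
    and Cmp_assoc: "f \<in> hom C w x \<Longrightarrow> g \<in> hom C x y \<Longrightarrow> h \<in> hom C y z \<Longrightarrow>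
      Cmp C (Cmp C h g) f = Cmp C h (Cmp C g f)"

definition inverse_ar :: "('o, 'a) cat \<Rightarrow> 'a \<Rightarrow> 'a \<Rightarrow> bool" where
  "inverse_ar C f g \<longleftrightarrow> f \<in> Ar C \<and> g \<in> hom C (Cod C f) (Dom C f) \<and>
     Cmp C g f = Idt C (Dom C f) \<and> Cmp C f g = Idt C (Cod C f)"

definition is_iso :: "('o, 'a) cat \<Rightarrow> 'a \<Rightarrow> bool" where
  "is_iso C f \<longleftrightarrow> (\<exists>g. inverse_ar C f g)"

definition inv_ar :: "('o, 'a) cat \<Rightarrow> 'a \<Rightarrow> 'a" where
  "inv_ar C f = (THE g. inverse_ar C f g)"

definition isomorphic :: "('o, 'a) cat \<Rightarrow> 'o \<Rightarrow> 'o \<Rightarrow> bool" where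
  "isomorphic C x y \<longleftrightarrow> (\<exists>f \<in> hom C x y. is_iso C f)"

definition full_sub :: "('o, 'a) cat \<Rightarrow> ('o \<Rightarrow> bool) \<Rightarrow> ('o, 'a) cat" where
  "full_sub C P = C\<lparr>Ob := {x \<in> Ob C. P x}, Ar := {f \<in> Ar C. P (Dom C f) \<and> P (Cod C f)}\<rparr>"

text \<open>
  Functors and transformations remember their source and target, and their underlying functions
  are required to be \<open>undefined\<close> off the carriers, so that equality is the intended one.
\<close>

record ('o, 'a, 'p, 'b) func =
  FSrc :: "('o, 'a) cat"
  FTrg :: "('p, 'b) cat"
  FOb :: "'o \<Rightarrow> 'p"
  FAr :: "'a \<Rightarrow> 'b"

locale is_functor =
  fixes F :: "('o, 'a, 'p, 'b) func"
  assumes Src_category: "category (FSrc F)"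
    and Trg_category: "category (FTrg F)"
    and FOb_ext: "FOb F \<in> extensional (Ob (FSrc F))"
    and FAr_ext: "FAr F \<in> extensional (Ar (FSrc F))"
    and FOb_in: "x \<in> Ob (FSrc F) \<Longrightarrow> FOb F x \<in> Ob (FTrg F)"
    and FAr_in: "f \<in> hom (FSrc F) x y \<Longrightarrow> FAr F f \<in> hom (FTrg F) (FOb F x) (FOb F y)"
    and FAr_Idt: "x \<in> Ob (FSrc F) \<Longrightarrow> FAr F (Idt (FSrc F) x) = Idt (FTrg F) (FOb F x)"
    and FAr_Cmp: "f \<in> hom (FSrc F) x y \<Longrightarrow> g \<in> hom (FSrc F) y z \<Longrightarrow>
      FAr F (Cmp (FSrc F) g f) = Cmp (FTrg F) (FAr F g) (FAr F f)"

definition fid :: "('o, 'a) cat \<Rightarrow> ('o, 'a, 'o, 'a) func" where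
  "fid C = \<lparr>FSrc = C, FTrg = C, FOb = (\<lambda>x\<in>Ob C. x), FAr = (\<lambda>f\<in>Ar C. f)\<rparr>"

definition fcmp ::
  "('p, 'b, 'q, 'c) func \<Rightarrow> ('o, 'a, 'p, 'b) func \<Rightarrow> ('o, 'a, 'q, 'c) func" where
  "fcmp G F = \<lparr>FSrc = FSrc F, FTrg = FTrg G,
     FOb = (\<lambda>x\<in>Ob (FSrc F). FOb G (FOb F x)), FAr = (\<lambda>f\<in>Ar (FSrc F). FAr G (FAr F f))\<rparr>"

record ('o, 'a, 'p, 'b) ntrans =
  NSrc :: "('o, 'a, 'p, 'b) func"
  NTrg :: "('o, 'a, 'p, 'b) func"
  NCmp :: "'o \<Rightarrow> 'b"

locale is_ntrans =
  fixes \<tau> :: "('o, 'a, 'p, 'b) ntrans"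
  assumes NSrc_functor: "is_functor (NSrc \<tau>)"
    and NTrg_functor: "is_functor (NTrg \<tau>)"
    and same_FSrc: "FSrc (NTrg \<tau>) = FSrc (NSrc \<tau>)"
    and same_FTrg: "FTrg (NTrg \<tau>) = FTrg (NSrc \<tau>)"
    and NCmp_ext: "NCmp \<tau> \<in> extensional (Ob (FSrc (NSrc \<tau>)))"
    and NCmp_in: "x \<in> Ob (FSrc (NSrc \<tau>)) \<Longrightarrow>
      NCmp \<tau> x \<in> hom (FTrg (NSrc \<tau>)) (FOb (NSrc \<tau>) x) (FOb (NTrg \<tau>) x)"
    and naturality: "f \<in> hom (FSrc (NSrc \<tau>)) x y \<Longrightarrow>
      Cmp (FTrg (NSrc \<tau>)) (FAr (NTrg \<tau>) f) (NCmp \<tau> x) =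
      Cmp (FTrg (NSrc \<tau>)) (NCmp \<tau> y) (FAr (NSrc \<tau>) f)"

definition nid :: "('o, 'a, 'p, 'b) func \<Rightarrow> ('o, 'a, 'p, 'b) ntrans" where
  "nid F = \<lparr>NSrc = F, NTrg = F, NCmp = (\<lambda>x\<in>Ob (FSrc F). Idt (FTrg F) (FOb F x))\<rparr>"

definition nvcmp ::
  "('o, 'a, 'p, 'b) ntrans \<Rightarrow> ('o, 'a, 'p, 'b) ntrans \<Rightarrow> ('o, 'a, 'p, 'b) ntrans" where
  "nvcmp \<sigma> \<tau> = \<lparr>NSrc = NSrc \<tau>, NTrg = NTrg \<sigma>,
     NCmp = (\<lambda>x\<in>Ob (FSrc (NSrc \<tau>)). Cmp (FTrg (NSrc \<tau>)) (NCmp \<sigma> x) (NCmp \<tau> x))\<rparr>"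

definition nhcmp ::
  "('p, 'b, 'q, 'c) ntrans \<Rightarrow> ('o, 'a, 'p, 'b) ntrans \<Rightarrow> ('o, 'a, 'q, 'c) ntrans" where
  "nhcmp \<sigma> \<tau> = \<lparr>NSrc = fcmp (NSrc \<sigma>) (NSrc \<tau>), NTrg = fcmp (NTrg \<sigma>) (NTrg \<tau>),
     NCmp = (\<lambda>x\<in>Ob (FSrc (NSrc \<tau>)).
       Cmp (FTrg (NSrc \<sigma>)) (NCmp \<sigma> (FOb (NTrg \<tau>) x)) (FAr (NSrc \<sigma>) (NCmp \<tau> x)))\<rparr>"

abbreviation nwhl ::
  "('p, 'b, 'q, 'c) func \<Rightarrow> ('o, 'a, 'p, 'b) ntrans \<Rightarrow> ('o, 'a, 'q, 'c) ntrans" where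
  "nwhl F \<tau> \<equiv> nhcmp (nid F) \<tau>"

abbreviation nwhr ::
  "('p, 'b, 'q, 'c) ntrans \<Rightarrow> ('o, 'a, 'p, 'b) func \<Rightarrow> ('o, 'a, 'q, 'c) ntrans" where
  "nwhr \<sigma> F \<equiv> nhcmp \<sigma> (nid F)"

definition fun_cat ::
  "('o, 'a) cat \<Rightarrow> ('p, 'b) cat \<Rightarrow> (('o, 'a, 'p, 'b) func, ('o, 'a, 'p, 'b) ntrans) cat" where
  "fun_cat C B = \<lparr>Ob = {F. is_functor F \<and> FSrc F = C \<and> FTrg F = B},
     Ar = {\<tau>. is_ntrans \<tau> \<and> FSrc (NSrc \<tau>) = C \<and> FTrg (NSrc \<tau>) = B},
     Dom = NSrc, Cod = NTrg, Idt = nid, Cmp = nvcmp\<rparr>"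

definition fun_cat_inv ::
  "('o, 'a) cat \<Rightarrow> 'a set \<Rightarrow> ('p, 'b) cat \<Rightarrow>
     (('o, 'a, 'p, 'b) func, ('o, 'a, 'p, 'b) ntrans) cat" where
  "fun_cat_inv C S B = full_sub (fun_cat C B) (\<lambda>F. \<forall>s\<in>S. is_iso B (FAr F s))"

definition invertible_ntrans :: "('o, 'a, 'p, 'b) ntrans \<Rightarrow> bool" where
  "invertible_ntrans \<tau> \<longleftrightarrow> is_iso (fun_cat (FSrc (NSrc \<tau>)) (FTrg (NSrc \<tau>))) \<tau>"

definition equivalence :: "('o, 'a, 'p, 'b) func \<Rightarrow> bool" where
  "equivalence F \<longleftrightarrow> is_functor F \<and>
     (\<exists>G. is_functor G \<and> FSrc G = FTrg F \<and> FTrg G = FSrc F \<and>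
        isomorphic (fun_cat (FSrc F) (FSrc F)) (fcmp G F) (fid (FSrc F)) \<and>
        isomorphic (fun_cat (FTrg F) (FTrg F)) (fcmp F G) (fid (FTrg F)))"

definition equivalent :: "('o, 'a) cat \<Rightarrow> ('p, 'b) cat \<Rightarrow> bool" (infix "\<simeq>" 50) where
  "C \<simeq> B \<longleftrightarrow> (\<exists>F. equivalence F \<and> FSrc F = C \<and> FTrg F = B)"


section \<open>The category of fractions\<close>

text \<open>
  Arrows from \<open>x\<close> to \<open>y\<close> are classes of zigzags, i.e. of paths (listed in the order
  of traversal) of arrows and of formal inverses of arrows in \<open>S\<close>.
\<close>

datatype 'a zig = Fwd 'a | Bwd 'a

fun zigzag :: "('o, 'a) cat \<Rightarrow> 'a set \<Rightarrow> 'o \<Rightarrow> 'a zig list \<Rightarrow> 'o \<Rightarrow> bool" where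
  "zigzag C S x [] y \<longleftrightarrow> x \<in> Ob C \<and> x = y"
| "zigzag C S x (Fwd f # zs) y \<longleftrightarrow> f \<in> Ar C \<and> Dom C f = x \<and> zigzag C S (Cod C f) zs y"
| "zigzag C S x (Bwd s # zs) y \<longleftrightarrow> s \<in> Ar C \<and> s \<in> S \<and> Cod C s = x \<and> zigzag C S (Dom C s) zs y"

inductive zstep :: "('o, 'a) cat \<Rightarrow> 'a set \<Rightarrow> 'a zig list \<Rightarrow> 'a zig list \<Rightarrow> bool"
  for C :: "('o, 'a) cat" and S :: "'a set" where
  zcmp: "zstep C S (us @ [Fwd f, Fwd g] @ vs) (us @ [Fwd (Cmp C g f)] @ vs)"
| zidt: "x \<in> Ob C \<Longrightarrow> zstep C S (us @ [Fwd (Idt C x)] @ vs) (us @ vs)"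
| zfb: "zstep C S (us @ [Fwd s, Bwd s] @ vs) (us @ vs)"
| zbf: "zstep C S (us @ [Bwd s, Fwd s] @ vs) (us @ vs)"

definition zrel ::
  "('o, 'a) cat \<Rightarrow> 'a set \<Rightarrow> 'o \<Rightarrow> 'o \<Rightarrow> ('a zig list \<times> 'a zig list) set" where
  "zrel C S x y = {(u, v). zigzag C S x u y \<and> zigzag C S x v y \<and> zstep C S u v}"

definition zclass :: "('o, 'a) cat \<Rightarrow> 'a set \<Rightarrow> 'o \<Rightarrow> 'o \<Rightarrow> 'a zig list \<Rightarrow> 'a zig list set" where
  "zclass C S x y u = (zrel C S x y \<union> (zrel C S x y)\<inverse>)\<^sup>* `` {u}"

definition fractions ::
  "('o, 'a) cat \<Rightarrow> 'a set \<Rightarrow> ('o, 'o \<times> 'a zig list set \<times> 'o) cat" where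
  "fractions C S = \<lparr>Ob = Ob C,
     Ar = {(x, zclass C S x y u, y) | x u y. zigzag C S x u y},
     Dom = (\<lambda>(x, P, y). x),
     Cod = (\<lambda>(x, P, y). y),
     Idt = (\<lambda>x. (x, zclass C S x x [], x)),
     Cmp = (\<lambda>(y', Q, z) (x, P, y). (x, \<Union>u\<in>P. \<Union>v\<in>Q. zclass C S x z (u @ v), z))\<rparr>"


section \<open>Bicategories and pseudofunctors\<close>

text \<open>
  \<open>Asc h g f\<close> is the associator from \<open>(h g) f\<close> to \<open>h (g f)\<close>; the unitors \<open>LUn f\<close>,
  \<open>RUn f\<close> go from \<open>1 f\<close>, \<open>f 1\<close> to \<open>f\<close>.
\<close>

record ('o, 'm, 't) bicat =
  Ob0 :: "'o set"
  Ar1 :: "'m set"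
  Ar2 :: "'t set"
  Src1 :: "'m \<Rightarrow> 'o"
  Trg1 :: "'m \<Rightarrow> 'o"
  Src2 :: "'t \<Rightarrow> 'm"
  Trg2 :: "'t \<Rightarrow> 'm"
  Id1 :: "'o \<Rightarrow> 'm"
  Cmp1 :: "'m \<Rightarrow> 'm \<Rightarrow> 'm"
  Id2 :: "'m \<Rightarrow> 't"
  VCmp :: "'t \<Rightarrow> 't \<Rightarrow> 't"
  HCmp :: "'t \<Rightarrow> 't \<Rightarrow> 't"
  Asc :: "'m \<Rightarrow> 'm \<Rightarrow> 'm \<Rightarrow> 't"
  LUn :: "'m \<Rightarrow> 't"
  RUn :: "'m \<Rightarrow> 't"

definition cell1 :: "('o, 'm, 't) bicat \<Rightarrow> 'o \<Rightarrow> 'o \<Rightarrow> 'm set" where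
  "cell1 X x y = {f \<in> Ar1 X. Src1 X f = x \<and> Trg1 X f = y}"

definition cell2 :: "('o, 'm, 't) bicat \<Rightarrow> 'm \<Rightarrow> 'm \<Rightarrow> 't set" where
  "cell2 X f g = {\<theta> \<in> Ar2 X. Src2 X \<theta> = f \<and> Trg2 X \<theta> = g}"

definition hom_cat :: "('o, 'm, 't) bicat \<Rightarrow> 'o \<Rightarrow> 'o \<Rightarrow> ('m, 't) cat" where
  "hom_cat X x y = \<lparr>Ob = cell1 X x y,
     Ar = {\<theta> \<in> Ar2 X. Src2 X \<theta> \<in> cell1 X x y \<and> Trg2 X \<theta> \<in> cell1 X x y},
     Dom = Src2 X, Cod = Trg2 X, Idt = Id2 X, Cmp = VCmp X\<rparr>"

definition iso2 :: "('o, 'm, 't) bicat \<Rightarrow> 't \<Rightarrow> bool" where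
  "iso2 X \<theta> \<longleftrightarrow> is_iso (hom_cat X (Src1 X (Src2 X \<theta>)) (Trg1 X (Src2 X \<theta>))) \<theta>"

definition inv2 :: "('o, 'm, 't) bicat \<Rightarrow> 't \<Rightarrow> 't" where
  "inv2 X \<theta> = inv_ar (hom_cat X (Src1 X (Src2 X \<theta>)) (Trg1 X (Src2 X \<theta>))) \<theta>"

abbreviation whl :: "('o, 'm, 't) bicat \<Rightarrow> 'm \<Rightarrow> 't \<Rightarrow> 't" where
  "whl X f \<theta> \<equiv> HCmp X (Id2 X f) \<theta>"

abbreviation whr :: "('o, 'm, 't) bicat \<Rightarrow> 't \<Rightarrow> 'm \<Rightarrow> 't" where
  "whr X \<theta> f \<equiv> HCmp X \<theta> (Id2 X f)"

locale bicategory =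
  fixes X :: "('o, 'm, 't) bicat"
  assumes Src1_in: "f \<in> Ar1 X \<Longrightarrow> Src1 X f \<in> Ob0 X"
    and Trg1_in: "f \<in> Ar1 X \<Longrightarrow> Trg1 X f \<in> Ob0 X"
    and Src2_in: "\<theta> \<in> Ar2 X \<Longrightarrow> Src2 X \<theta> \<in> Ar1 X"
    and Trg2_in: "\<theta> \<in> Ar2 X \<Longrightarrow> Trg2 X \<theta> \<in> Ar1 X"
    and Src1_Trg2: "\<theta> \<in> Ar2 X \<Longrightarrow> Src1 X (Trg2 X \<theta>) = Src1 X (Src2 X \<theta>)"
    and Trg1_Trg2: "\<theta> \<in> Ar2 X \<Longrightarrow> Trg1 X (Trg2 X \<theta>) = Trg1 X (Src2 X \<theta>)"
    and hom_category: "x \<in> Ob0 X \<Longrightarrow> y \<in> Ob0 X \<Longrightarrow> category (hom_cat X x y)"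
    and Id1_in: "x \<in> Ob0 X \<Longrightarrow> Id1 X x \<in> cell1 X x x"
    and Cmp1_in: "f \<in> cell1 X x y \<Longrightarrow> g \<in> cell1 X y z \<Longrightarrow> Cmp1 X g f \<in> cell1 X x z"
    and HCmp_in: "f \<in> cell1 X x y \<Longrightarrow> g \<in> cell1 X y z \<Longrightarrow>
      \<theta> \<in> cell2 X f f' \<Longrightarrow> \<phi> \<in> cell2 X g g' \<Longrightarrow>
      HCmp X \<phi> \<theta> \<in> cell2 X (Cmp1 X g f) (Cmp1 X g' f')"
    and HCmp_Id2: "f \<in> cell1 X x y \<Longrightarrow> g \<in> cell1 X y z \<Longrightarrow>
      HCmp X (Id2 X g) (Id2 X f) = Id2 X (Cmp1 X g f)"
    and interchange: "f \<in> cell1 X x y \<Longrightarrow> g \<in> cell1 X y z \<Longrightarrow>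
      \<theta> \<in> cell2 X f f' \<Longrightarrow> \<theta>' \<in> cell2 X f' f'' \<Longrightarrow>
      \<phi> \<in> cell2 X g g' \<Longrightarrow> \<phi>' \<in> cell2 X g' g'' \<Longrightarrow>
      HCmp X (VCmp X \<phi>' \<phi>) (VCmp X \<theta>' \<theta>) = VCmp X (HCmp X \<phi>' \<theta>') (HCmp X \<phi> \<theta>)"
    and Asc_in: "f \<in> cell1 X w x \<Longrightarrow> g \<in> cell1 X x y \<Longrightarrow> h \<in> cell1 X y z \<Longrightarrow>
      Asc X h g f \<in> cell2 X (Cmp1 X (Cmp1 X h g) f) (Cmp1 X h (Cmp1 X g f))"
    and Asc_iso: "f \<in> cell1 X w x \<Longrightarrow> g \<in> cell1 X x y \<Longrightarrow> h \<in> cell1 X y z \<Longrightarrow>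
      iso2 X (Asc X h g f)"
    and Asc_natural: "f \<in> cell1 X w x \<Longrightarrow> g \<in> cell1 X x y \<Longrightarrow> h \<in> cell1 X y z \<Longrightarrow>
      \<theta> \<in> cell2 X f f' \<Longrightarrow> \<phi> \<in> cell2 X g g' \<Longrightarrow> \<psi> \<in> cell2 X h h' \<Longrightarrow>
      VCmp X (Asc X h' g' f') (HCmp X (HCmp X \<psi> \<phi>) \<theta>) =
      VCmp X (HCmp X \<psi> (HCmp X \<phi> \<theta>)) (Asc X h g f)"
    and LUn_in: "f \<in> cell1 X x y \<Longrightarrow> LUn X f \<in> cell2 X (Cmp1 X (Id1 X y) f) f"
    and LUn_iso: "f \<in> cell1 X x y \<Longrightarrow> iso2 X (LUn X f)"
    and LUn_natural: "f \<in> cell1 X x y \<Longrightarrow> \<theta> \<in> cell2 X f f' \<Longrightarrow>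
      VCmp X (LUn X f') (whl X (Id1 X y) \<theta>) = VCmp X \<theta> (LUn X f)"
    and RUn_in: "f \<in> cell1 X x y \<Longrightarrow> RUn X f \<in> cell2 X (Cmp1 X f (Id1 X x)) f"
    and RUn_iso: "f \<in> cell1 X x y \<Longrightarrow> iso2 X (RUn X f)"
    and RUn_natural: "f \<in> cell1 X x y \<Longrightarrow> \<theta> \<in> cell2 X f f' \<Longrightarrow>
      VCmp X (RUn X f') (whr X \<theta> (Id1 X x)) = VCmp X \<theta> (RUn X f)"
    and triangle: "f \<in> cell1 X x y \<Longrightarrow> g \<in> cell1 X y z \<Longrightarrow>
      VCmp X (whl X g (LUn X f)) (Asc X g (Id1 X y) f) = whr X (RUn X g) f"
    and pentagon: "e \<in> cell1 X v w \<Longrightarrow> f \<in> cell1 X w x \<Longrightarrow> g \<in> cell1 X x y \<Longrightarrow>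
      h \<in> cell1 X y z \<Longrightarrow>
      VCmp X (Asc X h g (Cmp1 X f e)) (Asc X (Cmp1 X h g) f e) =
      VCmp X (whl X h (Asc X g f e)) (VCmp X (Asc X h (Cmp1 X g f) e) (whr X (Asc X h g f) e))"

definition equivalence1 :: "('o, 'm, 't) bicat \<Rightarrow> 'm \<Rightarrow> bool" where
  "equivalence1 X f \<longleftrightarrow> f \<in> Ar1 X \<and>
     (\<exists>g \<in> cell1 X (Trg1 X f) (Src1 X f).
        (\<exists>\<theta> \<in> cell2 X (Cmp1 X g f) (Id1 X (Src1 X f)). iso2 X \<theta>) \<and>
        (\<exists>\<theta> \<in> cell2 X (Cmp1 X f g) (Id1 X (Trg1 X f)). iso2 X \<theta>))"

text \<open>The locally discrete bicategory on a category: the only 2-cell on \<open>f\<close> is \<open>f\<close> itself.\<close>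

definition disc :: "('o, 'a) cat \<Rightarrow> ('o, 'a, 'a) bicat" where
  "disc B = \<lparr>Ob0 = Ob B, Ar1 = Ar B, Ar2 = Ar B, Src1 = Dom B, Trg1 = Cod B,
     Src2 = (\<lambda>f. f), Trg2 = (\<lambda>f. f), Id1 = Idt B, Cmp1 = Cmp B, Id2 = (\<lambda>f. f),
     VCmp = (\<lambda>g f. f), HCmp = Cmp B, Asc = (\<lambda>h g f. Cmp B h (Cmp B g f)),
     LUn = (\<lambda>f. f), RUn = (\<lambda>f. f)\<rparr>"

definition Cat ::
  "(('o, 'a) cat, ('o, 'a, 'o, 'a) func, ('o, 'a, 'o, 'a) ntrans) bicat" where
  "Cat = \<lparr>Ob0 = {C. category C}, Ar1 = {F. is_functor F}, Ar2 = {\<tau>. is_ntrans \<tau>},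
     Src1 = FSrc, Trg1 = FTrg, Src2 = NSrc, Trg2 = NTrg,
     Id1 = fid, Cmp1 = fcmp, Id2 = nid, VCmp = nvcmp, HCmp = nhcmp,
     Asc = (\<lambda>H G F. nid (fcmp H (fcmp G F))), LUn = nid, RUn = nid\<rparr>"

text \<open>
  The structure cells \<open>PUn F x\<close> and \<open>PCp F g f\<close> of a pseudofunctor go from \<open>1\<close> to \<open>F 1\<close> and
  from \<open>F g F f\<close> to \<open>F (g f)\<close>.
\<close>

record ('o, 'm, 't, 'o2, 'm2, 't2) psf =
  P0 :: "'o \<Rightarrow> 'o2"
  P1 :: "'m \<Rightarrow> 'm2"
  P2 :: "'t \<Rightarrow> 't2"
  PUn :: "'o \<Rightarrow> 't2"
  PCp :: "'m \<Rightarrow> 'm \<Rightarrow> 't2"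

locale pseudofunctor = S: bicategory X + T: bicategory Y
  for X :: "('o, 'm, 't) bicat" and Y :: "('o2, 'm2, 't2) bicat" +
  fixes F :: "('o, 'm, 't, 'o2, 'm2, 't2) psf"
  assumes P0_in: "x \<in> Ob0 X \<Longrightarrow> P0 F x \<in> Ob0 Y"
    and P1_in: "f \<in> cell1 X x y \<Longrightarrow> P1 F f \<in> cell1 Y (P0 F x) (P0 F y)"
    and P2_in: "\<theta> \<in> cell2 X f g \<Longrightarrow> P2 F \<theta> \<in> cell2 Y (P1 F f) (P1 F g)"
    and P2_Id2: "f \<in> Ar1 X \<Longrightarrow> P2 F (Id2 X f) = Id2 Y (P1 F f)"
    and P2_VCmp: "\<theta> \<in> cell2 X f g \<Longrightarrow> \<phi> \<in> cell2 X g h \<Longrightarrow>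
      P2 F (VCmp X \<phi> \<theta>) = VCmp Y (P2 F \<phi>) (P2 F \<theta>)"
    and PUn_in: "x \<in> Ob0 X \<Longrightarrow> PUn F x \<in> cell2 Y (Id1 Y (P0 F x)) (P1 F (Id1 X x))"
    and PUn_iso: "x \<in> Ob0 X \<Longrightarrow> iso2 Y (PUn F x)"
    and PCp_in: "f \<in> cell1 X x y \<Longrightarrow> g \<in> cell1 X y z \<Longrightarrow>
      PCp F g f \<in> cell2 Y (Cmp1 Y (P1 F g) (P1 F f)) (P1 F (Cmp1 X g f))"
    and PCp_iso: "f \<in> cell1 X x y \<Longrightarrow> g \<in> cell1 X y z \<Longrightarrow> iso2 Y (PCp F g f)"
    and PCp_natural: "f \<in> cell1 X x y \<Longrightarrow> g \<in> cell1 X y z \<Longrightarrow>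
      \<theta> \<in> cell2 X f f' \<Longrightarrow> \<phi> \<in> cell2 X g g' \<Longrightarrow>
      VCmp Y (PCp F g' f') (HCmp Y (P2 F \<phi>) (P2 F \<theta>)) =
      VCmp Y (P2 F (HCmp X \<phi> \<theta>)) (PCp F g f)"
    and PCp_Asc: "f \<in> cell1 X w x \<Longrightarrow> g \<in> cell1 X x y \<Longrightarrow> h \<in> cell1 X y z \<Longrightarrow>
      VCmp Y (P2 F (Asc X h g f))
        (VCmp Y (PCp F (Cmp1 X h g) f) (whr Y (PCp F h g) (P1 F f))) =
      VCmp Y (PCp F h (Cmp1 X g f))
        (VCmp Y (whl Y (P1 F h) (PCp F g f)) (Asc Y (P1 F h) (P1 F g) (P1 F f)))"
    and PCp_LUn: "f \<in> cell1 X x y \<Longrightarrow>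
      VCmp Y (P2 F (LUn X f)) (VCmp Y (PCp F (Id1 X y) f) (whr Y (PUn F y) (P1 F f))) =
      LUn Y (P1 F f)"
    and PCp_RUn: "f \<in> cell1 X x y \<Longrightarrow>
      VCmp Y (P2 F (RUn X f)) (VCmp Y (PCp F f (Id1 X x)) (whl Y (P1 F f) (PUn F x))) =
      RUn Y (P1 F f)"

definition psf_ext :: "('o, 'm, 't) bicat \<Rightarrow> ('o, 'm, 't, 'o2, 'm2, 't2) psf \<Rightarrow> bool" where
  "psf_ext X F \<longleftrightarrow> P0 F \<in> extensional (Ob0 X) \<and> P1 F \<in> extensional (Ar1 X) \<and>
     P2 F \<in> extensional (Ar2 X) \<and> PUn F \<in> extensional (Ob0 X) \<and>
     (\<forall>g f. \<not> (f \<in> Ar1 X \<and> g \<in> Ar1 X \<and> Trg1 X f = Src1 X g) \<longrightarrow> PCp F g f = undefined)"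

definition const_psf ::
  "('o2, 'm2, 't2) bicat \<Rightarrow> 'o2 \<Rightarrow> ('o, 'm, 't, 'o2, 'm2, 't2) psf" where
  "const_psf Y b = \<lparr>P0 = (\<lambda>_. b), P1 = (\<lambda>_. Id1 Y b), P2 = (\<lambda>_. Id2 Y (Id1 Y b)),
     PUn = (\<lambda>_. Id2 Y (Id1 Y b)), PCp = (\<lambda>_ _. LUn Y (Id1 Y b))\<rparr>"

abbreviation Delta ::
  "('p, 'b) cat \<Rightarrow> ('o, 'm, 't, ('p, 'b) cat, ('p, 'b, 'p, 'b) func, ('p, 'b, 'p, 'b) ntrans) psf"
  where "Delta B \<equiv> const_psf Cat B"


section \<open>Functors into a locally discrete bicategory\<close>

record ('o, 'm, 't, 'o2, 'm2, 't2) ptrans =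
  TSrc :: "('o, 'm, 't, 'o2, 'm2, 't2) psf"
  TTrg :: "('o, 'm, 't, 'o2, 'm2, 't2) psf"
  T0 :: "'o \<Rightarrow> 'm2"
  T1 :: "'m \<Rightarrow> 't2"

locale pseudonatural =
  F: pseudofunctor X Y "TSrc \<tau>" + G: pseudofunctor X Y "TTrg \<tau>"
  for X :: "('o, 'm, 't) bicat" and Y :: "('o2, 'm2, 't2) bicat"
    and \<tau> :: "('o, 'm, 't, 'o2, 'm2, 't2) ptrans" +
  assumes T0_ext: "T0 \<tau> \<in> extensional (Ob0 X)"
    and T1_ext: "T1 \<tau> \<in> extensional (Ar1 X)"
    and T0_in: "x \<in> Ob0 X \<Longrightarrow> T0 \<tau> x \<in> cell1 Y (P0 (TSrc \<tau>) x) (P0 (TTrg \<tau>) x)"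
    and T1_in: "f \<in> cell1 X x y \<Longrightarrow>
      T1 \<tau> f \<in> cell2 Y (Cmp1 Y (P1 (TTrg \<tau>) f) (T0 \<tau> x)) (Cmp1 Y (T0 \<tau> y) (P1 (TSrc \<tau>) f))"
    and T1_iso: "f \<in> Ar1 X \<Longrightarrow> iso2 Y (T1 \<tau> f)"
    and T1_natural: "f \<in> cell1 X x y \<Longrightarrow> \<theta> \<in> cell2 X f g \<Longrightarrow>
      VCmp Y (whl Y (T0 \<tau> y) (P2 (TSrc \<tau>) \<theta>)) (T1 \<tau> f) =
      VCmp Y (T1 \<tau> g) (whr Y (P2 (TTrg \<tau>) \<theta>) (T0 \<tau> x))"
    and T1_Id1: "x \<in> Ob0 X \<Longrightarrow>
      VCmp Y (T1 \<tau> (Id1 X x)) (whr Y (PUn (TTrg \<tau>) x) (T0 \<tau> x)) =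
      VCmp Y (whl Y (T0 \<tau> x) (PUn (TSrc \<tau>) x))
        (VCmp Y (inv2 Y (RUn Y (T0 \<tau> x))) (LUn Y (T0 \<tau> x)))"
    and T1_Cmp1: "f \<in> cell1 X x y \<Longrightarrow> g \<in> cell1 X y z \<Longrightarrow>
      VCmp Y (T1 \<tau> (Cmp1 X g f)) (whr Y (PCp (TTrg \<tau>) g f) (T0 \<tau> x)) =
      VCmp Y (whl Y (T0 \<tau> z) (PCp (TSrc \<tau>) g f))
       (VCmp Y (Asc Y (T0 \<tau> z) (P1 (TSrc \<tau>) g) (P1 (TSrc \<tau>) f))
        (VCmp Y (whr Y (T1 \<tau> g) (P1 (TSrc \<tau>) f))
         (VCmp Y (inv2 Y (Asc Y (P1 (TTrg \<tau>) g) (T0 \<tau> y) (P1 (TSrc \<tau>) f)))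
          (VCmp Y (whl Y (P1 (TTrg \<tau>) g) (T1 \<tau> f))
           (Asc Y (P1 (TTrg \<tau>) g) (P1 (TTrg \<tau>) f) (T0 \<tau> x))))))"

definition ptid ::
  "('o, 'm, 't) bicat \<Rightarrow> ('o2, 'm2, 't2) bicat \<Rightarrow> ('o, 'm, 't, 'o2, 'm2, 't2) psf \<Rightarrow>
     ('o, 'm, 't, 'o2, 'm2, 't2) ptrans" where
  "ptid X Y F = \<lparr>TSrc = F, TTrg = F, T0 = (\<lambda>x\<in>Ob0 X. Id1 Y (P0 F x)),
     T1 = (\<lambda>f\<in>Ar1 X. VCmp Y (inv2 Y (LUn Y (P1 F f))) (RUn Y (P1 F f)))\<rparr>"

definition ptcmp ::
  "('o, 'm, 't) bicat \<Rightarrow> ('o2, 'm2, 't2) bicat \<Rightarrow> ('o, 'm, 't, 'o2, 'm2, 't2) ptrans \<Rightarrow>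
     ('o, 'm, 't, 'o2, 'm2, 't2) ptrans \<Rightarrow> ('o, 'm, 't, 'o2, 'm2, 't2) ptrans" where
  "ptcmp X Y \<sigma> \<tau> = \<lparr>TSrc = TSrc \<tau>, TTrg = TTrg \<sigma>,
     T0 = (\<lambda>x\<in>Ob0 X. Cmp1 Y (T0 \<sigma> x) (T0 \<tau> x)),
     T1 = (\<lambda>f\<in>Ar1 X. let x = Src1 X f; y = Trg1 X f in
       VCmp Y (inv2 Y (Asc Y (T0 \<sigma> y) (T0 \<tau> y) (P1 (TSrc \<tau>) f)))
        (VCmp Y (whl Y (T0 \<sigma> y) (T1 \<tau> f))
         (VCmp Y (Asc Y (T0 \<sigma> y) (P1 (TTrg \<tau>) f) (T0 \<tau> x))
          (VCmp Y (whr Y (T1 \<sigma> f) (T0 \<tau> x))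
           (inv2 Y (Asc Y (P1 (TTrg \<sigma>) f) (T0 \<sigma> x) (T0 \<tau> x)))))))\<rparr>"

text \<open>
  Pseudofunctors and pseudonatural transformations. This is only used for locally discrete
  \<open>Y\<close>: then all modifications are identities and the composition of pseudonatural
  transformations is strictly associative and unital, so the bicategory of pseudofunctors from
  \<open>X\<close> to \<open>Y\<close> is just this category.
\<close>

definition psf_cat ::
  "('o, 'm, 't) bicat \<Rightarrow> ('o2, 'm2, 't2) bicat \<Rightarrow>
     (('o, 'm, 't, 'o2, 'm2, 't2) psf, ('o, 'm, 't, 'o2, 'm2, 't2) ptrans) cat" where
  "psf_cat X Y = \<lparr>Ob = {F. pseudofunctor X Y F \<and> psf_ext X F},
     Ar = {\<tau>. pseudonatural X Y \<tau> \<and> psf_ext X (TSrc \<tau>) \<and> psf_ext X (TTrg \<tau>)},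
     Dom = TSrc, Cod = TTrg, Idt = ptid X Y, Cmp = ptcmp X Y\<rparr>"

definition psf_cat_inv ::
  "('o, 'm, 't) bicat \<Rightarrow> 'm set \<Rightarrow> ('o2, 'm2, 't2) bicat \<Rightarrow>
     (('o, 'm, 't, 'o2, 'm2, 't2) psf, ('o, 'm, 't, 'o2, 'm2, 't2) ptrans) cat" where
  "psf_cat_inv X S Y = full_sub (psf_cat X Y) (\<lambda>F. \<forall>s\<in>S. equivalence1 Y (P1 F s))"


section \<open>Lax transformations and modifications between Cat-valued functors\<close>

text \<open>
  The two functors may take values in categories over different types, which is why these
  notions are not stated for an arbitrary target bicategory. As composition of
  functors is strictly associative and unital, no associators or unitors appear.
\<close>

record ('o, 'm, 'x, 'a, 'p, 'b) lax =
  L0 :: "'o \<Rightarrow> ('x, 'a, 'p, 'b) func"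
  L1 :: "'m \<Rightarrow> ('x, 'a, 'p, 'b) ntrans"

locale lax_transformation =
  D: pseudofunctor X Cat D + E: pseudofunctor X Cat E
  for X :: "('o, 'm, 't) bicat"
    and D :: "('o, 'm, 't, ('x, 'a) cat, ('x, 'a, 'x, 'a) func, ('x, 'a, 'x, 'a) ntrans) psf"
    and E :: "('o, 'm, 't, ('p, 'b) cat, ('p, 'b, 'p, 'b) func, ('p, 'b, 'p, 'b) ntrans) psf" +
  fixes \<alpha> :: "('o, 'm, 'x, 'a, 'p, 'b) lax"
  assumes L0_ext: "L0 \<alpha> \<in> extensional (Ob0 X)"
    and L1_ext: "L1 \<alpha> \<in> extensional (Ar1 X)"
    and L0_in: "i \<in> Ob0 X \<Longrightarrow> L0 \<alpha> i \<in> Ob (fun_cat (P0 D i) (P0 E i))"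
    and L1_in: "m \<in> cell1 X i j \<Longrightarrow>
      L1 \<alpha> m \<in> hom (fun_cat (P0 D i) (P0 E j)) (fcmp (P1 E m) (L0 \<alpha> i)) (fcmp (L0 \<alpha> j) (P1 D m))"
    and L1_natural: "m \<in> cell1 X i j \<Longrightarrow> \<theta> \<in> cell2 X m n \<Longrightarrow>
      nvcmp (nwhl (L0 \<alpha> j) (P2 D \<theta>)) (L1 \<alpha> m) = nvcmp (L1 \<alpha> n) (nwhr (P2 E \<theta>) (L0 \<alpha> i))"
    and L1_Id1: "i \<in> Ob0 X \<Longrightarrow>
      nvcmp (L1 \<alpha> (Id1 X i)) (nwhr (PUn E i) (L0 \<alpha> i)) = nwhl (L0 \<alpha> i) (PUn D i)"
    and L1_Cmp1: "m \<in> cell1 X i j \<Longrightarrow> n \<in> cell1 X j k \<Longrightarrow>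
      nvcmp (L1 \<alpha> (Cmp1 X n m)) (nwhr (PCp E n m) (L0 \<alpha> i)) =
      nvcmp (nwhl (L0 \<alpha> k) (PCp D n m))
        (nvcmp (nwhr (L1 \<alpha> n) (P1 D m)) (nwhl (P1 E n) (L1 \<alpha> m)))"

record ('o, 'm, 'x, 'a, 'p, 'b) modif =
  MSrc :: "('o, 'm, 'x, 'a, 'p, 'b) lax"
  MTrg :: "('o, 'm, 'x, 'a, 'p, 'b) lax"
  MCmp :: "'o \<Rightarrow> ('x, 'a, 'p, 'b) ntrans"

locale modification =
  A: lax_transformation X D E "MSrc \<Gamma>" + B: lax_transformation X D E "MTrg \<Gamma>"
  for X :: "('o, 'm, 't) bicat"
    and D :: "('o, 'm, 't, ('x, 'a) cat, ('x, 'a, 'x, 'a) func, ('x, 'a, 'x, 'a) ntrans) psf"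
    and E :: "('o, 'm, 't, ('p, 'b) cat, ('p, 'b, 'p, 'b) func, ('p, 'b, 'p, 'b) ntrans) psf"
    and \<Gamma> :: "('o, 'm, 'x, 'a, 'p, 'b) modif" +
  assumes MCmp_ext: "MCmp \<Gamma> \<in> extensional (Ob0 X)"
    and MCmp_in: "i \<in> Ob0 X \<Longrightarrow>
      MCmp \<Gamma> i \<in> hom (fun_cat (P0 D i) (P0 E i)) (L0 (MSrc \<Gamma>) i) (L0 (MTrg \<Gamma>) i)"
    and MCmp_L1: "m \<in> cell1 X i j \<Longrightarrow>
      nvcmp (L1 (MTrg \<Gamma>) m) (nwhl (P1 E m) (MCmp \<Gamma> i)) =
      nvcmp (nwhr (MCmp \<Gamma> j) (P1 D m)) (L1 (MSrc \<Gamma>) m)"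

definition Lax ::
  "('o, 'm, 't) bicat \<Rightarrow>
   ('o, 'm, 't, ('x, 'a) cat, ('x, 'a, 'x, 'a) func, ('x, 'a, 'x, 'a) ntrans) psf \<Rightarrow>
   ('o, 'm, 't, ('p, 'b) cat, ('p, 'b, 'p, 'b) func, ('p, 'b, 'p, 'b) ntrans) psf \<Rightarrow>
   (('o, 'm, 'x, 'a, 'p, 'b) lax, ('o, 'm, 'x, 'a, 'p, 'b) modif) cat" where
  "Lax X D E = \<lparr>Ob = {\<alpha>. lax_transformation X D E \<alpha>},
     Ar = {\<Gamma>. modification X D E \<Gamma>},
     Dom = MSrc, Cod = MTrg,
     Idt = (\<lambda>\<alpha>. \<lparr>MSrc = \<alpha>, MTrg = \<alpha>, MCmp = (\<lambda>i\<in>Ob0 X. nid (L0 \<alpha> i))\<rparr>),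
     Cmp = (\<lambda>\<Delta> \<Gamma>. \<lparr>MSrc = MSrc \<Gamma>, MTrg = MTrg \<Delta>,
       MCmp = (\<lambda>i\<in>Ob0 X. nvcmp (MCmp \<Delta> i) (MCmp \<Gamma> i))\<rparr>)\<rparr>"

definition Ps ::
  "('o, 'm, 't) bicat \<Rightarrow>
   ('o, 'm, 't, ('x, 'a) cat, ('x, 'a, 'x, 'a) func, ('x, 'a, 'x, 'a) ntrans) psf \<Rightarrow>
   ('o, 'm, 't, ('p, 'b) cat, ('p, 'b, 'p, 'b) func, ('p, 'b, 'p, 'b) ntrans) psf \<Rightarrow>
   (('o, 'm, 'x, 'a, 'p, 'b) lax, ('o, 'm, 'x, 'a, 'p, 'b) modif) cat" where
  "Ps X D E = full_sub (Lax X D E) (\<lambda>\<alpha>. \<forall>m\<in>Ar1 X. invertible_ntrans (L1 \<alpha> m))"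


section \<open>Lax colimits and colimits\<close>

text \<open>The 2-functor \<open>B \<mapsto> [C, B]\<close>, by postcomposition.\<close>

definition postcomp ::
  "('x, 'a) cat \<Rightarrow> ('p, 'b, 'p, 'b) func \<Rightarrow>
    (('x, 'a, 'p, 'b) func, ('x, 'a, 'p, 'b) ntrans, ('x, 'a, 'p, 'b) func, ('x, 'a, 'p, 'b) ntrans) func"
  where
  "postcomp C F = \<lparr>FSrc = fun_cat C (FSrc F), FTrg = fun_cat C (FTrg F),
     FOb = (\<lambda>G\<in>Ob (fun_cat C (FSrc F)). fcmp F G),
     FAr = (\<lambda>\<tau>\<in>Ar (fun_cat C (FSrc F)). nwhl F \<tau>)\<rparr>"

definition hom_from ::
  "('x, 'a) cat \<Rightarrow>
    (('p, 'b) cat, ('p, 'b, 'p, 'b) func, ('p, 'b, 'p, 'b) ntrans,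
     (('x, 'a, 'p, 'b) func, ('x, 'a, 'p, 'b) ntrans) cat,
     (('x, 'a, 'p, 'b) func, ('x, 'a, 'p, 'b) ntrans,
      ('x, 'a, 'p, 'b) func, ('x, 'a, 'p, 'b) ntrans) func,
     (('x, 'a, 'p, 'b) func, ('x, 'a, 'p, 'b) ntrans,
      ('x, 'a, 'p, 'b) func, ('x, 'a, 'p, 'b) ntrans) ntrans) psf" where
  "hom_from C = \<lparr>P0 = fun_cat C, P1 = postcomp C,
     P2 = (\<lambda>\<sigma>. \<lparr>NSrc = postcomp C (NSrc \<sigma>), NTrg = postcomp C (NTrg \<sigma>),
       NCmp = (\<lambda>G\<in>Ob (fun_cat C (FSrc (NSrc \<sigma>))). nwhr \<sigma> G)\<rparr>),
     PUn = (\<lambda>B. nid (fid (fun_cat C B))),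
     PCp = (\<lambda>G F. nid (postcomp C (fcmp G F)))\<rparr>"

text \<open>
  The 2-functors \<open>B \<mapsto> Lax(D, \<Delta>B)\<close> and \<open>B \<mapsto> Ps(D, \<Delta>B)\<close>, also by
  postcomposition; \<open>K B\<close> stands for the respective category.
\<close>

definition post_lax ::
  "('o, 'm, 't) bicat \<Rightarrow> ('p, 'b, 'p, 'b) func \<Rightarrow>
   ('o, 'm, 'x, 'a, 'p, 'b) lax \<Rightarrow> ('o, 'm, 'x, 'a, 'p, 'b) lax" where
  "post_lax X F \<alpha> = \<lparr>L0 = (\<lambda>i\<in>Ob0 X. fcmp F (L0 \<alpha> i)), L1 = (\<lambda>m\<in>Ar1 X. nwhl F (L1 \<alpha> m))\<rparr>"

definition post_cocones ::
  "('o, 'm, 't) bicat \<Rightarrow>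
   (('p, 'b) cat \<Rightarrow> (('o, 'm, 'x, 'a, 'p, 'b) lax, ('o, 'm, 'x, 'a, 'p, 'b) modif) cat) \<Rightarrow>
   ('p, 'b, 'p, 'b) func \<Rightarrow>
   (('o, 'm, 'x, 'a, 'p, 'b) lax, ('o, 'm, 'x, 'a, 'p, 'b) modif,
    ('o, 'm, 'x, 'a, 'p, 'b) lax, ('o, 'm, 'x, 'a, 'p, 'b) modif) func" where
  "post_cocones X K F = \<lparr>FSrc = K (FSrc F), FTrg = K (FTrg F),
     FOb = (\<lambda>\<alpha>\<in>Ob (K (FSrc F)). post_lax X F \<alpha>),
     FAr = (\<lambda>\<Gamma>\<in>Ar (K (FSrc F)).
       \<lparr>MSrc = post_lax X F (MSrc \<Gamma>), MTrg = post_lax X F (MTrg \<Gamma>),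
        MCmp = (\<lambda>i\<in>Ob0 X. nwhl F (MCmp \<Gamma> i))\<rparr>)\<rparr>"

definition cocones ::
  "('o, 'm, 't) bicat \<Rightarrow>
   (('p, 'b) cat \<Rightarrow> (('o, 'm, 'x, 'a, 'p, 'b) lax, ('o, 'm, 'x, 'a, 'p, 'b) modif) cat) \<Rightarrow>
   (('p, 'b) cat, ('p, 'b, 'p, 'b) func, ('p, 'b, 'p, 'b) ntrans,
    (('o, 'm, 'x, 'a, 'p, 'b) lax, ('o, 'm, 'x, 'a, 'p, 'b) modif) cat,
    (('o, 'm, 'x, 'a, 'p, 'b) lax, ('o, 'm, 'x, 'a, 'p, 'b) modif,
     ('o, 'm, 'x, 'a, 'p, 'b) lax, ('o, 'm, 'x, 'a, 'p, 'b) modif) func,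
    (('o, 'm, 'x, 'a, 'p, 'b) lax, ('o, 'm, 'x, 'a, 'p, 'b) modif,
     ('o, 'm, 'x, 'a, 'p, 'b) lax, ('o, 'm, 'x, 'a, 'p, 'b) modif) ntrans) psf" where
  "cocones X K = \<lparr>P0 = K, P1 = post_cocones X K,
     P2 = (\<lambda>\<sigma>. \<lparr>NSrc = post_cocones X K (NSrc \<sigma>), NTrg = post_cocones X K (NTrg \<sigma>),
       NCmp = (\<lambda>\<alpha>\<in>Ob (K (FSrc (NSrc \<sigma>))).
         \<lparr>MSrc = post_lax X (NSrc \<sigma>) \<alpha>, MTrg = post_lax X (NTrg \<sigma>) \<alpha>,
          MCmp = (\<lambda>i\<in>Ob0 X. nwhr \<sigma> (L0 \<alpha> i))\<rparr>)\<rparr>),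
     PUn = (\<lambda>B. nid (fid (K B))),
     PCp = (\<lambda>G F. nid (post_cocones X K (fcmp G F)))\<rparr>"

text \<open>
  \<open>C\<close> represents \<open>P\<close>: there is a pseudonatural transformation from \<open>[C, -]\<close> to \<open>P\<close> all of
  whose components are equivalences of categories.
\<close>

definition represents ::
  "('x, 'a) cat \<Rightarrow>
   (('p, 'b) cat, ('p, 'b, 'p, 'b) func, ('p, 'b, 'p, 'b) ntrans,
    ('q, 'c) cat, ('q, 'c, 'q, 'c) func, ('q, 'c, 'q, 'c) ntrans) psf \<Rightarrow> bool" where
  "represents C P \<longleftrightarrow> category C \<and>
     (\<exists>\<alpha> \<in> Ob (Ps Cat (hom_from C) P). \<forall>B \<in> Ob0 Cat. equivalence (L0 \<alpha> B))"

text \<open>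
  The type arguments \<open>'p\<close> and \<open>'b\<close> fix the categories \<open>B\<close> against which the universal
  property is tested.
\<close>

definition is_lax_colimit ::
  "'p itself \<Rightarrow> 'b itself \<Rightarrow> ('o, 'm, 't) bicat \<Rightarrow>
   ('o, 'm, 't, ('x, 'a) cat, ('x, 'a, 'x, 'a) func, ('x, 'a, 'x, 'a) ntrans) psf \<Rightarrow>
   ('y, 'c) cat \<Rightarrow> bool" where
  "is_lax_colimit _ _ X D C \<longleftrightarrow>
     represents C (cocones X (\<lambda>B :: ('p, 'b) cat. Lax X D (Delta B)))"

definition is_colimit ::
  "'p itself \<Rightarrow> 'b itself \<Rightarrow> ('o, 'm, 't) bicat \<Rightarrow>
   ('o, 'm, 't, ('x, 'a) cat, ('x, 'a, 'x, 'a) func, ('x, 'a, 'x, 'a) ntrans) psf \<Rightarrow>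
   ('y, 'c) cat \<Rightarrow> bool" where
  "is_colimit _ _ X D C \<longleftrightarrow>
     represents C (cocones X (\<lambda>B :: ('p, 'b) cat. Ps X D (Delta B)))"


section \<open>The 2-category of elements\<close>

record ('o, 'm, 'x, 'a) el1 =
  ESrc :: "'o \<times> 'x"
  ETrg :: "'o \<times> 'x"
  EBase :: "'m"
  EFib :: "'a"

record ('o, 'm, 't, 'x, 'a) el2 =
  CSrc :: "('o, 'm, 'x, 'a) el1"
  CTrg :: "('o, 'm, 'x, 'a) el1"
  CBase :: "'t"

text \<open>
  The composite of \<open>f : m\<^sub>*x \<rightarrow> y\<close> and \<open>g : n\<^sub>*y \<rightarrow> z\<close> is
  \<open>(n m)\<^sub>*x \<cong> n\<^sub>*m\<^sub>*x \<rightarrow> n\<^sub>*y \<rightarrow> z\<close>, and the identity of \<open>x\<close> is \<open>1\<^sub>*x \<cong> x\<close>; the isomorphisms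
  are inverses of the structure cells of \<open>D\<close>.
\<close>

definition el_id ::
  "('o, 'm, 't) bicat \<Rightarrow>
   ('o, 'm, 't, ('x, 'a) cat, ('x, 'a, 'x, 'a) func, ('x, 'a, 'x, 'a) ntrans) psf \<Rightarrow>
   'o \<times> 'x \<Rightarrow> ('o, 'm, 'x, 'a) el1" where
  "el_id J D = (\<lambda>(j, x). \<lparr>ESrc = (j, x), ETrg = (j, x), EBase = Id1 J j,
     EFib = inv_ar (P0 D j) (NCmp (PUn D j) x)\<rparr>)"

definition el_cmp ::
  "('o, 'm, 't) bicat \<Rightarrow>
   ('o, 'm, 't, ('x, 'a) cat, ('x, 'a, 'x, 'a) func, ('x, 'a, 'x, 'a) ntrans) psf \<Rightarrow>
   ('o, 'm, 'x, 'a) el1 \<Rightarrow> ('o, 'm, 'x, 'a) el1 \<Rightarrow> ('o, 'm, 'x, 'a) el1" where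
  "el_cmp J D v u = (let K = P0 D (fst (ETrg v)) in
     \<lparr>ESrc = ESrc u, ETrg = ETrg v, EBase = Cmp1 J (EBase v) (EBase u),
      EFib = Cmp K (EFib v) (Cmp K (FAr (P1 D (EBase v)) (EFib u))
        (inv_ar K (NCmp (PCp D (EBase v) (EBase u)) (snd (ESrc u)))))\<rparr>)"

definition elements ::
  "('o, 'm, 't) bicat \<Rightarrow>
   ('o, 'm, 't, ('x, 'a) cat, ('x, 'a, 'x, 'a) func, ('x, 'a, 'x, 'a) ntrans) psf \<Rightarrow>
   ('o \<times> 'x, ('o, 'm, 'x, 'a) el1, ('o, 'm, 't, 'x, 'a) el2) bicat" where
  "elements J D =
    (let A1 = {u. fst (ESrc u) \<in> Ob0 J \<and> snd (ESrc u) \<in> Ob (P0 D (fst (ESrc u))) \<and>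
           fst (ETrg u) \<in> Ob0 J \<and> snd (ETrg u) \<in> Ob (P0 D (fst (ETrg u))) \<and>
           EBase u \<in> cell1 J (fst (ESrc u)) (fst (ETrg u)) \<and>
           EFib u \<in> hom (P0 D (fst (ETrg u))) (FOb (P1 D (EBase u)) (snd (ESrc u))) (snd (ETrg u))}
     in
     \<lparr>Ob0 = (SIGMA j : Ob0 J. Ob (P0 D j)),
      Ar1 = A1,
      Ar2 = {c. CSrc c \<in> A1 \<and> CTrg c \<in> A1 \<and>
        ESrc (CTrg c) = ESrc (CSrc c) \<and> ETrg (CTrg c) = ETrg (CSrc c) \<and>
        CBase c \<in> cell2 J (EBase (CSrc c)) (EBase (CTrg c)) \<and>
        Cmp (P0 D (fst (ETrg (CSrc c)))) (EFib (CTrg c)) (NCmp (P2 D (CBase c)) (snd (ESrc (CSrc c)))) =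
        EFib (CSrc c)},
      Src1 = ESrc, Trg1 = ETrg, Src2 = CSrc, Trg2 = CTrg,
      Id1 = el_id J D,
      Cmp1 = el_cmp J D,
      Id2 = (\<lambda>u. \<lparr>CSrc = u, CTrg = u, CBase = Id2 J (EBase u)\<rparr>),
      VCmp = (\<lambda>d c. \<lparr>CSrc = CSrc c, CTrg = CTrg d, CBase = VCmp J (CBase d) (CBase c)\<rparr>),
      HCmp = (\<lambda>d c. \<lparr>CSrc = el_cmp J D (CSrc d) (CSrc c), CTrg = el_cmp J D (CTrg d) (CTrg c),
        CBase = HCmp J (CBase d) (CBase c)\<rparr>),
      Asc = (\<lambda>w v u. \<lparr>CSrc = el_cmp J D (el_cmp J D w v) u, CTrg = el_cmp J D w (el_cmp J D v u),
        CBase = Asc J (EBase w) (EBase v) (EBase u)\<rparr>),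
      LUn = (\<lambda>u. \<lparr>CSrc = el_cmp J D (el_id J D (ETrg u)) u, CTrg = u, CBase = LUn J (EBase u)\<rparr>),
      RUn = (\<lambda>u. \<lparr>CSrc = el_cmp J D u (el_id J D (ESrc u)), CTrg = u, CBase = RUn J (EBase u)\<rparr>)\<rparr>)"

definition opcartesian ::
  "('o, 'm, 't) bicat \<Rightarrow>
   ('o, 'm, 't, ('x, 'a) cat, ('x, 'a, 'x, 'a) func, ('x, 'a, 'x, 'a) ntrans) psf \<Rightarrow>
   ('o, 'm, 'x, 'a) el1 set" where
  "opcartesian J D = {u \<in> Ar1 (elements J D). is_iso (P0 D (fst (ETrg u))) (EFib u)}"


section \<open>Connected components of hom-categories\<close>

definition component :: "('o, 'a) cat \<Rightarrow> 'o \<Rightarrow> 'o set" where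
  "component C x = (let R = {(Dom C f, Cod C f) | f. f \<in> Ar C} in (R \<union> R\<inverse>)\<^sup>* `` {x})"

definition pi_class :: "('o, 'm, 't) bicat \<Rightarrow> 'm \<Rightarrow> 'm set" where
  "pi_class X f = component (hom_cat X (Src1 X f) (Trg1 X f)) f"

text \<open>All members of an arrow of \<open>pi_cat X\<close> have the same source and the same target.\<close>

definition pi_cat :: "('o, 'm, 't) bicat \<Rightarrow> ('o, 'm set) cat" where
  "pi_cat X = \<lparr>Ob = Ob0 X, Ar = pi_class X ` Ar1 X,
     Dom = (\<lambda>P. the_elem (Src1 X ` P)),
     Cod = (\<lambda>P. the_elem (Trg1 X ` P)),
     Idt = (\<lambda>x. pi_class X (Id1 X x)),
     Cmp = (\<lambda>Q P. \<Union>g\<in>Q. \<Union>f\<in>P. pi_class X (Cmp1 X g f))\<rparr>"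

end

theory Submission
  imports Defs
begin

text \<open>
  Write \<open>E\<close> for the bicategory of elements of \<open>D\<close>. Every 1-cell \<open>(m, f : m\<^sub>*x \<rightarrow> y)\<close> of \<open>E\<close> is
  connected by a 2-cell with the composite of the opcartesian lift \<open>(m, 1) : x \<rightarrow> m\<^sub>*x\<close> and of the
  vertical 1-cell given by \<open>f\<close> (lemma \<open>cl_decompose\<close>). A functor \<open>G\<close> on \<open>pi_cat E\<close> is therefore known once
  it is known on the fibres, where it gives functors \<open>\<alpha>\<^sub>i : Di \<rightarrow> B\<close>, and on the lifts, where it gives
  transformations \<open>\<alpha>\<^sub>m\<close>; conversely a lax cocone \<open>\<alpha>\<close> assigns \<open>\<alpha>\<^sub>j(f) \<alpha>\<^sub>m(x)\<close> to \<open>(m, f)\<close>. The axioms of a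
  lax cocone say precisely that this assignment respects 2-cells, identities and composites, so
  the two notions agree on the nose (\<open>fun_cat_iso_Lax\<close>). The functor \<open>G\<close> inverts the opcartesian
  1-cells if and only if all \<open>\<alpha>\<^sub>m\<close> are invertible (\<open>lax_of_invertible_iff\<close>).

  That \<open>E\<close> is a bicategory (\<open>elements_bicategory\<close>) rests on the coherence axioms of \<open>D\<close>, which say that
  associators and unitors of \<open>J\<close> are compatible with the fibre parts of 1-cells. A pseudofunctor
  into a locally discrete bicategory amounts to a functor on connected components
  (\<open>fun_cat_iso_psf_cat\<close>), and the category of fractions has its universal property strictly
  (\<open>fun_cat_fractions_iso\<close>). So all equivalences of the theorem are isomorphisms of categories.

  For the universal properties, these isomorphisms from \<open>[C, B]\<close> to the category of (lax) cocones
  commute strictly with postcomposition by functors and transformations. Along them the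
  2-functoriality of \<open>[C, -]\<close> is transported to cocones, and they form a strict 2-natural
  transformation (locale \<open>strict_representation\<close>).
\<close>

section \<open>Calculus of categories, functors and transformations\<close>

text \<open>
  Membership in hom-sets is split into conditions on \<open>Dom\<close> and \<open>Cod\<close> throughout: in this form all
  premises of the laws of a category are instantiated by matching, so the simplifier checks them.
\<close>

lemma Dom_Ob [simp]: "category C \<Longrightarrow> f \<in> Ar C \<Longrightarrow> Dom C f \<in> Ob C"
  by (rule category.Dom_in)

lemma Cod_Ob [simp]: "category C \<Longrightarrow> f \<in> Ar C \<Longrightarrow> Cod C f \<in> Ob C"
  by (rule category.Cod_in)

lemma Idt_simps [simp]:
  assumes "category C" "x \<in> Ob C"
  shows "Idt C x \<in> Ar C" "Dom C (Idt C x) = x" "Cod C (Idt C x) = x"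
  using category.Idt_in[OF assms] by (auto simp: hom_def)

lemma Cmp_simps [simp]:
  assumes "category C" "f \<in> Ar C" "g \<in> Ar C" "Cod C f = Dom C g"
  shows "Cmp C g f \<in> Ar C" "Dom C (Cmp C g f) = Dom C f" "Cod C (Cmp C g f) = Cod C g"
  using category.Cmp_in[OF assms(1), of f "Dom C f" "Cod C f" g "Cod C g"] assms
  by (auto simp: hom_def)

lemma Cmp_Idt_l [simp]: "category C \<Longrightarrow> f \<in> Ar C \<Longrightarrow> Cod C f = x \<Longrightarrow> Cmp C (Idt C x) f = f"
  by (rule category.Cmp_Idt_left) (auto simp: hom_def)

lemma Cmp_Idt_r [simp]: "category C \<Longrightarrow> f \<in> Ar C \<Longrightarrow> Dom C f = x \<Longrightarrow> Cmp C f (Idt C x) = f"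
  by (rule category.Cmp_Idt_right) (auto simp: hom_def)

lemma Cmp_asc [simp]:
  "category C \<Longrightarrow> f \<in> Ar C \<Longrightarrow> g \<in> Ar C \<Longrightarrow> h \<in> Ar C \<Longrightarrow> Cod C f = Dom C g \<Longrightarrow> Cod C g = Dom C h \<Longrightarrow>
    Cmp C (Cmp C h g) f = Cmp C h (Cmp C g f)"
  by (rule category.Cmp_assoc) (auto simp: hom_def)

lemma categoryI:
  assumes "\<And>f. f \<in> Ar C \<Longrightarrow> Dom C f \<in> Ob C"
    and "\<And>f. f \<in> Ar C \<Longrightarrow> Cod C f \<in> Ob C"
    and "\<And>x. x \<in> Ob C \<Longrightarrow> Idt C x \<in> Ar C \<and> Dom C (Idt C x) = x \<and> Cod C (Idt C x) = x"
    and "\<And>f g. f \<in> Ar C \<Longrightarrow> g \<in> Ar C \<Longrightarrow> Cod C f = Dom C g \<Longrightarrow>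
      Cmp C g f \<in> Ar C \<and> Dom C (Cmp C g f) = Dom C f \<and> Cod C (Cmp C g f) = Cod C g"
    and "\<And>f. f \<in> Ar C \<Longrightarrow> Cmp C (Idt C (Cod C f)) f = f"
    and "\<And>f. f \<in> Ar C \<Longrightarrow> Cmp C f (Idt C (Dom C f)) = f"
    and "\<And>f g h. f \<in> Ar C \<Longrightarrow> g \<in> Ar C \<Longrightarrow> h \<in> Ar C \<Longrightarrow> Cod C f = Dom C g \<Longrightarrow> Cod C g = Dom C h \<Longrightarrow>
      Cmp C (Cmp C h g) f = Cmp C h (Cmp C g f)"
  shows "category C"
  using assms by unfold_locales (auto simp: hom_def)

lemma inverse_ar_unique:
  assumes C: "category C" and g: "inverse_ar C f g" and h: "inverse_ar C f h"
  shows "g = h"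
proof -
  have t: "f \<in> Ar C" "g \<in> Ar C" "Dom C g = Cod C f" "Cod C g = Dom C f"
    "h \<in> Ar C" "Dom C h = Cod C f" "Cod C h = Dom C f"
    "Cmp C g f = Idt C (Dom C f)" "Cmp C f h = Idt C (Cod C f)"
    using g h by (auto simp: inverse_ar_def hom_def)
  have "g = Cmp C g (Cmp C f h)" using C t by simp
  also have "\<dots> = Cmp C (Cmp C g f) h" using C t by (subst Cmp_asc) auto
  also have "\<dots> = h" using C t by simp
  finally show ?thesis .
qed

lemma inv_ar_eq: "category C \<Longrightarrow> inverse_ar C f g \<Longrightarrow> inv_ar C f = g"
  unfolding inv_ar_def by (rule the_equality) (auto intro: inverse_ar_unique)

lemma is_isoI: "f \<in> Ar C \<Longrightarrow> g \<in> Ar C \<Longrightarrow> Dom C g = Cod C f \<Longrightarrow> Cod C g = Dom C f \<Longrightarrow>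
    Cmp C g f = Idt C (Dom C f) \<Longrightarrow> Cmp C f g = Idt C (Cod C f) \<Longrightarrow> is_iso C f"
  by (auto simp: is_iso_def inverse_ar_def hom_def)

lemma inv_ar_simps [simp]:
  assumes C: "category C" and f: "is_iso C f"
  shows "inv_ar C f \<in> Ar C" "Dom C (inv_ar C f) = Cod C f" "Cod C (inv_ar C f) = Dom C f"
    "Cmp C (inv_ar C f) f = Idt C (Dom C f)" "Cmp C f (inv_ar C f) = Idt C (Cod C f)"
proof -
  obtain g where "inverse_ar C f g" using f by (auto simp: is_iso_def)
  then show "inv_ar C f \<in> Ar C" "Dom C (inv_ar C f) = Cod C f" "Cod C (inv_ar C f) = Dom C f"
    "Cmp C (inv_ar C f) f = Idt C (Dom C f)" "Cmp C f (inv_ar C f) = Idt C (Cod C f)"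
    using inv_ar_eq[OF C, of f g] by (auto simp: inverse_ar_def hom_def)
qed

lemma iso_Ar: "is_iso C f \<Longrightarrow> f \<in> Ar C"
  by (auto simp: is_iso_def inverse_ar_def)

lemma inv_cancel [simp]:
  assumes C: "category C" and f: "is_iso C f" and g: "g \<in> Ar C"
  shows "Cod C g = Dom C f \<Longrightarrow> Cmp C (inv_ar C f) (Cmp C f g) = g"
    and "Cod C g = Cod C f \<Longrightarrow> Cmp C f (Cmp C (inv_ar C f) g) = g"
  using C f g iso_Ar[OF f] by (simp_all flip: Cmp_asc)

lemma iso_epi:
  assumes C: "category C" and k: "is_iso C k" and t: "f \<in> Ar C" "g \<in> Ar C"
    "Dom C f = Cod C k" "Dom C g = Cod C k" and e: "Cmp C f k = Cmp C g k"
  shows "f = g"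
proof -
  have "Cmp C (Cmp C f k) (inv_ar C k) = Cmp C (Cmp C g k) (inv_ar C k)" using e by simp
  then show ?thesis using C k t iso_Ar[OF k] by simp
qed

lemma is_iso_Idt [simp]: "category C \<Longrightarrow> x \<in> Ob C \<Longrightarrow> is_iso C (Idt C x)"
  by (rule is_isoI[where g = "Idt C x"]) auto

lemma is_iso_Cmp:
  assumes C: "category C" and f: "is_iso C f" and g: "is_iso C g" and e: "Cod C f = Dom C g"
  shows "is_iso C (Cmp C g f)"
  using assms iso_Ar[OF f] iso_Ar[OF g]
  by (intro is_isoI[where g = "Cmp C (inv_ar C f) (inv_ar C g)"]) simp_all

subsection \<open>Functors\<close>

lemma functor_simps [simp]:
  assumes F: "is_functor F"
  shows "category (FSrc F)" "category (FTrg F)"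
    "FSrc F = C \<Longrightarrow> FOb F \<in> extensional (Ob C)" "FSrc F = C \<Longrightarrow> FAr F \<in> extensional (Ar C)"
  using F by (auto simp: is_functor_def)

lemma functor_cats: "is_functor F \<Longrightarrow> FSrc F = C \<Longrightarrow> category C"
  "is_functor F \<Longrightarrow> FTrg F = B \<Longrightarrow> category B"
  by auto

lemma FOb_simp [simp]: "is_functor F \<Longrightarrow> FTrg F = B \<Longrightarrow> x \<in> Ob (FSrc F) \<Longrightarrow> FOb F x \<in> Ob B"
  using is_functor.FOb_in by auto

lemma FAr_simps [simp]:
  assumes "is_functor F" "FTrg F = B" "f \<in> Ar (FSrc F)"
  shows "FAr F f \<in> Ar B" "Dom B (FAr F f) = FOb F (Dom (FSrc F) f)"
    "Cod B (FAr F f) = FOb F (Cod (FSrc F) f)"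
  using is_functor.FAr_in[OF assms(1), of f] assms by (auto simp: hom_def)

lemma FAr_Idt_simp [simp]: "is_functor F \<Longrightarrow> FSrc F = C \<Longrightarrow> x \<in> Ob C \<Longrightarrow> FAr F (Idt C x) = Idt (FTrg F) (FOb F x)"
  using is_functor.FAr_Idt by auto

lemma FAr_Cmp_simp [simp]:
  "is_functor F \<Longrightarrow> FSrc F = C \<Longrightarrow> f \<in> Ar C \<Longrightarrow> g \<in> Ar C \<Longrightarrow> Cod C f = Dom C g \<Longrightarrow>
    FAr F (Cmp C g f) = Cmp (FTrg F) (FAr F g) (FAr F f)"
  using is_functor.FAr_Cmp[of F f "Dom C f" "Cod C f" g "Cod C g"] by (auto simp: hom_def)

lemma functorI:
  assumes "category C" "category B"
    and "FSrc F = C" "FTrg F = B" "FOb F \<in> extensional (Ob C)" "FAr F \<in> extensional (Ar C)"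
    and "\<And>x. x \<in> Ob C \<Longrightarrow> FOb F x \<in> Ob B"
    and "\<And>f. f \<in> Ar C \<Longrightarrow> FAr F f \<in> Ar B \<and> Dom B (FAr F f) = FOb F (Dom C f) \<and> Cod B (FAr F f) = FOb F (Cod C f)"
    and "\<And>x. x \<in> Ob C \<Longrightarrow> FAr F (Idt C x) = Idt B (FOb F x)"
    and "\<And>f g. f \<in> Ar C \<Longrightarrow> g \<in> Ar C \<Longrightarrow> Cod C f = Dom C g \<Longrightarrow> FAr F (Cmp C g f) = Cmp B (FAr F g) (FAr F f)"
  shows "is_functor F"
  using assms by unfold_locales (auto simp: hom_def)

lemma functor_eqI:
  fixes F G :: "('o, 'a, 'p, 'b) func"
  assumes "is_functor F" "is_functor G" "FSrc F = FSrc G" "FTrg F = FTrg G"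
    and "\<And>x. x \<in> Ob (FSrc G) \<Longrightarrow> FOb F x = FOb G x"
    and "\<And>f. f \<in> Ar (FSrc G) \<Longrightarrow> FAr F f = FAr G f"
  shows "F = G"
proof (rule func.equality)
  have "FOb F \<in> extensional (Ob (FSrc G))" "FAr F \<in> extensional (Ar (FSrc G))"
    using functor_simps(3,4)[OF assms(1,3)] by simp_all
  then show "FOb F = FOb G" "FAr F = FAr G"
    using assms(2,5,6) by (auto intro: extensionalityI)
qed (use assms(3,4) in auto)

lemma functor_iso:
  assumes F: "is_functor F" and f: "is_iso (FSrc F) f"
  shows "is_iso (FTrg F) (FAr F f)"
proof (rule is_isoI[where g = "FAr F (inv_ar (FSrc F) f)"])
  show "Cmp (FTrg F) (FAr F (inv_ar (FSrc F) f)) (FAr F f) = Idt (FTrg F) (Dom (FTrg F) (FAr F f))"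
    using F f iso_Ar[OF f] by (simp flip: FAr_Cmp_simp)
  show "Cmp (FTrg F) (FAr F f) (FAr F (inv_ar (FSrc F) f)) = Idt (FTrg F) (Cod (FTrg F) (FAr F f))"
    using F f iso_Ar[OF f] by (simp flip: FAr_Cmp_simp)
qed (use F f iso_Ar[OF f] in auto)

lemma functor_inv_ar:
  assumes F: "is_functor F" and f: "is_iso (FSrc F) f"
  shows "FAr F (inv_ar (FSrc F) f) = inv_ar (FTrg F) (FAr F f)"
proof -
  have "inverse_ar (FTrg F) (FAr F f) (FAr F (inv_ar (FSrc F) f))"
    unfolding inverse_ar_def hom_def using F f iso_Ar[OF f] by (simp flip: FAr_Cmp_simp)
  then show ?thesis using F by (simp add: inv_ar_eq)
qed

lemma fid_simps [simp]: "FSrc (fid C) = C" "FTrg (fid C) = C"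
  "x \<in> Ob C \<Longrightarrow> FOb (fid C) x = x" "f \<in> Ar C \<Longrightarrow> FAr (fid C) f = f"
  by (auto simp: fid_def)

lemma fid_functor [simp]: "category C \<Longrightarrow> is_functor (fid C)"
  by (rule functorI) (auto simp: fid_def)

lemma fcmp_simps [simp]: "FSrc (fcmp G F) = FSrc F" "FTrg (fcmp G F) = FTrg G"
  "x \<in> Ob (FSrc F) \<Longrightarrow> FOb (fcmp G F) x = FOb G (FOb F x)"
  "f \<in> Ar (FSrc F) \<Longrightarrow> FAr (fcmp G F) f = FAr G (FAr F f)"
  by (auto simp: fcmp_def)

lemma fcmp_functor [simp]:
  "is_functor F \<Longrightarrow> is_functor G \<Longrightarrow> FSrc G = FTrg F \<Longrightarrow> is_functor (fcmp G F)"
  by (rule functorI[where C = "FSrc F" and B = "FTrg G"]) (auto simp: fcmp_def)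

lemma fcmp_fid_l [simp]: "is_functor F \<Longrightarrow> FTrg F = C \<Longrightarrow> fcmp (fid C) F = F"
  by (rule functor_eqI) auto

lemma fcmp_fid_r [simp]: "is_functor F \<Longrightarrow> FSrc F = C \<Longrightarrow> fcmp F (fid C) = F"
  by (rule functor_eqI) auto

lemma fcmp_assoc [simp]:
  "is_functor F \<Longrightarrow> is_functor G \<Longrightarrow> is_functor H \<Longrightarrow> FSrc G = FTrg F \<Longrightarrow> FSrc H = FTrg G \<Longrightarrow>
    fcmp (fcmp H G) F = fcmp H (fcmp G F)"
  by (rule functor_eqI) auto

subsection \<open>Natural transformations\<close>

lemma ntrans_simps [simp]:
  assumes "is_ntrans \<tau>"
  shows "is_functor (NSrc \<tau>)" "is_functor (NTrg \<tau>)"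
    "FSrc (NTrg \<tau>) = FSrc (NSrc \<tau>)" "FTrg (NTrg \<tau>) = FTrg (NSrc \<tau>)"
    "FSrc (NSrc \<tau>) = C \<Longrightarrow> NCmp \<tau> \<in> extensional (Ob C)"
  using assms by (auto simp: is_ntrans_def)

lemma NCmp_simps [simp]:
  assumes "is_ntrans \<tau>" "FTrg (NSrc \<tau>) = B" "x \<in> Ob (FSrc (NSrc \<tau>))"
  shows "NCmp \<tau> x \<in> Ar B" "Dom B (NCmp \<tau> x) = FOb (NSrc \<tau>) x" "Cod B (NCmp \<tau> x) = FOb (NTrg \<tau>) x"
  using is_ntrans.NCmp_in[OF assms(1,3)] assms(2) by (auto simp: hom_def)

lemma ntrans_nat:
  assumes "is_ntrans \<tau>" "FTrg (NSrc \<tau>) = B" "FSrc (NSrc \<tau>) = C" "f \<in> Ar C" "Dom C f = x" "Cod C f = y"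
  shows "Cmp B (FAr (NTrg \<tau>) f) (NCmp \<tau> x) = Cmp B (NCmp \<tau> y) (FAr (NSrc \<tau>) f)"
  using is_ntrans.naturality[OF assms(1), of f x y] assms by (auto simp: hom_def)

lemma ntransI:
  assumes "is_functor F" "is_functor G" "NSrc \<tau> = F" "NTrg \<tau> = G"
    "FSrc F = C" "FTrg F = B" "FSrc G = C" "FTrg G = B"
    and "NCmp \<tau> \<in> extensional (Ob C)"
    and "\<And>x. x \<in> Ob C \<Longrightarrow> NCmp \<tau> x \<in> Ar B \<and> Dom B (NCmp \<tau> x) = FOb F x \<and> Cod B (NCmp \<tau> x) = FOb G x"
    and "\<And>f. f \<in> Ar C \<Longrightarrow> Cmp B (FAr G f) (NCmp \<tau> (Dom C f)) = Cmp B (NCmp \<tau> (Cod C f)) (FAr F f)"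
  shows "is_ntrans \<tau>"
  using assms by unfold_locales (auto simp: hom_def)

lemma ntrans_eqI:
  fixes \<sigma> \<tau> :: "('o, 'a, 'p, 'b) ntrans"
  assumes "is_ntrans \<sigma>" "is_ntrans \<tau>" "NSrc \<sigma> = NSrc \<tau>" "NTrg \<sigma> = NTrg \<tau>"
    and "\<And>x. x \<in> Ob (FSrc (NSrc \<tau>)) \<Longrightarrow> NCmp \<sigma> x = NCmp \<tau> x"
  shows "\<sigma> = \<tau>"
proof (rule ntrans.equality)
  have "NCmp \<sigma> \<in> extensional (Ob (FSrc (NSrc \<tau>)))"
    using ntrans_simps(5)[OF assms(1)] assms(3) by simp
  then show "NCmp \<sigma> = NCmp \<tau>"
    by (rule extensionalityI) (use assms(2,5) in simp_all)
qed (use assms(3,4) in auto)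

lemma nid_simps [simp]: "NSrc (nid F) = F" "NTrg (nid F) = F"
  "x \<in> Ob (FSrc F) \<Longrightarrow> NCmp (nid F) x = Idt (FTrg F) (FOb F x)"
  by (auto simp: nid_def)

lemma nid_ntrans [simp]: "is_functor F \<Longrightarrow> is_ntrans (nid F)"
  by (rule ntransI[where C = "FSrc F" and B = "FTrg F"]) (auto simp: nid_def)

lemma nvcmp_simps [simp]: "NSrc (nvcmp \<sigma> \<tau>) = NSrc \<tau>" "NTrg (nvcmp \<sigma> \<tau>) = NTrg \<sigma>"
  "x \<in> Ob (FSrc (NSrc \<tau>)) \<Longrightarrow> NCmp (nvcmp \<sigma> \<tau>) x = Cmp (FTrg (NSrc \<tau>)) (NCmp \<sigma> x) (NCmp \<tau> x)"
  by (auto simp: nvcmp_def)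

lemma nhcmp_simps [simp]: "NSrc (nhcmp \<sigma> \<tau>) = fcmp (NSrc \<sigma>) (NSrc \<tau>)"
  "NTrg (nhcmp \<sigma> \<tau>) = fcmp (NTrg \<sigma>) (NTrg \<tau>)"
  "x \<in> Ob (FSrc (NSrc \<tau>)) \<Longrightarrow> NCmp (nhcmp \<sigma> \<tau>) x =
     Cmp (FTrg (NSrc \<sigma>)) (NCmp \<sigma> (FOb (NTrg \<tau>) x)) (FAr (NSrc \<sigma>) (NCmp \<tau> x))"
  by (auto simp: nhcmp_def)

lemma nvcmp_ntrans [simp]:
  assumes s: "is_ntrans \<sigma>" and t: "is_ntrans \<tau>" and e: "NSrc \<sigma> = NTrg \<tau>"
  shows "is_ntrans (nvcmp \<sigma> \<tau>)"
proof (rule ntransI[where C = "FSrc (NSrc \<tau>)" and B = "FTrg (NSrc \<tau>)"])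
  fix f assume f: "f \<in> Ar (FSrc (NSrc \<tau>))"
  let ?C = "FSrc (NSrc \<tau>)" and ?B = "FTrg (NSrc \<tau>)"
  let ?x = "Dom ?C f" and ?y = "Cod ?C f"
  have B: "category ?B" using t by simp
  have "Cmp ?B (FAr (NTrg \<sigma>) f) (Cmp ?B (NCmp \<sigma> ?x) (NCmp \<tau> ?x))
      = Cmp ?B (Cmp ?B (FAr (NTrg \<sigma>) f) (NCmp \<sigma> ?x)) (NCmp \<tau> ?x)"
    using s t e f by simp
  also have "\<dots> = Cmp ?B (Cmp ?B (NCmp \<sigma> ?y) (FAr (NSrc \<sigma>) f)) (NCmp \<tau> ?x)"
    using ntrans_nat[OF s, of ?B ?C f ?x ?y] t e f by simp
  also have "\<dots> = Cmp ?B (NCmp \<sigma> ?y) (Cmp ?B (FAr (NTrg \<tau>) f) (NCmp \<tau> ?x))"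
    using s t e f by simp
  also have "\<dots> = Cmp ?B (Cmp ?B (NCmp \<sigma> ?y) (NCmp \<tau> ?y)) (FAr (NSrc \<tau>) f)"
    using ntrans_nat[OF t, of ?B ?C f ?x ?y] s t e f by simp
  finally show "Cmp ?B (FAr (NTrg \<sigma>) f) (NCmp (nvcmp \<sigma> \<tau>) ?x) = Cmp ?B (NCmp (nvcmp \<sigma> \<tau>) ?y) (FAr (NSrc \<tau>) f)"
    using t f by simp
qed (use assms in \<open>auto simp: nvcmp_def\<close>)

lemma nhcmp_ntrans [simp]:
  assumes s: "is_ntrans \<sigma>" and t: "is_ntrans \<tau>" and e: "FSrc (NSrc \<sigma>) = FTrg (NSrc \<tau>)"
  shows "is_ntrans (nhcmp \<sigma> \<tau>)"
proof (rule ntransI[where C = "FSrc (NSrc \<tau>)" and B = "FTrg (NSrc \<sigma>)"])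
  fix f assume f: "f \<in> Ar (FSrc (NSrc \<tau>))"
  let ?C = "FSrc (NSrc \<tau>)" and ?D = "FSrc (NSrc \<sigma>)" and ?B = "FTrg (NSrc \<sigma>)"
  let ?x = "Dom ?C f" and ?y = "Cod ?C f" and ?F = "NSrc \<tau>" and ?F' = "NTrg \<tau>" and ?G = "NSrc \<sigma>" and ?G' = "NTrg \<sigma>"
  have n1: "Cmp ?B (FAr ?G' (FAr ?F' f)) (NCmp \<sigma> (FOb ?F' ?x)) = Cmp ?B (NCmp \<sigma> (FOb ?F' ?y)) (FAr ?G (FAr ?F' f))"
    using s t e f by (intro ntrans_nat[where C = ?D]) simp_all
  have n2: "Cmp ?D (FAr ?F' f) (NCmp \<tau> ?x) = Cmp ?D (NCmp \<tau> ?y) (FAr ?F f)"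
    using s t e f by (intro ntrans_nat[where C = ?C]) simp_all
  have "Cmp ?B (FAr ?G' (FAr ?F' f)) (Cmp ?B (NCmp \<sigma> (FOb ?F' ?x)) (FAr ?G (NCmp \<tau> ?x)))
     = Cmp ?B (Cmp ?B (FAr ?G' (FAr ?F' f)) (NCmp \<sigma> (FOb ?F' ?x))) (FAr ?G (NCmp \<tau> ?x))"
    using s t e f by simp
  also have "\<dots> = Cmp ?B (NCmp \<sigma> (FOb ?F' ?y)) (FAr ?G (Cmp ?D (FAr ?F' f) (NCmp \<tau> ?x)))"
    unfolding n1 using s t e f by simp
  also have "\<dots> = Cmp ?B (Cmp ?B (NCmp \<sigma> (FOb ?F' ?y)) (FAr ?G (NCmp \<tau> ?y))) (FAr ?G (FAr ?F f))"
    unfolding n2 using s t e f by simp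
  finally show "Cmp ?B (FAr (fcmp ?G' ?F') f) (NCmp (nhcmp \<sigma> \<tau>) ?x) =
      Cmp ?B (NCmp (nhcmp \<sigma> \<tau>) ?y) (FAr (fcmp ?G ?F) f)"
    using s t f by simp
qed (use assms in \<open>auto simp: nhcmp_def\<close>)

lemma nvcmp_nid_l [simp]: "is_ntrans \<tau> \<Longrightarrow> NTrg \<tau> = F \<Longrightarrow> nvcmp (nid F) \<tau> = \<tau>"
  by (rule ntrans_eqI) auto

lemma nvcmp_nid_r [simp]: "is_ntrans \<tau> \<Longrightarrow> NSrc \<tau> = F \<Longrightarrow> nvcmp \<tau> (nid F) = \<tau>"
  by (rule ntrans_eqI) auto

lemma nvcmp_assoc [simp]: "is_ntrans \<tau> \<Longrightarrow> is_ntrans \<sigma> \<Longrightarrow> is_ntrans \<rho> \<Longrightarrow> NSrc \<sigma> = NTrg \<tau> \<Longrightarrow>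
    NSrc \<rho> = NTrg \<sigma> \<Longrightarrow> nvcmp (nvcmp \<rho> \<sigma>) \<tau> = nvcmp \<rho> (nvcmp \<sigma> \<tau>)"
  by (rule ntrans_eqI) auto

lemma nhcmp_nid_nid [simp]: "is_functor F \<Longrightarrow> is_functor G \<Longrightarrow> FSrc G = FTrg F \<Longrightarrow>
    nhcmp (nid G) (nid F) = nid (fcmp G F)"
  by (rule ntrans_eqI) auto

lemma nwhl_fid [simp]: "is_ntrans \<tau> \<Longrightarrow> FTrg (NSrc \<tau>) = C \<Longrightarrow> nwhl (fid C) \<tau> = \<tau>"
  by (rule ntrans_eqI) auto

lemma nwhr_fid [simp]: "is_ntrans \<tau> \<Longrightarrow> FSrc (NSrc \<tau>) = C \<Longrightarrow> nwhr \<tau> (fid C) = \<tau>"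
  by (rule ntrans_eqI) auto

lemma nhcmp_assoc: "is_ntrans \<tau> \<Longrightarrow> is_ntrans \<sigma> \<Longrightarrow> is_ntrans \<rho> \<Longrightarrow> FSrc (NSrc \<sigma>) = FTrg (NSrc \<tau>) \<Longrightarrow>
    FSrc (NSrc \<rho>) = FTrg (NSrc \<sigma>) \<Longrightarrow> nhcmp (nhcmp \<rho> \<sigma>) \<tau> = nhcmp \<rho> (nhcmp \<sigma> \<tau>)"
  by (rule ntrans_eqI) auto

lemma nhcmp_interchange:
  assumes t: "is_ntrans \<tau>" "is_ntrans \<tau>'" "NSrc \<tau>' = NTrg \<tau>"
    and s: "is_ntrans \<sigma>" "is_ntrans \<sigma>'" "NSrc \<sigma>' = NTrg \<sigma>"
    and e: "FSrc (NSrc \<sigma>) = FTrg (NSrc \<tau>)"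
  shows "nhcmp (nvcmp \<sigma>' \<sigma>) (nvcmp \<tau>' \<tau>) = nvcmp (nhcmp \<sigma>' \<tau>') (nhcmp \<sigma> \<tau>)"
proof (rule ntrans_eqI)
  fix x assume "x \<in> Ob (FSrc (NSrc (nvcmp (nhcmp \<sigma>' \<tau>') (nhcmp \<sigma> \<tau>))))"
  then have x: "x \<in> Ob (FSrc (NSrc \<tau>))" by simp
  let ?B = "FTrg (NSrc \<sigma>)" and ?D = "FSrc (NSrc \<sigma>)"
  let ?F = "NSrc \<tau>" and ?F' = "NTrg \<tau>" and ?F'' = "NTrg \<tau>'" and ?G = "NSrc \<sigma>" and ?G' = "NTrg \<sigma>"
  have n: "Cmp ?B (FAr ?G' (NCmp \<tau>' x)) (NCmp \<sigma> (FOb ?F' x)) = Cmp ?B (NCmp \<sigma> (FOb ?F'' x)) (FAr ?G (NCmp \<tau>' x))"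
    using assms x by (intro ntrans_nat[where C = ?D]) simp_all
  have "Cmp ?B (NCmp \<sigma> (FOb ?F'' x)) (Cmp ?B (FAr ?G (NCmp \<tau>' x)) (FAr ?G (NCmp \<tau> x)))
     = Cmp ?B (Cmp ?B (NCmp \<sigma> (FOb ?F'' x)) (FAr ?G (NCmp \<tau>' x))) (FAr ?G (NCmp \<tau> x))"
    using assms x by simp
  also have "\<dots> = Cmp ?B (FAr ?G' (NCmp \<tau>' x)) (Cmp ?B (NCmp \<sigma> (FOb ?F' x)) (FAr ?G (NCmp \<tau> x)))"
    unfolding n[symmetric] using assms x by simp
  finally show "NCmp (nhcmp (nvcmp \<sigma>' \<sigma>) (nvcmp \<tau>' \<tau>)) x = NCmp (nvcmp (nhcmp \<sigma>' \<tau>') (nhcmp \<sigma> \<tau>)) x"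
    using assms x by simp
qed (use assms in auto)

lemma fun_cat_simps [simp]:
  "F \<in> Ob (fun_cat C B) \<longleftrightarrow> is_functor F \<and> FSrc F = C \<and> FTrg F = B"
  "\<tau> \<in> Ar (fun_cat C B) \<longleftrightarrow> is_ntrans \<tau> \<and> FSrc (NSrc \<tau>) = C \<and> FTrg (NSrc \<tau>) = B"
  "Dom (fun_cat C B) = NSrc" "Cod (fun_cat C B) = NTrg" "Idt (fun_cat C B) = nid" "Cmp (fun_cat C B) = nvcmp"
  by (auto simp: fun_cat_def)

lemma fun_cat_category [simp]: "category (fun_cat C B)"
  by (rule categoryI) auto

text \<open>The inverses of the components of a natural transformation are automatically natural.\<close>

lemma fun_cat_iso_iff:
  assumes t: "is_ntrans \<tau>" and C: "FSrc (NSrc \<tau>) = C" and B: "FTrg (NSrc \<tau>) = B"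
  shows "is_iso (fun_cat C B) \<tau> \<longleftrightarrow> (\<forall>x \<in> Ob C. is_iso B (NCmp \<tau> x))"
proof
  assume "is_iso (fun_cat C B) \<tau>"
  then obtain \<sigma> where s: "is_ntrans \<sigma>" "NSrc \<sigma> = NTrg \<tau>" "NTrg \<sigma> = NSrc \<tau>"
    and e: "nvcmp \<sigma> \<tau> = nid (NSrc \<tau>)" "nvcmp \<tau> \<sigma> = nid (NTrg \<tau>)"
    by (auto simp: is_iso_def inverse_ar_def hom_def)
  show "\<forall>x \<in> Ob C. is_iso B (NCmp \<tau> x)"
  proof
    fix x assume x: "x \<in> Ob C"
    show "is_iso B (NCmp \<tau> x)"
      using arg_cong[OF e(1), of "\<lambda>\<rho>. NCmp \<rho> x"] arg_cong[OF e(2), of "\<lambda>\<rho>. NCmp \<rho> x"] x s t C B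
      by (intro is_isoI[where g = "NCmp \<sigma> x"]) simp_all
  qed
next
  assume i: "\<forall>x \<in> Ob C. is_iso B (NCmp \<tau> x)"
  have cB: "category B" using t B functor_cats(2)[of "NSrc \<tau>"] by auto
  have cC: "category C" using t C functor_cats(1)[of "NSrc \<tau>"] by auto
  define \<sigma> where "\<sigma> = \<lparr>NSrc = NTrg \<tau>, NTrg = NSrc \<tau>, NCmp = (\<lambda>x\<in>Ob C. inv_ar B (NCmp \<tau> x))\<rparr>"
  have s: "is_ntrans \<sigma>"
  proof (rule ntransI[where C = C and B = B])
    fix f assume f: "f \<in> Ar C"
    let ?x = "Dom C f" and ?y = "Cod C f"
    have ob: "?x \<in> Ob C" "?y \<in> Ob C" using cC f by auto
    have ix: "is_iso B (NCmp \<tau> ?x)" and iy: "is_iso B (NCmp \<tau> ?y)" using i ob by auto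
    have n: "Cmp B (FAr (NTrg \<tau>) f) (NCmp \<tau> ?x) = Cmp B (NCmp \<tau> ?y) (FAr (NSrc \<tau>) f)"
      using t C B f by (intro ntrans_nat) auto
    have "Cmp B (FAr (NSrc \<tau>) f) (inv_ar B (NCmp \<tau> ?x)) =
        Cmp B (inv_ar B (NCmp \<tau> ?y)) (Cmp B (Cmp B (NCmp \<tau> ?y) (FAr (NSrc \<tau>) f)) (inv_ar B (NCmp \<tau> ?x)))"
      using cB ix iy t C B f ob by simp
    also have "\<dots> = Cmp B (inv_ar B (NCmp \<tau> ?y)) (FAr (NTrg \<tau>) f)"
      unfolding n[symmetric] using cB ix iy t C B f ob by simp
    finally show "Cmp B (FAr (NSrc \<tau>) f) (NCmp \<sigma> ?x) = Cmp B (NCmp \<sigma> ?y) (FAr (NTrg \<tau>) f)"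
      using ob by (simp add: \<sigma>_def)
  qed (use t C B i cB in \<open>auto simp: \<sigma>_def\<close>)
  show "is_iso (fun_cat C B) \<tau>"
  proof (rule is_isoI[where g = \<sigma>])
    show "Cmp (fun_cat C B) \<sigma> \<tau> = Idt (fun_cat C B) (Dom (fun_cat C B) \<tau>)"
      unfolding fun_cat_simps using s t C B i cB by (intro ntrans_eqI) (auto simp: \<sigma>_def)
    show "Cmp (fun_cat C B) \<tau> \<sigma> = Idt (fun_cat C B) (Cod (fun_cat C B) \<tau>)"
      unfolding fun_cat_simps using s t C B i cB by (intro ntrans_eqI) (auto simp: \<sigma>_def)
  qed (use s t C B in \<open>auto simp: \<sigma>_def\<close>)
qed

subsection \<open>The 2-category of categories\<close>

lemma Cat_simps [simp]:
  "x \<in> Ob0 Cat \<longleftrightarrow> category x" "F \<in> Ar1 Cat \<longleftrightarrow> is_functor F" "\<tau> \<in> Ar2 Cat \<longleftrightarrow> is_ntrans \<tau>"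
  "Src1 Cat = FSrc" "Trg1 Cat = FTrg" "Src2 Cat = NSrc" "Trg2 Cat = NTrg"
  "Id1 Cat = fid" "Cmp1 Cat = fcmp" "Id2 Cat = nid" "VCmp Cat = nvcmp" "HCmp Cat = nhcmp"
  "Asc Cat H G F = nid (fcmp H (fcmp G F))" "LUn Cat = nid" "RUn Cat = nid"
  by (auto simp: Cat_def)

lemma cell_Cat [simp]: "F \<in> cell1 Cat C B \<longleftrightarrow> is_functor F \<and> FSrc F = C \<and> FTrg F = B"
  "\<tau> \<in> cell2 Cat F G \<longleftrightarrow> is_ntrans \<tau> \<and> NSrc \<tau> = F \<and> NTrg \<tau> = G"
  by (auto simp: cell1_def cell2_def)

lemma hom_cat_Cat [simp]: "hom_cat Cat C B = fun_cat C B"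
proof -
  have "{\<theta>. is_ntrans \<theta> \<and> (is_functor (NSrc \<theta>) \<and> FSrc (NSrc \<theta>) = C \<and> FTrg (NSrc \<theta>) = B) \<and>
     (is_functor (NTrg \<theta>) \<and> FSrc (NTrg \<theta>) = C \<and> FTrg (NTrg \<theta>) = B)} =
     {\<theta>. is_ntrans \<theta> \<and> FSrc (NSrc \<theta>) = C \<and> FTrg (NSrc \<theta>) = B}"
    by auto
  then show ?thesis by (simp add: hom_cat_def fun_cat_def) (simp add: Cat_def cell1_def)
qed

lemma iso2_nid [simp]: "is_functor F \<Longrightarrow> iso2 Cat (nid F)"
  unfolding iso2_def by (auto simp: fun_cat_iso_iff)

lemma Cat_bicategory [simp]: "bicategory Cat"
  by (rule bicategory.intro) (auto simp: nhcmp_interchange nhcmp_assoc)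

section \<open>Isomorphisms of categories\<close>

text \<open>
  The notion of isomorphism that is shown for each equivalence of the theorem. The category axioms
  of \<open>A\<close> pass to \<open>B\<close> along the bijections; this is how lax transformations and pseudofunctors are
  seen to form categories.
\<close>

definition cat_iso :: "('o, 'a) cat \<Rightarrow> ('p, 'b) cat \<Rightarrow> ('o \<Rightarrow> 'p) \<Rightarrow> ('a \<Rightarrow> 'b) \<Rightarrow> bool" where
  "cat_iso A B f g \<longleftrightarrow> category A \<and> bij_betw f (Ob A) (Ob B) \<and> bij_betw g (Ar A) (Ar B) \<and>
     (\<forall>a\<in>Ar A. Dom B (g a) = f (Dom A a) \<and> Cod B (g a) = f (Cod A a)) \<and>
     (\<forall>x\<in>Ob A. g (Idt A x) = Idt B (f x)) \<and>
     (\<forall>a\<in>Ar A. \<forall>b\<in>Ar A. Cod A a = Dom A b \<longrightarrow> g (Cmp A b a) = Cmp B (g b) (g a))"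

lemma cat_isoI:
  assumes A: "category A"
    and f: "\<And>x. x \<in> Ob A \<Longrightarrow> f x \<in> Ob B" and f': "\<And>y. y \<in> Ob B \<Longrightarrow> f' y \<in> Ob A"
    and ff: "\<And>x. x \<in> Ob A \<Longrightarrow> f' (f x) = x" "\<And>y. y \<in> Ob B \<Longrightarrow> f (f' y) = y"
    and g: "\<And>a. a \<in> Ar A \<Longrightarrow> g a \<in> Ar B" and g': "\<And>b. b \<in> Ar B \<Longrightarrow> g' b \<in> Ar A"
    and gg: "\<And>a. a \<in> Ar A \<Longrightarrow> g' (g a) = a" "\<And>b. b \<in> Ar B \<Longrightarrow> g (g' b) = b"
    and "\<And>a. a \<in> Ar A \<Longrightarrow> Dom B (g a) = f (Dom A a)"
    and "\<And>a. a \<in> Ar A \<Longrightarrow> Cod B (g a) = f (Cod A a)"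
    and "\<And>x. x \<in> Ob A \<Longrightarrow> g (Idt A x) = Idt B (f x)"
    and "\<And>a b. a \<in> Ar A \<Longrightarrow> b \<in> Ar A \<Longrightarrow> Cod A a = Dom A b \<Longrightarrow> g (Cmp A b a) = Cmp B (g b) (g a)"
  shows "cat_iso A B f g"
proof -
  have "bij_betw f (Ob A) (Ob B)" using f f' ff by (intro bij_betw_byWitness[where f' = f']) auto
  moreover have "bij_betw g (Ar A) (Ar B)" using g g' gg by (intro bij_betw_byWitness[where f' = g']) auto
  ultimately show ?thesis using assms by (simp add: cat_iso_def)
qed

lemma cat_isoD:
  assumes "cat_iso A B f g"
  shows "category A" "x \<in> Ob A \<Longrightarrow> f x \<in> Ob B" "a \<in> Ar A \<Longrightarrow> g a \<in> Ar B"
    "a \<in> Ar A \<Longrightarrow> Dom B (g a) = f (Dom A a)" "a \<in> Ar A \<Longrightarrow> Cod B (g a) = f (Cod A a)"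
    "x \<in> Ob A \<Longrightarrow> g (Idt A x) = Idt B (f x)"
    "a \<in> Ar A \<Longrightarrow> b \<in> Ar A \<Longrightarrow> Cod A a = Dom A b \<Longrightarrow> g (Cmp A b a) = Cmp B (g b) (g a)"
    "inj_on f (Ob A)" "inj_on g (Ar A)" "f ` Ob A = Ob B" "g ` Ar A = Ar B"
    "bij_betw f (Ob A) (Ob B)" "bij_betw g (Ar A) (Ar B)"
  using assms unfolding cat_iso_def bij_betw_def by auto

lemma cat_iso_sym:
  assumes i: "cat_iso A B f g"
  shows "cat_iso B A (inv_into (Ob A) f) (inv_into (Ar A) g)"
proof -
  note D = cat_isoD[OF i]
  let ?f = "inv_into (Ob A) f" and ?g = "inv_into (Ar A) g"
  have f: "?f y \<in> Ob A" "f (?f y) = y" if "y \<in> Ob B" for y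
    using that D(10) by (auto intro: inv_into_into f_inv_into_f)
  have g: "?g b \<in> Ar A" "g (?g b) = b" if "b \<in> Ar B" for b
    using that D(11) by (auto intro: inv_into_into f_inv_into_f)
  have f2: "?f (f x) = x" if "x \<in> Ob A" for x using that D(8) by simp
  have g2: "?g (g a) = a" if "a \<in> Ar A" for a using that D(9) by simp
  have dom: "Dom B b = f (Dom A (?g b))" "Cod B b = f (Cod A (?g b))" if "b \<in> Ar B" for b
    using D(4,5)[of "?g b"] g[OF that] by simp_all
  have idt: "Idt B y = g (Idt A (?f y))" if "y \<in> Ob B" for y
    using D(6)[of "?f y"] f[OF that] by simp
  have comp: "Cod A (?g a) = Dom A (?g b)" if "a \<in> Ar B" "b \<in> Ar B" "Cod B a = Dom B b" for a b
    using dom that f2 g D(1) by (metis Cod_Ob Dom_Ob)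
  have cmp: "Cmp B b a = g (Cmp A (?g b) (?g a))" if "a \<in> Ar B" "b \<in> Ar B" "Cod B a = Dom B b" for a b
    using D(7)[of "?g a" "?g b"] g that comp[OF that] by simp
  have B: "category B"
  proof (rule categoryI)
    show "Dom B a \<in> Ob B" "Cod B a \<in> Ob B" if "a \<in> Ar B" for a using that dom g D(1,2) by simp_all
    show "Idt B x \<in> Ar B \<and> Dom B (Idt B x) = x \<and> Cod B (Idt B x) = x" if "x \<in> Ob B" for x
      using that by (simp add: idt D(1-5) f)
    show "Cmp B b a \<in> Ar B \<and> Dom B (Cmp B b a) = Dom B a \<and> Cod B (Cmp B b a) = Cod B b"
      if "a \<in> Ar B" "b \<in> Ar B" "Cod B a = Dom B b" for a b
      using that comp[OF that] by (simp add: cmp D(1-5) g) (simp add: dom)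
    show "Cmp B (Idt B (Cod B a)) a = a" if "a \<in> Ar B" for a
      using that D(7)[of "?g a" "Idt A (Cod A (?g a))"] D(6)[of "Cod A (?g a)"]
      by (simp add: D(1) g dom)
    show "Cmp B a (Idt B (Dom B a)) = a" if "a \<in> Ar B" for a
      using that D(7)[of "Idt A (Dom A (?g a))" "?g a"] D(6)[of "Dom A (?g a)"]
      by (simp add: D(1) g dom)
    show "Cmp B (Cmp B c b) a = Cmp B c (Cmp B b a)"
      if t: "a \<in> Ar B" "b \<in> Ar B" "c \<in> Ar B" "Cod B a = Dom B b" "Cod B b = Dom B c" for a b c
    proof -
      have k: "Cod A (?g a) = Dom A (?g b)" "Cod A (?g b) = Dom A (?g c)" using comp t by auto
      have "Cmp B (Cmp B c b) a = Cmp B (g (Cmp A (?g c) (?g b))) (g (?g a))"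
        using t by (simp add: cmp g)
      also have "\<dots> = g (Cmp A (?g c) (Cmp A (?g b) (?g a)))"
        using t k D(1) g D(7)[of "?g a" "Cmp A (?g c) (?g b)"] by simp
      also have "\<dots> = Cmp B (g (?g c)) (g (Cmp A (?g b) (?g a)))"
        using t k D(1) g by (intro D(7)) simp_all
      finally show ?thesis using t by (simp add: cmp g)
    qed
  qed
  show ?thesis
  proof (rule cat_isoI[where f' = f and g' = g, OF B])
    show "Dom A (?g b) = ?f (Dom B b)" "Cod A (?g b) = ?f (Cod B b)" if "b \<in> Ar B" for b
      using that by (simp_all add: dom f2 g D(1))
    show "?g (Idt B x) = Idt A (?f x)" if "x \<in> Ob B" for x
      using that by (simp add: idt g2 f D(1))
    show "?g (Cmp B b a) = Cmp A (?g b) (?g a)" if "a \<in> Ar B" "b \<in> Ar B" "Cod B a = Dom B b" for a b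
      using that comp[OF that] by (simp add: cmp g2 g D(1))
  qed (use f g f2 g2 D(2,3) in simp_all)
qed

lemma cat_iso_category: "cat_iso A B f g \<Longrightarrow> category B"
  using cat_iso_sym cat_isoD(1) by blast

lemma cat_iso_trans:
  assumes i: "cat_iso A B f g" and j: "cat_iso B C f' g'"
  shows "cat_iso A C (f' \<circ> f) (g' \<circ> g)"
  unfolding cat_iso_def
proof (intro conjI ballI impI)
  note I = cat_isoD[OF i] and K = cat_isoD[OF j]
  show "category A" by (rule I)
  show "bij_betw (f' \<circ> f) (Ob A) (Ob C)" "bij_betw (g' \<circ> g) (Ar A) (Ar C)"
    using I(12,13) K(12,13) by (auto intro: bij_betw_trans)
qed (use cat_isoD(1-7)[OF i] cat_isoD(1-7)[OF j] in simp_all)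

lemma full_sub_simps [simp]:
  "x \<in> Ob (full_sub C P) \<longleftrightarrow> x \<in> Ob C \<and> P x"
  "f \<in> Ar (full_sub C P) \<longleftrightarrow> f \<in> Ar C \<and> P (Dom C f) \<and> P (Cod C f)"
  "Dom (full_sub C P) = Dom C" "Cod (full_sub C P) = Cod C" "Idt (full_sub C P) = Idt C"
  "Cmp (full_sub C P) = Cmp C"
  by (auto simp: full_sub_def)

lemma full_sub_category: "category C \<Longrightarrow> category (full_sub C P)"
  by (rule categoryI) auto

lemma cat_iso_full_sub:
  assumes i: "cat_iso A B f g" and PQ: "\<And>x. x \<in> Ob A \<Longrightarrow> P x \<longleftrightarrow> Q (f x)"
  shows "cat_iso (full_sub A P) (full_sub B Q) f g"
proof -
  note D = cat_isoD[OF i]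
  have "bij_betw f (Ob (full_sub A P)) (Ob (full_sub B Q))"
    unfolding bij_betw_def
  proof
    show "inj_on f (Ob (full_sub A P))" using D(8) by (auto simp: inj_on_def)
    show "f ` Ob (full_sub A P) = Ob (full_sub B Q)"
    proof (intro set_eqI iffI)
      fix y assume "y \<in> f ` Ob (full_sub A P)"
      then show "y \<in> Ob (full_sub B Q)" using D(2) PQ by auto
    next
      fix y assume y: "y \<in> Ob (full_sub B Q)"
      then obtain x where "x \<in> Ob A" "y = f x" using D(10) by auto
      then show "y \<in> f ` Ob (full_sub A P)" using y PQ by auto
    qed
  qed
  moreover have "bij_betw g (Ar (full_sub A P)) (Ar (full_sub B Q))"
    unfolding bij_betw_def
  proof
    show "inj_on g (Ar (full_sub A P))" using D(9) by (auto simp: inj_on_def)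
    show "g ` Ar (full_sub A P) = Ar (full_sub B Q)"
    proof (intro set_eqI iffI)
      fix b assume "b \<in> g ` Ar (full_sub A P)"
      then show "b \<in> Ar (full_sub B Q)" using D(1-5) PQ by auto
    next
      fix b assume b: "b \<in> Ar (full_sub B Q)"
      then obtain a where "a \<in> Ar A" "b = g a" using D(11) by auto
      then show "b \<in> g ` Ar (full_sub A P)" using b D(1-5) PQ by auto
    qed
  qed
  ultimately show ?thesis
    using full_sub_category[OF D(1)] D(1-7) by (simp add: cat_iso_def)
qed

definition functor_of :: "('o, 'a) cat \<Rightarrow> ('p, 'b) cat \<Rightarrow> ('o \<Rightarrow> 'p) \<Rightarrow> ('a \<Rightarrow> 'b) \<Rightarrow> ('o, 'a, 'p, 'b) func" where
  "functor_of A B f g = \<lparr>FSrc = A, FTrg = B, FOb = restrict f (Ob A), FAr = restrict g (Ar A)\<rparr>"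

lemma functor_of_simps [simp]:
  "FSrc (functor_of A B f g) = A" "FTrg (functor_of A B f g) = B"
  "x \<in> Ob A \<Longrightarrow> FOb (functor_of A B f g) x = f x" "a \<in> Ar A \<Longrightarrow> FAr (functor_of A B f g) a = g a"
  "X = Ob A \<Longrightarrow> FOb (functor_of A B f g) \<in> extensional X"
  "Y = Ar A \<Longrightarrow> FAr (functor_of A B f g) \<in> extensional Y"
  by (auto simp: functor_of_def)

lemma cat_iso_functor: "cat_iso A B f g \<Longrightarrow> is_functor (functor_of A B f g)"
  using cat_isoD(1-7)[of A B f g] cat_iso_category[of A B f g]
  by (intro functorI[where C = A and B = B]) simp_all

lemma isomorphic_fid [simp]: "category C \<Longrightarrow> isomorphic (fun_cat C C) (fid C) (fid C)"
  unfolding isomorphic_def by (intro bexI[where x = "nid (fid C)"]) (auto simp: hom_def fun_cat_iso_iff)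

lemma cat_iso_equivalence:
  assumes i: "cat_iso A B f g"
  shows "equivalence (functor_of A B f g)"
proof -
  let ?G = "functor_of B A (inv_into (Ob A) f) (inv_into (Ar A) g)" and ?F = "functor_of A B f g"
  note D = cat_isoD[OF i]
  have F: "is_functor ?F" and G: "is_functor ?G"
    by (rule cat_iso_functor[OF i], rule cat_iso_functor[OF cat_iso_sym[OF i]])
  have A: "category A" "category B" using i D(1) cat_iso_category by auto
  have 1: "fcmp ?G ?F = fid A"
    using F G A D by (intro functor_eqI) simp_all
  have 2: "fcmp ?F ?G = fid B"
    using F G A D f_inv_into_f[where f = f and A = "Ob A"] f_inv_into_f[where f = g and A = "Ar A"]
      inv_into_into[where f = f and A = "Ob A"] inv_into_into[where f = g and A = "Ar A"]
    by (intro functor_eqI) simp_all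
  show ?thesis
    unfolding equivalence_def using F G 1 2 A by (intro conjI exI[where x = ?G]) simp_all
qed

lemma cat_iso_equivalent: "cat_iso A B f g \<Longrightarrow> A \<simeq> B"
  unfolding equivalent_def using cat_iso_equivalence[of A B f g] by (auto intro: exI[where x = "functor_of A B f g"])

lemma cat_iso_equivalent': "cat_iso A B f g \<Longrightarrow> B \<simeq> A"
  by (rule cat_iso_equivalent[OF cat_iso_sym])

section \<open>Connected components of the hom-categories of a bicategory\<close>

context bicategory
begin

lemma Ob0_simps [simp]: "f \<in> Ar1 X \<Longrightarrow> Src1 X f \<in> Ob0 X" "f \<in> Ar1 X \<Longrightarrow> Trg1 X f \<in> Ob0 X"
  by (rule Src1_in Trg1_in, assumption)+

lemma Ar2_simps [simp]: assumes "\<theta> \<in> Ar2 X" shows "Src2 X \<theta> \<in> Ar1 X" "Trg2 X \<theta> \<in> Ar1 X"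
  "Src1 X (Trg2 X \<theta>) = Src1 X (Src2 X \<theta>)" "Trg1 X (Trg2 X \<theta>) = Trg1 X (Src2 X \<theta>)"
  using assms Src2_in Trg2_in Src1_Trg2 Trg1_Trg2 by auto

lemma Id1_simps [simp]: assumes "x \<in> Ob0 X"
  shows "Id1 X x \<in> Ar1 X" "Src1 X (Id1 X x) = x" "Trg1 X (Id1 X x) = x"
  using Id1_in[OF assms] by (auto simp: cell1_def)

lemma Cmp1_simps [simp]: assumes "f \<in> Ar1 X" "g \<in> Ar1 X" "Trg1 X f = Src1 X g"
  shows "Cmp1 X g f \<in> Ar1 X" "Src1 X (Cmp1 X g f) = Src1 X f" "Trg1 X (Cmp1 X g f) = Trg1 X g"
  using Cmp1_in[of f "Src1 X f" "Trg1 X f" g "Trg1 X g"] assms by (auto simp: cell1_def)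

lemma Id2_simps [simp]: assumes "f \<in> Ar1 X"
  shows "Id2 X f \<in> Ar2 X" "Src2 X (Id2 X f) = f" "Trg2 X (Id2 X f) = f"
  using Idt_simps[OF hom_category[of "Src1 X f" "Trg1 X f"], of f] assms
  by (auto simp: hom_cat_def cell1_def)

lemma VCmp_simps [simp]: assumes "\<theta> \<in> Ar2 X" "\<phi> \<in> Ar2 X" "Trg2 X \<theta> = Src2 X \<phi>"
  shows "VCmp X \<phi> \<theta> \<in> Ar2 X" "Src2 X (VCmp X \<phi> \<theta>) = Src2 X \<theta>" "Trg2 X (VCmp X \<phi> \<theta>) = Trg2 X \<phi>"
proof -
  have "Src1 X (Src2 X \<phi>) = Src1 X (Src2 X \<theta>)" "Trg1 X (Src2 X \<phi>) = Trg1 X (Src2 X \<theta>)"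
    using assms by (metis Ar2_simps(3,4))+
  then show "VCmp X \<phi> \<theta> \<in> Ar2 X" "Src2 X (VCmp X \<phi> \<theta>) = Src2 X \<theta>" "Trg2 X (VCmp X \<phi> \<theta>) = Trg2 X \<phi>"
    using Cmp_simps[OF hom_category[of "Src1 X (Src2 X \<theta>)" "Trg1 X (Src2 X \<theta>)"], of \<theta> \<phi>] assms
    by (auto simp: hom_cat_def cell1_def)
qed

lemma VCmp_Id2 [simp]: assumes "\<theta> \<in> Ar2 X"
  shows "Trg2 X \<theta> = f \<Longrightarrow> VCmp X (Id2 X f) \<theta> = \<theta>" "Src2 X \<theta> = f \<Longrightarrow> VCmp X \<theta> (Id2 X f) = \<theta>"
  using Cmp_Idt_l[OF hom_category[of "Src1 X (Src2 X \<theta>)" "Trg1 X (Src2 X \<theta>)"], of \<theta>]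
    Cmp_Idt_r[OF hom_category[of "Src1 X (Src2 X \<theta>)" "Trg1 X (Src2 X \<theta>)"], of \<theta>] assms
  by (auto simp: hom_cat_def cell1_def)

lemma VCmp_assoc: assumes "\<theta> \<in> Ar2 X" "\<phi> \<in> Ar2 X" "\<psi> \<in> Ar2 X" "Trg2 X \<theta> = Src2 X \<phi>" "Trg2 X \<phi> = Src2 X \<psi>"
  shows "VCmp X (VCmp X \<psi> \<phi>) \<theta> = VCmp X \<psi> (VCmp X \<phi> \<theta>)"
proof -
  have "Src1 X (Src2 X \<phi>) = Src1 X (Src2 X \<theta>)" "Trg1 X (Src2 X \<phi>) = Trg1 X (Src2 X \<theta>)"
    "Src1 X (Src2 X \<psi>) = Src1 X (Src2 X \<theta>)" "Trg1 X (Src2 X \<psi>) = Trg1 X (Src2 X \<theta>)"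
    using assms by (metis Ar2_simps(3,4))+
  then show ?thesis
    using Cmp_asc[OF hom_category[of "Src1 X (Src2 X \<theta>)" "Trg1 X (Src2 X \<theta>)"], of \<theta> \<phi> \<psi>] assms
    by (auto simp: hom_cat_def cell1_def)
qed

lemma HCmp_simps [simp]: assumes "\<theta> \<in> Ar2 X" "\<phi> \<in> Ar2 X" "Trg1 X (Src2 X \<theta>) = Src1 X (Src2 X \<phi>)"
  shows "HCmp X \<phi> \<theta> \<in> Ar2 X" "Src2 X (HCmp X \<phi> \<theta>) = Cmp1 X (Src2 X \<phi>) (Src2 X \<theta>)"
    "Trg2 X (HCmp X \<phi> \<theta>) = Cmp1 X (Trg2 X \<phi>) (Trg2 X \<theta>)"
  using HCmp_in[of "Src2 X \<theta>" "Src1 X (Src2 X \<theta>)" "Trg1 X (Src2 X \<theta>)" "Src2 X \<phi>" "Trg1 X (Src2 X \<phi>)" \<theta> "Trg2 X \<theta>" \<phi> "Trg2 X \<phi>"] assms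
  by (auto simp: cell1_def cell2_def)

lemma Asc_simps [simp]: assumes "f \<in> Ar1 X" "g \<in> Ar1 X" "h \<in> Ar1 X" "Trg1 X f = Src1 X g" "Trg1 X g = Src1 X h"
  shows "Asc X h g f \<in> Ar2 X" "Src2 X (Asc X h g f) = Cmp1 X (Cmp1 X h g) f"
    "Trg2 X (Asc X h g f) = Cmp1 X h (Cmp1 X g f)" "iso2 X (Asc X h g f)"
  using Asc_in[of f "Src1 X f" "Trg1 X f" g "Trg1 X g" h "Trg1 X h"]
    Asc_iso[of f "Src1 X f" "Trg1 X f" g "Trg1 X g" h "Trg1 X h"] assms
  by (auto simp: cell1_def cell2_def)

lemma LUn_simps [simp]: assumes "f \<in> Ar1 X"
  shows "LUn X f \<in> Ar2 X" "Src2 X (LUn X f) = Cmp1 X (Id1 X (Trg1 X f)) f"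
    "Trg2 X (LUn X f) = f" "iso2 X (LUn X f)"
  using LUn_in[of f "Src1 X f" "Trg1 X f"] LUn_iso[of f "Src1 X f" "Trg1 X f"] assms
  by (auto simp: cell1_def cell2_def)

lemma RUn_simps [simp]: assumes "f \<in> Ar1 X"
  shows "RUn X f \<in> Ar2 X" "Src2 X (RUn X f) = Cmp1 X f (Id1 X (Src1 X f))"
    "Trg2 X (RUn X f) = f" "iso2 X (RUn X f)"
  using RUn_in[of f "Src1 X f" "Trg1 X f"] RUn_iso[of f "Src1 X f" "Trg1 X f"] assms
  by (auto simp: cell1_def cell2_def)

lemma iso2_iff:
  assumes "\<theta> \<in> Ar2 X"
  shows "iso2 X \<theta> \<longleftrightarrow> (\<exists>\<phi>\<in>Ar2 X. Src2 X \<phi> = Trg2 X \<theta> \<and> Trg2 X \<phi> = Src2 X \<theta> \<and>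
    VCmp X \<phi> \<theta> = Id2 X (Src2 X \<theta>) \<and> VCmp X \<theta> \<phi> = Id2 X (Trg2 X \<theta>))"
  using assms by (auto simp: iso2_def is_iso_def inverse_ar_def hom_cat_def hom_def cell1_def)

text \<open>
  A function that identifies the two ends of every 2-cell is constant on connected components, by
  induction along a zigzag of 2-cells. All maps out of \<open>pi_cat X\<close> are well defined by this.
\<close>

lemma pi_class_invariant:
  assumes f: "f \<in> Ar1 X" and g: "g \<in> pi_class X f"
    and inv: "\<And>\<theta>. \<theta> \<in> Ar2 X \<Longrightarrow> Src1 X (Src2 X \<theta>) = Src1 X f \<Longrightarrow> Trg1 X (Src2 X \<theta>) = Trg1 X f \<Longrightarrow>
      h (Src2 X \<theta>) = h (Trg2 X \<theta>)"
  shows "g \<in> Ar1 X \<and> Src1 X g = Src1 X f \<and> Trg1 X g = Trg1 X f \<and> h g = h f"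
proof -
  let ?C = "hom_cat X (Src1 X f) (Trg1 X f)"
  let ?R = "{(Dom ?C a, Cod ?C a) | a. a \<in> Ar ?C}"
  have "(f, g) \<in> (?R \<union> ?R\<inverse>)\<^sup>*" using g by (simp add: pi_class_def component_def Let_def)
  then show ?thesis
  proof induction
    case base then show ?case using f by simp
  next
    case (step y z)
    have "\<exists>\<theta>\<in>Ar2 X. Src1 X (Src2 X \<theta>) = Src1 X f \<and> Trg1 X (Src2 X \<theta>) = Trg1 X f \<and>
        ((y = Src2 X \<theta> \<and> z = Trg2 X \<theta>) \<or> (z = Src2 X \<theta> \<and> y = Trg2 X \<theta>))"
      using step(2) by (auto simp: hom_cat_def cell1_def)
    then show ?case using step(3) inv by auto
  qed
qed

lemma pi_class_self [simp]: "f \<in> pi_class X f"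
  by (simp add: pi_class_def component_def Let_def)

lemma pi_class_eqI:
  assumes t: "\<theta> \<in> Ar2 X" and f: "Src2 X \<theta> = f" and g: "Trg2 X \<theta> = g"
  shows "pi_class X f = pi_class X g"
proof -
  let ?C = "hom_cat X (Src1 X f) (Trg1 X f)"
  let ?R = "{(Dom ?C a, Cod ?C a) | a. a \<in> Ar ?C}"
  have e: "Src1 X g = Src1 X f" "Trg1 X g = Trg1 X f" using assms by auto
  have "\<theta> \<in> Ar ?C" "Dom ?C \<theta> = f" "Cod ?C \<theta> = g" using assms by (auto simp: hom_cat_def cell1_def)
  then have fg: "(f, g) \<in> ?R \<union> ?R\<inverse>" "(g, f) \<in> ?R \<union> ?R\<inverse>" by auto
  have "(f, z) \<in> (?R \<union> ?R\<inverse>)\<^sup>* \<longleftrightarrow> (g, z) \<in> (?R \<union> ?R\<inverse>)\<^sup>*" for z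
    using fg by (meson converse_rtrancl_into_rtrancl)
  then show ?thesis by (auto simp: pi_class_def component_def Let_def e)
qed

lemma the_elem_pi_class:
  assumes f: "f \<in> Ar1 X"
    and inv: "\<And>\<theta>. \<theta> \<in> Ar2 X \<Longrightarrow> Src1 X (Src2 X \<theta>) = Src1 X f \<Longrightarrow> Trg1 X (Src2 X \<theta>) = Trg1 X f \<Longrightarrow>
      h (Src2 X \<theta>) = h (Trg2 X \<theta>)"
  shows "the_elem (h ` pi_class X f) = h f"
proof -
  have "h g = h f" if "g \<in> pi_class X f" for g
    using pi_class_invariant[OF f that, of h] inv by blast
  then have "h ` pi_class X f = {h f}" using pi_class_self[of f] by blast
  then show ?thesis by simp
qed

lemma pi_cat_Ob [simp]: "Ob (pi_cat X) = Ob0 X" and pi_cat_Ar: "Ar (pi_cat X) = pi_class X ` Ar1 X"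
  and pi_cat_Idt [simp]: "Idt (pi_cat X) x = pi_class X (Id1 X x)"
  by (simp_all add: pi_cat_def)

lemma pi_cat_Ar_in [simp]: "f \<in> Ar1 X \<Longrightarrow> pi_class X f \<in> Ar (pi_cat X)"
  by (simp add: pi_cat_Ar)

lemma pi_cat_Dom [simp]: "f \<in> Ar1 X \<Longrightarrow> Dom (pi_cat X) (pi_class X f) = Src1 X f"
  and pi_cat_Cod [simp]: "f \<in> Ar1 X \<Longrightarrow> Cod (pi_cat X) (pi_class X f) = Trg1 X f"
  by (simp_all add: pi_cat_def the_elem_pi_class)

lemma pi_class_Cmp1:
  assumes f: "f \<in> Ar1 X" and g: "g \<in> Ar1 X" and fg: "Trg1 X f = Src1 X g"
    and f': "f' \<in> pi_class X f" and g': "g' \<in> pi_class X g"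
  shows "pi_class X (Cmp1 X g' f') = pi_class X (Cmp1 X g f)"
proof -
  have 1: "f' \<in> Ar1 X \<and> Src1 X f' = Src1 X f \<and> Trg1 X f' = Trg1 X f \<and>
      pi_class X (Cmp1 X g f') = pi_class X (Cmp1 X g f)"
  proof (rule pi_class_invariant[OF f f', where h = "\<lambda>f. pi_class X (Cmp1 X g f)"])
    fix \<theta> assume t: "\<theta> \<in> Ar2 X" "Trg1 X (Src2 X \<theta>) = Trg1 X f"
    show "pi_class X (Cmp1 X g (Src2 X \<theta>)) = pi_class X (Cmp1 X g (Trg2 X \<theta>))"
      using t g fg by (intro pi_class_eqI[where \<theta> = "whl X g \<theta>"]) simp_all
  qed
  have "g' \<in> Ar1 X \<and> Src1 X g' = Src1 X g \<and> Trg1 X g' = Trg1 X g \<and>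
      pi_class X (Cmp1 X g' f') = pi_class X (Cmp1 X g f')"
  proof (rule pi_class_invariant[OF g g', where h = "\<lambda>g. pi_class X (Cmp1 X g f')"])
    fix \<theta> assume t: "\<theta> \<in> Ar2 X" "Src1 X (Src2 X \<theta>) = Src1 X g"
    show "pi_class X (Cmp1 X (Src2 X \<theta>) f') = pi_class X (Cmp1 X (Trg2 X \<theta>) f')"
      using t fg 1 by (intro pi_class_eqI[where \<theta> = "whr X \<theta> f'"]) simp_all
  qed
  then show ?thesis using 1 by simp
qed

lemma pi_cat_Cmp [simp]:
  assumes f: "f \<in> Ar1 X" and g: "g \<in> Ar1 X" and fg: "Trg1 X f = Src1 X g"
  shows "Cmp (pi_cat X) (pi_class X g) (pi_class X f) = pi_class X (Cmp1 X g f)"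
proof -
  have "(\<Union>g'\<in>pi_class X g. \<Union>f'\<in>pi_class X f. pi_class X (Cmp1 X g' f')) = pi_class X (Cmp1 X g f)"
    using pi_class_Cmp1[OF assms] pi_class_self[of f] pi_class_self[of g] by blast
  then show ?thesis by (simp add: pi_cat_def)
qed

lemma pi_cat_category: "category (pi_cat X)"
proof (rule categoryI)
  fix P assume "P \<in> Ar (pi_cat X)"
  then obtain f where f: "f \<in> Ar1 X" "P = pi_class X f" by (auto simp: pi_cat_Ar)
  show "Dom (pi_cat X) P \<in> Ob (pi_cat X)" "Cod (pi_cat X) P \<in> Ob (pi_cat X)" using f by simp_all
  show "Cmp (pi_cat X) (Idt (pi_cat X) (Cod (pi_cat X) P)) P = P"
    using f by simp (rule pi_class_eqI[where \<theta> = "LUn X f"]; simp)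
  show "Cmp (pi_cat X) P (Idt (pi_cat X) (Dom (pi_cat X) P)) = P"
    using f by simp (rule pi_class_eqI[where \<theta> = "RUn X f"]; simp)
  fix Q assume "Q \<in> Ar (pi_cat X)" and PQ: "Cod (pi_cat X) P = Dom (pi_cat X) Q"
  then obtain g where g: "g \<in> Ar1 X" "Q = pi_class X g" by (auto simp: pi_cat_Ar)
  have fg: "Trg1 X f = Src1 X g" using PQ f g by simp
  show "Cmp (pi_cat X) Q P \<in> Ar (pi_cat X) \<and> Dom (pi_cat X) (Cmp (pi_cat X) Q P) = Dom (pi_cat X) P \<and>
      Cod (pi_cat X) (Cmp (pi_cat X) Q P) = Cod (pi_cat X) Q"
    using f g fg by simp
  fix R assume "R \<in> Ar (pi_cat X)" and QR: "Cod (pi_cat X) Q = Dom (pi_cat X) R"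
  then obtain h where h: "h \<in> Ar1 X" "R = pi_class X h" by (auto simp: pi_cat_Ar)
  have gh: "Trg1 X g = Src1 X h" using QR h g by simp
  show "Cmp (pi_cat X) (Cmp (pi_cat X) R Q) P = Cmp (pi_cat X) R (Cmp (pi_cat X) Q P)"
    using f g fg h gh by simp (rule pi_class_eqI[where \<theta> = "Asc X h g f"]; simp)
qed simp

text \<open>
  The functor out of \<open>pi_cat X\<close> induced by a function on 1-cells that identifies the two ends
  of every 2-cell.
\<close>

definition pi_lift :: "('p, 'b) cat \<Rightarrow> ('o \<Rightarrow> 'p) \<Rightarrow> ('m \<Rightarrow> 'b) \<Rightarrow> ('o, 'm set, 'p, 'b) func" where
  "pi_lift B k h = functor_of (pi_cat X) B k (\<lambda>P. the_elem (h ` P))"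

lemma pi_lift_functor:
  assumes B: "category B"
    and k: "\<And>x. x \<in> Ob0 X \<Longrightarrow> k x \<in> Ob B"
    and h: "\<And>f. f \<in> Ar1 X \<Longrightarrow> h f \<in> Ar B \<and> Dom B (h f) = k (Src1 X f) \<and> Cod B (h f) = k (Trg1 X f)"
    and inv: "\<And>\<theta>. \<theta> \<in> Ar2 X \<Longrightarrow> h (Src2 X \<theta>) = h (Trg2 X \<theta>)"
    and idt: "\<And>x. x \<in> Ob0 X \<Longrightarrow> h (Id1 X x) = Idt B (k x)"
    and cmp: "\<And>f g. f \<in> Ar1 X \<Longrightarrow> g \<in> Ar1 X \<Longrightarrow> Trg1 X f = Src1 X g \<Longrightarrow> h (Cmp1 X g f) = Cmp B (h g) (h f)"
  shows "is_functor (pi_lift B k h)"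
    and "f \<in> Ar1 X \<Longrightarrow> FAr (pi_lift B k h) (pi_class X f) = h f"
proof -
  have e: "the_elem (h ` pi_class X f) = h f" if "f \<in> Ar1 X" for f
    using that inv by (intro the_elem_pi_class) auto
  then show "f \<in> Ar1 X \<Longrightarrow> FAr (pi_lift B k h) (pi_class X f) = h f" for f
    by (simp add: pi_lift_def)
  show "is_functor (pi_lift B k h)"
    unfolding pi_lift_def
  proof (rule functorI[where C = "pi_cat X" and B = B])
    fix P Q assume PQ: "P \<in> Ar (pi_cat X)" "Q \<in> Ar (pi_cat X)" "Cod (pi_cat X) P = Dom (pi_cat X) Q"
    then obtain f g where f: "f \<in> Ar1 X" "P = pi_class X f" and g: "g \<in> Ar1 X" "Q = pi_class X g"
      by (auto simp: pi_cat_Ar)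
    then show "FAr (functor_of (pi_cat X) B k (\<lambda>P. the_elem (h ` P))) (Cmp (pi_cat X) Q P) =
       Cmp B (FAr (functor_of (pi_cat X) B k (\<lambda>P. the_elem (h ` P))) Q)
        (FAr (functor_of (pi_cat X) B k (\<lambda>P. the_elem (h ` P))) P)"
      using PQ e cmp by simp
  qed (use assms pi_cat_category e in \<open>auto simp: pi_cat_Ar\<close>)
qed

lemma pi_lift_simps [simp]: "FSrc (pi_lift B k h) = pi_cat X" "FTrg (pi_lift B k h) = B"
  "x \<in> Ob0 X \<Longrightarrow> FOb (pi_lift B k h) x = k x"
  by (simp_all add: pi_lift_def)

lemma pi_functor_eqI:
  fixes G H :: "('o, 'm set, 'p, 'b) func"
  assumes "is_functor G" "is_functor H" "FSrc G = pi_cat X" "FSrc H = pi_cat X" "FTrg G = FTrg H"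
    and "\<And>x. x \<in> Ob0 X \<Longrightarrow> FOb G x = FOb H x"
    and "\<And>f. f \<in> Ar1 X \<Longrightarrow> FAr G (pi_class X f) = FAr H (pi_class X f)"
  shows "G = H"
  using assms by (intro functor_eqI) (auto simp: pi_cat_Ar)

lemma pi_ntransI:
  assumes "is_functor G" "is_functor H" "NSrc \<tau> = G" "NTrg \<tau> = H"
    "FSrc G = pi_cat X" "FTrg G = B" "FSrc H = pi_cat X" "FTrg H = B"
    and "NCmp \<tau> \<in> extensional (Ob0 X)"
    and "\<And>x. x \<in> Ob0 X \<Longrightarrow> NCmp \<tau> x \<in> Ar B \<and> Dom B (NCmp \<tau> x) = FOb G x \<and> Cod B (NCmp \<tau> x) = FOb H x"
    and "\<And>f. f \<in> Ar1 X \<Longrightarrow> Cmp B (FAr H (pi_class X f)) (NCmp \<tau> (Src1 X f)) =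
      Cmp B (NCmp \<tau> (Trg1 X f)) (FAr G (pi_class X f))"
  shows "is_ntrans \<tau>"
  using assms by (intro ntransI[where C = "pi_cat X" and B = B]) (auto simp: pi_cat_Ar)

end

section \<open>Functors into a locally discrete bicategory\<close>

lemma disc_simps [simp]: "Ob0 (disc B) = Ob B" "Ar1 (disc B) = Ar B" "Ar2 (disc B) = Ar B"
  "Src1 (disc B) = Dom B" "Trg1 (disc B) = Cod B" "Src2 (disc B) f = f" "Trg2 (disc B) f = f"
  "Id1 (disc B) = Idt B" "Cmp1 (disc B) = Cmp B" "Id2 (disc B) f = f" "VCmp (disc B) g f = f"
  "HCmp (disc B) = Cmp B" "Asc (disc B) h g f = Cmp B h (Cmp B g f)" "LUn (disc B) f = f" "RUn (disc B) f = f"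
  by (simp_all add: disc_def)

lemma disc_hom_cat: "category B \<Longrightarrow> category (hom_cat (disc B) x y)"
  by (rule categoryI) (auto simp: hom_cat_def cell1_def)

lemma disc_inverse: "f \<in> Ar B \<Longrightarrow> inverse_ar (hom_cat (disc B) (Dom B f) (Cod B f)) f f"
  by (auto simp: inverse_ar_def hom_def hom_cat_def cell1_def)

lemma disc_iso2 [simp]: "f \<in> Ar B \<Longrightarrow> iso2 (disc B) f"
  using disc_inverse[of f B] by (auto simp: iso2_def is_iso_def)

lemma disc_inv2 [simp]: "category B \<Longrightarrow> f \<in> Ar B \<Longrightarrow> inv2 (disc B) f = f"
  using inv_ar_eq[OF disc_hom_cat disc_inverse, of B f] by (simp add: inv2_def)

lemma disc_bicategory: "category B \<Longrightarrow> bicategory (disc B)"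
  by (rule bicategory.intro) (auto simp: disc_hom_cat cell1_def cell2_def)

text \<open>
  All 2-cells of \<open>disc B\<close> are identities, so a pseudofunctor into it is determined by its
  action on objects and 1-cells, and similarly for transformations.
\<close>

lemma psf_disc_iff:
  assumes X: "bicategory X" and B: "category B"
  shows "pseudofunctor X (disc B) F \<longleftrightarrow>
    (\<forall>x\<in>Ob0 X. P0 F x \<in> Ob B \<and> P1 F (Id1 X x) = Idt B (P0 F x) \<and> PUn F x = Idt B (P0 F x)) \<and>
    (\<forall>f\<in>Ar1 X. P1 F f \<in> Ar B \<and> Dom B (P1 F f) = P0 F (Src1 X f) \<and> Cod B (P1 F f) = P0 F (Trg1 X f)) \<and>
    (\<forall>\<theta>\<in>Ar2 X. P2 F \<theta> = P1 F (Src2 X \<theta>) \<and> P1 F (Trg2 X \<theta>) = P1 F (Src2 X \<theta>)) \<and>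
    (\<forall>f\<in>Ar1 X. \<forall>g\<in>Ar1 X. Trg1 X f = Src1 X g \<longrightarrow>
      P1 F (Cmp1 X g f) = Cmp B (P1 F g) (P1 F f) \<and> PCp F g f = Cmp B (P1 F g) (P1 F f))"
    (is "_ \<longleftrightarrow> ?R")
proof
  interpret X: bicategory X by (rule X)
  assume "pseudofunctor X (disc B) F"
  then interpret pseudofunctor X "disc B" F .
  have "P0 F x \<in> Ob B \<and> P1 F (Id1 X x) = Idt B (P0 F x) \<and> PUn F x = Idt B (P0 F x)" if "x \<in> Ob0 X" for x
    using P0_in[OF that] PUn_in[OF that] by (auto simp: cell2_def)
  moreover have "P1 F f \<in> Ar B \<and> Dom B (P1 F f) = P0 F (Src1 X f) \<and> Cod B (P1 F f) = P0 F (Trg1 X f)"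
    if "f \<in> Ar1 X" for f
    using P1_in[of f "Src1 X f" "Trg1 X f"] that by (auto simp: cell1_def)
  moreover have "P2 F \<theta> = P1 F (Src2 X \<theta>) \<and> P1 F (Trg2 X \<theta>) = P1 F (Src2 X \<theta>)" if "\<theta> \<in> Ar2 X" for \<theta>
    using P2_in[of \<theta> "Src2 X \<theta>" "Trg2 X \<theta>"] that by (auto simp: cell2_def)
  moreover have "P1 F (Cmp1 X g f) = Cmp B (P1 F g) (P1 F f) \<and> PCp F g f = Cmp B (P1 F g) (P1 F f)"
    if "f \<in> Ar1 X" "g \<in> Ar1 X" "Trg1 X f = Src1 X g" for f g
    using PCp_in[of f "Src1 X f" "Trg1 X f" g "Trg1 X g"] that by (auto simp: cell1_def cell2_def)
  ultimately show ?R by blast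
next
  interpret X: bicategory X by (rule X)
  assume R: ?R
  then have ob: "\<And>x. x \<in> Ob0 X \<Longrightarrow> P0 F x \<in> Ob B" "\<And>x. x \<in> Ob0 X \<Longrightarrow> P1 F (Id1 X x) = Idt B (P0 F x)"
      "\<And>x. x \<in> Ob0 X \<Longrightarrow> PUn F x = Idt B (P0 F x)"
    and ar: "\<And>f. f \<in> Ar1 X \<Longrightarrow> P1 F f \<in> Ar B" "\<And>f. f \<in> Ar1 X \<Longrightarrow> Dom B (P1 F f) = P0 F (Src1 X f)"
      "\<And>f. f \<in> Ar1 X \<Longrightarrow> Cod B (P1 F f) = P0 F (Trg1 X f)"
    and ce: "\<And>\<theta>. \<theta> \<in> Ar2 X \<Longrightarrow> P2 F \<theta> = P1 F (Src2 X \<theta>)" "\<And>\<theta>. \<theta> \<in> Ar2 X \<Longrightarrow> P1 F (Trg2 X \<theta>) = P1 F (Src2 X \<theta>)"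
    and cm: "\<And>f g. f \<in> Ar1 X \<Longrightarrow> g \<in> Ar1 X \<Longrightarrow> Trg1 X f = Src1 X g \<Longrightarrow> P1 F (Cmp1 X g f) = Cmp B (P1 F g) (P1 F f)"
      "\<And>f g. f \<in> Ar1 X \<Longrightarrow> g \<in> Ar1 X \<Longrightarrow> Trg1 X f = Src1 X g \<Longrightarrow> PCp F g f = Cmp B (P1 F g) (P1 F f)"
    by blast+
  show "pseudofunctor X (disc B) F"
    by (intro pseudofunctor.intro pseudofunctor_axioms.intro X disc_bicategory[OF B])
      (auto simp: cell1_def cell2_def ob ar ce cm B)
qed

lemma pt_disc_iff:
  assumes X: "bicategory X" and B: "category B"
  shows "pseudonatural X (disc B) \<tau> \<longleftrightarrow>
    pseudofunctor X (disc B) (TSrc \<tau>) \<and> pseudofunctor X (disc B) (TTrg \<tau>) \<and>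
    T0 \<tau> \<in> extensional (Ob0 X) \<and> T1 \<tau> \<in> extensional (Ar1 X) \<and>
    (\<forall>x\<in>Ob0 X. T0 \<tau> x \<in> Ar B \<and> Dom B (T0 \<tau> x) = P0 (TSrc \<tau>) x \<and> Cod B (T0 \<tau> x) = P0 (TTrg \<tau>) x) \<and>
    (\<forall>f\<in>Ar1 X. T1 \<tau> f = Cmp B (T0 \<tau> (Trg1 X f)) (P1 (TSrc \<tau>) f) \<and>
      Cmp B (P1 (TTrg \<tau>) f) (T0 \<tau> (Src1 X f)) = Cmp B (T0 \<tau> (Trg1 X f)) (P1 (TSrc \<tau>) f))"
    (is "_ \<longleftrightarrow> ?R")
proof
  assume "pseudonatural X (disc B) \<tau>"
  then interpret pseudonatural X "disc B" \<tau> .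
  have "T0 \<tau> x \<in> Ar B \<and> Dom B (T0 \<tau> x) = P0 (TSrc \<tau>) x \<and> Cod B (T0 \<tau> x) = P0 (TTrg \<tau>) x" if "x \<in> Ob0 X" for x
    using T0_in[OF that] by (auto simp: cell1_def)
  moreover have "T1 \<tau> f = Cmp B (T0 \<tau> (Trg1 X f)) (P1 (TSrc \<tau>) f) \<and>
      Cmp B (P1 (TTrg \<tau>) f) (T0 \<tau> (Src1 X f)) = Cmp B (T0 \<tau> (Trg1 X f)) (P1 (TSrc \<tau>) f)" if "f \<in> Ar1 X" for f
    using T1_in[of f "Src1 X f" "Trg1 X f"] that by (auto simp: cell1_def cell2_def)
  ultimately show ?R using T0_ext T1_ext F.pseudofunctor_axioms G.pseudofunctor_axioms by blast
next
  interpret X: bicategory X by (rule X)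
  assume R: ?R
  then have F: "pseudofunctor X (disc B) (TSrc \<tau>)" and G: "pseudofunctor X (disc B) (TTrg \<tau>)"
    and ext: "T0 \<tau> \<in> extensional (Ob0 X)" "T1 \<tau> \<in> extensional (Ar1 X)"
    and t0: "\<And>x. x \<in> Ob0 X \<Longrightarrow> T0 \<tau> x \<in> Ar B" "\<And>x. x \<in> Ob0 X \<Longrightarrow> Dom B (T0 \<tau> x) = P0 (TSrc \<tau>) x"
      "\<And>x. x \<in> Ob0 X \<Longrightarrow> Cod B (T0 \<tau> x) = P0 (TTrg \<tau>) x"
    and t1: "\<And>f. f \<in> Ar1 X \<Longrightarrow> T1 \<tau> f = Cmp B (T0 \<tau> (Trg1 X f)) (P1 (TSrc \<tau>) f)"
      "\<And>f. f \<in> Ar1 X \<Longrightarrow> Cmp B (T0 \<tau> (Trg1 X f)) (P1 (TSrc \<tau>) f) = Cmp B (P1 (TTrg \<tau>) f) (T0 \<tau> (Src1 X f))"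
    by auto
  note FD = F[unfolded psf_disc_iff[OF X B]] and GD = G[unfolded psf_disc_iff[OF X B]]
  have a: "P0 K x \<in> Ob B" "P1 K (Id1 X x) = Idt B (P0 K x)" "PUn K x = Idt B (P0 K x)"
    if "K = TSrc \<tau> \<or> K = TTrg \<tau>" "x \<in> Ob0 X" for K x
    using that FD GD by auto
  have b: "P1 K f \<in> Ar B" "Dom B (P1 K f) = P0 K (Src1 X f)" "Cod B (P1 K f) = P0 K (Trg1 X f)"
    if "K = TSrc \<tau> \<or> K = TTrg \<tau>" "f \<in> Ar1 X" for K f
    using that FD GD by auto
  have c: "P2 K \<theta> = P1 K (Trg2 X \<theta>)" "P1 K (Src2 X \<theta>) = P1 K (Trg2 X \<theta>)"
    if "K = TSrc \<tau> \<or> K = TTrg \<tau>" "\<theta> \<in> Ar2 X" for K \<theta>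
    using that FD GD by auto
  have d: "P1 K (Cmp1 X g f) = Cmp B (P1 K g) (P1 K f)" "PCp K g f = Cmp B (P1 K g) (P1 K f)"
    if "K = TSrc \<tau> \<or> K = TTrg \<tau>" "f \<in> Ar1 X" "g \<in> Ar1 X" "Trg1 X f = Src1 X g" for K f g
    using that FD GD by auto
  note S = a[of "TSrc \<tau>", simplified] a[of "TTrg \<tau>", simplified] b[of "TSrc \<tau>", simplified] b[of "TTrg \<tau>", simplified]
    c[of "TSrc \<tau>", simplified] c[of "TTrg \<tau>", simplified] d[of "TSrc \<tau>", simplified] d[of "TTrg \<tau>", simplified]
  have n: "Cmp B (T0 \<tau> y) (P1 (TSrc \<tau>) f) = Cmp B (P1 (TTrg \<tau>) f) (T0 \<tau> x)"
    if "f \<in> Ar1 X" "Src1 X f = x" "Trg1 X f = y" for f x y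
    using t1(2)[of f] that by simp
  have n': "T1 \<tau> f = Cmp B (P1 (TTrg \<tau>) f) (T0 \<tau> (Src1 X f))" if "f \<in> Ar1 X" for f
    using t1[of f] that by simp
  show "pseudonatural X (disc B) \<tau>"
    by (intro pseudonatural.intro pseudonatural_axioms.intro F G ext)
      (auto simp: cell1_def cell2_def t0 S n n' B)
qed


lemma psf_cat_simps [simp]:
  "F \<in> Ob (psf_cat X Y) \<longleftrightarrow> pseudofunctor X Y F \<and> psf_ext X F"
  "\<tau> \<in> Ar (psf_cat X Y) \<longleftrightarrow> pseudonatural X Y \<tau> \<and> psf_ext X (TSrc \<tau>) \<and> psf_ext X (TTrg \<tau>)"
  "Dom (psf_cat X Y) = TSrc" "Cod (psf_cat X Y) = TTrg" "Idt (psf_cat X Y) = ptid X Y" "Cmp (psf_cat X Y) = ptcmp X Y"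
  by (auto simp: psf_cat_def)

definition psf_of :: "('o, 'm, 't) bicat \<Rightarrow> ('o, 'm set, 'p, 'b) func \<Rightarrow> ('o, 'm, 't, 'p, 'b, 'b) psf" where
  "psf_of X G = \<lparr>P0 = FOb G, P1 = (\<lambda>f\<in>Ar1 X. FAr G (pi_class X f)),
     P2 = (\<lambda>\<theta>\<in>Ar2 X. FAr G (pi_class X (Src2 X \<theta>))),
     PUn = (\<lambda>x\<in>Ob0 X. FAr G (pi_class X (Id1 X x))),
     PCp = (\<lambda>g f. if f \<in> Ar1 X \<and> g \<in> Ar1 X \<and> Trg1 X f = Src1 X g
       then FAr G (pi_class X (Cmp1 X g f)) else undefined)\<rparr>"

definition pt_of :: "('o, 'm, 't) bicat \<Rightarrow> ('p, 'b) cat \<Rightarrow> ('o, 'm set, 'p, 'b) ntrans \<Rightarrow> ('o, 'm, 't, 'p, 'b, 'b) ptrans" where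
  "pt_of X B \<tau> = \<lparr>TSrc = psf_of X (NSrc \<tau>), TTrg = psf_of X (NTrg \<tau>), T0 = NCmp \<tau>,
     T1 = (\<lambda>f\<in>Ar1 X. Cmp B (NCmp \<tau> (Trg1 X f)) (FAr (NSrc \<tau>) (pi_class X f)))\<rparr>"

lemma psf_of_simps [simp]: "P0 (psf_of X G) = FOb G" "f \<in> Ar1 X \<Longrightarrow> P1 (psf_of X G) f = FAr G (pi_class X f)"
  "\<theta> \<in> Ar2 X \<Longrightarrow> P2 (psf_of X G) \<theta> = FAr G (pi_class X (Src2 X \<theta>))"
  "x \<in> Ob0 X \<Longrightarrow> PUn (psf_of X G) x = FAr G (pi_class X (Id1 X x))"
  "f \<in> Ar1 X \<Longrightarrow> g \<in> Ar1 X \<Longrightarrow> Trg1 X f = Src1 X g \<Longrightarrow> PCp (psf_of X G) g f = FAr G (pi_class X (Cmp1 X g f))"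
  by (auto simp: psf_of_def)

lemma pt_of_simps [simp]: "TSrc (pt_of X B \<tau>) = psf_of X (NSrc \<tau>)" "TTrg (pt_of X B \<tau>) = psf_of X (NTrg \<tau>)"
  "T0 (pt_of X B \<tau>) = NCmp \<tau>"
  "f \<in> Ar1 X \<Longrightarrow> T1 (pt_of X B \<tau>) f = Cmp B (NCmp \<tau> (Trg1 X f)) (FAr (NSrc \<tau>) (pi_class X f))"
  by (auto simp: pt_of_def)

lemma pi_functor_Cmp1:
  assumes X: "bicategory X" and G: "is_functor G" "FSrc G = pi_cat X"
    and fg: "f \<in> Ar1 X" "g \<in> Ar1 X" "Trg1 X f = Src1 X g"
  shows "FAr G (pi_class X (Cmp1 X g f)) = Cmp (FTrg G) (FAr G (pi_class X g)) (FAr G (pi_class X f))"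
proof -
  interpret bicategory X by (rule X)
  show ?thesis using G fg by (simp flip: pi_cat_Cmp)
qed

lemma pi_functor_Id1:
  assumes X: "bicategory X" and G: "is_functor G" "FSrc G = pi_cat X" and x: "x \<in> Ob0 X"
  shows "FAr G (pi_class X (Id1 X x)) = Idt (FTrg G) (FOb G x)"
proof -
  interpret bicategory X by (rule X)
  show ?thesis using G x FAr_Idt_simp[of G "pi_cat X" x] by simp
qed

lemma psf_of_psf:
  assumes X: "bicategory X" and G: "is_functor G" "FSrc G = pi_cat X" "FTrg G = B"
  shows "pseudofunctor X (disc B) (psf_of X G)" "psf_ext X (psf_of X G)"
proof -
  interpret bicategory X by (rule X)
  have B: "category B" using G by auto
  show "pseudofunctor X (disc B) (psf_of X G)"
    unfolding psf_disc_iff[OF X B] using G pi_functor_Cmp1[OF X G(1,2)] pi_functor_Id1[OF X G(1,2)]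
    by (auto simp: pi_class_eqI)
  show "psf_ext X (psf_of X G)"
    using G functor_simps(3)[OF G(1,2)] by (auto simp: psf_ext_def psf_of_def)
qed

lemma psf_disc_eqI:
  fixes F G :: "('o, 'm, 't, 'p, 'b, 'b) psf"
  assumes X: "bicategory X" and B: "category B"
    and F: "pseudofunctor X (disc B) F" "psf_ext X F" and G: "pseudofunctor X (disc B) G" "psf_ext X G"
    and P0: "\<And>x. x \<in> Ob0 X \<Longrightarrow> P0 F x = P0 G x" and P1: "\<And>f. f \<in> Ar1 X \<Longrightarrow> P1 F f = P1 G f"
  shows "F = G"
proof (rule psf.equality)
  interpret bicategory X by (rule X)
  note FD = F(1)[unfolded psf_disc_iff[OF X B]] and GD = G(1)[unfolded psf_disc_iff[OF X B]]
  show "P0 F = P0 G" "P1 F = P1 G"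
    using F(2) G(2) P0 P1 unfolding psf_ext_def by (auto intro: extensionalityI)
  have "P2 F \<theta> = P2 G \<theta>" if "\<theta> \<in> Ar2 X" for \<theta> using that FD GD P1 by simp
  then show "P2 F = P2 G" using F(2) G(2) unfolding psf_ext_def by (auto intro: extensionalityI)
  have "PUn F x = PUn G x" if "x \<in> Ob0 X" for x using that FD GD P0 by simp
  then show "PUn F = PUn G" using F(2) G(2) unfolding psf_ext_def by (auto intro: extensionalityI)
  have "PCp F g f = PCp G g f" for g f
  proof (cases "f \<in> Ar1 X \<and> g \<in> Ar1 X \<and> Trg1 X f = Src1 X g")
    case True
    then have "PCp F g f = Cmp B (P1 F g) (P1 F f)" "PCp G g f = Cmp B (P1 G g) (P1 G f)"
      using FD GD by blast+
    then show ?thesis using P1 True by simp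
  next
    case False
    then have "PCp F g f = undefined" "PCp G g f = undefined"
      using F(2) G(2) unfolding psf_ext_def by blast+
    then show ?thesis by simp
  qed
  then show "PCp F = PCp G" by blast
qed simp

lemma pt_disc_eqI:
  fixes \<sigma> \<tau> :: "('o, 'm, 't, 'p, 'b, 'b) ptrans"
  assumes X: "bicategory X" and B: "category B"
    and s: "pseudonatural X (disc B) \<sigma>" and t: "pseudonatural X (disc B) \<tau>"
    and e: "TSrc \<sigma> = TSrc \<tau>" "TTrg \<sigma> = TTrg \<tau>"
    and T0: "\<And>x. x \<in> Ob0 X \<Longrightarrow> T0 \<sigma> x = T0 \<tau> x"
  shows "\<sigma> = \<tau>"
proof (rule ptrans.equality)
  interpret bicategory X by (rule X)
  note SD = s[unfolded pt_disc_iff[OF X B]] and TD = t[unfolded pt_disc_iff[OF X B]]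
  show "T0 \<sigma> = T0 \<tau>" using SD TD T0 by (blast intro: extensionalityI)
  have "T1 \<sigma> f = T1 \<tau> f" if f: "f \<in> Ar1 X" for f
  proof -
    have "T1 \<sigma> f = Cmp B (T0 \<sigma> (Trg1 X f)) (P1 (TSrc \<sigma>) f)" "T1 \<tau> f = Cmp B (T0 \<tau> (Trg1 X f)) (P1 (TSrc \<tau>) f)"
      using SD TD f by blast+
    then show ?thesis using T0 e f by simp
  qed
  then show "T1 \<sigma> = T1 \<tau>" using SD TD by (blast intro: extensionalityI)
qed (use e in auto)

lemma (in bicategory) pi_ntrans_nat:
  assumes "is_ntrans \<tau>" "FSrc (NSrc \<tau>) = pi_cat X" "FTrg (NSrc \<tau>) = B" "f \<in> Ar1 X" "Src1 X f = x" "Trg1 X f = y"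
  shows "Cmp B (FAr (NTrg \<tau>) (pi_class X f)) (NCmp \<tau> x) = Cmp B (NCmp \<tau> y) (FAr (NSrc \<tau>) (pi_class X f))"
  using assms by (intro ntrans_nat[where C = "pi_cat X"]) auto

lemma pt_of_pt:
  assumes X: "bicategory X" and t: "is_ntrans \<tau>" "FSrc (NSrc \<tau>) = pi_cat X" "FTrg (NSrc \<tau>) = B"
  shows "pseudonatural X (disc B) (pt_of X B \<tau>)"
proof -
  interpret bicategory X by (rule X)
  have B: "category B" using t functor_cats(2)[of "NSrc \<tau>"] by auto
  have e: "T1 (pt_of X B \<tau>) \<in> extensional (Ar1 X)" by (simp add: pt_of_def)
  show ?thesis
    unfolding pt_disc_iff[OF X B]
    using t psf_of_psf[OF X, of "NSrc \<tau>" B] psf_of_psf[OF X, of "NTrg \<tau>" B] e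
      ntrans_simps(5)[OF t(1,2)] pi_ntrans_nat[OF t] by auto
qed

lemma ptid_T0: "x \<in> Ob0 X \<Longrightarrow> T0 (ptid X (disc B) F) x = Idt B (P0 F x)"
  by (simp add: ptid_def)

lemma ptid_pt:
  assumes X: "bicategory X" and B: "category B" and F: "pseudofunctor X (disc B) F"
  shows "pseudonatural X (disc B) (ptid X (disc B) F)"
proof -
  interpret bicategory X by (rule X)
  note FD = F[unfolded psf_disc_iff[OF X B]]
  show ?thesis unfolding pt_disc_iff[OF X B] using F FD B by (auto simp: ptid_def)
qed

lemma ptcmp_T0: "x \<in> Ob0 X \<Longrightarrow> T0 (ptcmp X (disc B) \<sigma> \<tau>) x = Cmp B (T0 \<sigma> x) (T0 \<tau> x)"
  by (simp add: ptcmp_def)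

lemma ptcmp_pt:
  assumes X: "bicategory X" and B: "category B"
    and s: "pseudonatural X (disc B) \<sigma>" and t: "pseudonatural X (disc B) \<tau>" and e: "TTrg \<tau> = TSrc \<sigma>"
  shows "pseudonatural X (disc B) (ptcmp X (disc B) \<sigma> \<tau>)"
proof -
  interpret bicategory X by (rule X)
  note SD = s[unfolded pt_disc_iff[OF X B]] and TD = t[unfolded pt_disc_iff[OF X B]]
  let ?F = "TSrc \<tau>" and ?G = "TSrc \<sigma>" and ?H = "TTrg \<sigma>"
  have F: "pseudofunctor X (disc B) ?F" and H: "pseudofunctor X (disc B) ?H" and G: "pseudofunctor X (disc B) ?G"
    using SD TD by auto
  have t0: "T0 \<tau> x \<in> Ar B" "Dom B (T0 \<tau> x) = P0 ?F x" "Cod B (T0 \<tau> x) = P0 ?G x"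
    "T0 \<sigma> x \<in> Ar B" "Dom B (T0 \<sigma> x) = P0 ?G x" "Cod B (T0 \<sigma> x) = P0 ?H x" if "x \<in> Ob0 X" for x
    using that SD TD e by auto
  have p1: "P1 K f \<in> Ar B" "Dom B (P1 K f) = P0 K (Src1 X f)" "Cod B (P1 K f) = P0 K (Trg1 X f)"
    if "f \<in> Ar1 X" "K = ?F \<or> K = ?G \<or> K = ?H" for f K
    using that F G H unfolding psf_disc_iff[OF X B] by blast+
  note p = p1[of _ ?F, simplified] p1[of _ ?G, simplified] p1[of _ ?H, simplified]
  have n: "Cmp B (T0 \<sigma> (Trg1 X f)) (P1 ?G f) = Cmp B (P1 ?H f) (T0 \<sigma> (Src1 X f))"
    "Cmp B (T0 \<tau> (Trg1 X f)) (P1 ?F f) = Cmp B (P1 ?G f) (T0 \<tau> (Src1 X f))"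
    "T1 \<sigma> f = Cmp B (T0 \<sigma> (Trg1 X f)) (P1 ?G f)" "T1 \<tau> f = Cmp B (T0 \<tau> (Trg1 X f)) (P1 ?F f)" if "f \<in> Ar1 X" for f
    using SD TD that e by auto
  have m: "Cmp B (P1 ?H f) (Cmp B (T0 \<sigma> (Src1 X f)) (T0 \<tau> (Src1 X f))) =
      Cmp B (T0 \<sigma> (Trg1 X f)) (Cmp B (T0 \<tau> (Trg1 X f)) (P1 ?F f))" if f: "f \<in> Ar1 X" for f
  proof -
    have "Cmp B (P1 ?H f) (Cmp B (T0 \<sigma> (Src1 X f)) (T0 \<tau> (Src1 X f))) =
        Cmp B (Cmp B (P1 ?H f) (T0 \<sigma> (Src1 X f))) (T0 \<tau> (Src1 X f))"
      using f B by (simp add: t0 p)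
    also have "\<dots> = Cmp B (T0 \<sigma> (Trg1 X f)) (Cmp B (P1 ?G f) (T0 \<tau> (Src1 X f)))"
      unfolding n(1)[OF f, symmetric] using f B by (simp add: t0 p)
    finally show ?thesis using n(2)[OF f] by simp
  qed
  have T1: "T1 (ptcmp X (disc B) \<sigma> \<tau>) f = Cmp B (P1 ?H f) (Cmp B (T0 \<sigma> (Src1 X f)) (T0 \<tau> (Src1 X f)))"
    if f: "f \<in> Ar1 X" for f
    using f B by (simp add: ptcmp_def Let_def t0 p)
  have "T0 (ptcmp X (disc B) \<sigma> \<tau>) \<in> extensional (Ob0 X)" "T1 (ptcmp X (disc B) \<sigma> \<tau>) \<in> extensional (Ar1 X)"
    "TSrc (ptcmp X (disc B) \<sigma> \<tau>) = ?F" "TTrg (ptcmp X (disc B) \<sigma> \<tau>) = ?H"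
    by (simp_all add: ptcmp_def)
  then show ?thesis
    unfolding pt_disc_iff[OF X B] using F H B by (simp add: T1 m ptcmp_T0 t0 p)
qed

lemma fun_cat_iso_psf_cat:
  fixes X :: "('o, 'm, 't) bicat" and B :: "('p, 'b) cat"
  assumes X: "bicategory X" and B: "category B"
  shows "cat_iso (fun_cat (pi_cat X) B) (psf_cat X (disc B)) (psf_of X) (pt_of X B)"
proof -
  interpret bicategory X by (rule X)
  define L where "L = (\<lambda>F :: ('o, 'm, 't, 'p, 'b, 'b) psf. pi_lift B (P0 F) (P1 F))"
  define M where "M = (\<lambda>\<tau> :: ('o, 'm, 't, 'p, 'b, 'b) ptrans. \<lparr>NSrc = L (TSrc \<tau>), NTrg = L (TTrg \<tau>), NCmp = T0 \<tau>\<rparr>)"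
  have L: "is_functor (L F)" "\<And>f. f \<in> Ar1 X \<Longrightarrow> FAr (L F) (pi_class X f) = P1 F f"
    "FSrc (L F) = pi_cat X" "FTrg (L F) = B" "\<And>x. x \<in> Ob0 X \<Longrightarrow> FOb (L F) x = P0 F x"
    if "pseudofunctor X (disc B) F" for F
    unfolding L_def using that unfolding psf_disc_iff[OF X B]
    by (auto intro!: pi_lift_functor B)
  have LL: "L (psf_of X G) = G" if "is_functor G" "FSrc G = pi_cat X" "FTrg G = B" for G
    using that L[OF psf_of_psf(1)[OF X that]] by (intro pi_functor_eqI) simp_all
  have psfL: "psf_of X (L F) = F" if "pseudofunctor X (disc B) F" "psf_ext X F" for F
    using that L[OF that(1)] psf_of_psf[OF X, of "L F" B] by (intro psf_disc_eqI[OF X B]) simp_all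
  have M: "is_ntrans (M \<tau>)" if t: "pseudonatural X (disc B) \<tau>" for \<tau>
  proof -
    note TD = t[unfolded pt_disc_iff[OF X B]]
    show ?thesis
      using TD L[of "TSrc \<tau>"] L[of "TTrg \<tau>"]
      by (intro pi_ntransI[where G = "L (TSrc \<tau>)" and H = "L (TTrg \<tau>)" and B = B]) (simp_all add: M_def)
  qed
  show ?thesis
  proof (rule cat_isoI[where f' = L and g' = M])
    fix b assume b: "b \<in> Ar (psf_cat X (disc B))"
    then have "pseudofunctor X (disc B) (TSrc b)" "pseudofunctor X (disc B) (TTrg b)"
      by (auto simp: pt_disc_iff[OF X B])
    then show "M b \<in> Ar (fun_cat (pi_cat X) B)" "pt_of X B (M b) = b"
      using b M[of b] L pt_of_pt[OF X, of "M b" B] psfL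
      by (simp_all add: M_def) (intro pt_disc_eqI[OF X B]; simp)
  next
    fix a b assume a: "a \<in> Ar (fun_cat (pi_cat X) B)" and b: "b \<in> Ar (fun_cat (pi_cat X) B)"
      and ab: "Cod (fun_cat (pi_cat X) B) a = Dom (fun_cat (pi_cat X) B) b"
    have p: "pseudonatural X (disc B) (ptcmp X (disc B) (pt_of X B b) (pt_of X B a))"
      "pseudonatural X (disc B) (pt_of X B (nvcmp b a))"
      using a b ab by (auto intro!: ptcmp_pt pt_of_pt X B)
    show "pt_of X B (Cmp (fun_cat (pi_cat X) B) b a) = Cmp (psf_cat X (disc B)) (pt_of X B b) (pt_of X B a)"
      using p a b ab by simp (intro pt_disc_eqI[OF X B]; simp add: ptcmp_T0; simp add: ptcmp_def)
  next
    fix G assume G: "G \<in> Ob (fun_cat (pi_cat X) B)"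
    then have p: "pseudonatural X (disc B) (ptid X (disc B) (psf_of X G))" "pseudonatural X (disc B) (pt_of X B (nid G))"
      by (auto intro!: ptid_pt pt_of_pt psf_of_psf X B)
    then show "pt_of X B (Idt (fun_cat (pi_cat X) B) G) = Idt (psf_cat X (disc B)) (psf_of X G)"
      using G by simp (intro pt_disc_eqI[OF X B]; simp add: ptid_T0; simp add: ptid_def)
  next
    fix a assume a: "a \<in> Ar (fun_cat (pi_cat X) B)"
    then show "M (pt_of X B a) = a"
      using M[OF pt_of_pt[OF X, of a B]] LL by simp (intro ntrans_eqI; simp add: M_def)
  qed (simp_all add: LL psfL L psf_of_psf[OF X] pt_of_pt[OF X])
qed

text \<open>A 2-cell of \<open>disc B\<close> from \<open>g f\<close> to an identity is an equation, so equivalences are isomorphisms.\<close>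

lemma disc_equivalence1:
  assumes B: "category B"
  shows "equivalence1 (disc B) f \<longleftrightarrow> is_iso B f"
proof
  assume "equivalence1 (disc B) f"
  then show "is_iso B f" using B by (auto simp: equivalence1_def cell1_def cell2_def intro: is_isoI)
next
  assume f: "is_iso B f"
  show "equivalence1 (disc B) f"
    unfolding equivalence1_def cell1_def cell2_def
    using B f iso_Ar[OF f] by (auto intro!: exI[where x = "inv_ar B f"])
qed

lemma fun_cat_inv_iso_psf_cat_inv:
  fixes X :: "('o, 'm, 't) bicat" and B :: "('p, 'b) cat"
  assumes X: "bicategory X" and B: "category B" and S: "S \<subseteq> Ar1 X"
  shows "cat_iso (fun_cat_inv (pi_cat X) (pi_class X ` S) B) (psf_cat_inv X S (disc B)) (psf_of X) (pt_of X B)"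
proof -
  have "P1 (psf_of X G) s = FAr G (pi_class X s)" if "s \<in> S" for s and G :: "('o, 'm set, 'p, 'b) func"
    using S that by auto
  then show ?thesis
    unfolding fun_cat_inv_def psf_cat_inv_def
    by (intro cat_iso_full_sub fun_cat_iso_psf_cat[OF X B]) (auto simp: disc_equivalence1[OF B])
qed

section \<open>The bicategory of elements\<close>

lemma Cmp_reassoc:
  assumes C: "category C" and e: "Cmp C g f = Cmp C k h"
    and t: "w \<in> Ar C" "f \<in> Ar C" "g \<in> Ar C" "h \<in> Ar C" "k \<in> Ar C" "Cod C w = Dom C f" "Cod C f = Dom C g"
      "Cod C w = Dom C h" "Cod C h = Dom C k"
  shows "Cmp C g (Cmp C f w) = Cmp C k (Cmp C h w)"
  using C t by (simp flip: Cmp_asc add: e)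

locale cat_psf = pseudofunctor J Cat D
  for J :: "('j, 'm, 't) bicat"
    and D :: "('j, 'm, 't, ('x, 'a) cat, ('x, 'a, 'x, 'a) func, ('x, 'a, 'x, 'a) ntrans) psf"
begin

abbreviation "E \<equiv> elements J D"
abbreviation "un i x \<equiv> NCmp (PUn D i) x"
abbreviation "ph n m x \<equiv> NCmp (PCp D n m) x"

lemma fibre_category [simp]: "i \<in> Ob0 J \<Longrightarrow> category (P0 D i)"
  using P0_in by simp

lemma P1_simps [simp]: assumes "m \<in> Ar1 J"
  shows "is_functor (P1 D m)" "FSrc (P1 D m) = P0 D (Src1 J m)" "FTrg (P1 D m) = P0 D (Trg1 J m)"
  using P1_in[of m "Src1 J m" "Trg1 J m"] assms by (simp_all add: cell1_def)

lemma P2_simps [simp]: assumes "\<theta> \<in> Ar2 J"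
  shows "is_ntrans (P2 D \<theta>)" "NSrc (P2 D \<theta>) = P1 D (Src2 J \<theta>)" "NTrg (P2 D \<theta>) = P1 D (Trg2 J \<theta>)"
  using P2_in[of \<theta> "Src2 J \<theta>" "Trg2 J \<theta>"] assms by (simp_all add: cell2_def)

lemma PUn_simps [simp]: assumes "i \<in> Ob0 J"
  shows "is_ntrans (PUn D i)" "NSrc (PUn D i) = fid (P0 D i)" "NTrg (PUn D i) = P1 D (Id1 J i)"
  using PUn_in[OF assms] by simp_all

lemma PCp_simps [simp]: assumes "m \<in> Ar1 J" "n \<in> Ar1 J" "Trg1 J m = Src1 J n"
  shows "is_ntrans (PCp D n m)" "NSrc (PCp D n m) = fcmp (P1 D n) (P1 D m)" "NTrg (PCp D n m) = P1 D (Cmp1 J n m)"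
  using PCp_in[of m "Src1 J m" "Trg1 J m" n "Trg1 J n"] assms by (simp_all add: cell1_def)

lemma un_iso [simp]: assumes "i \<in> Ob0 J" "x \<in> Ob (P0 D i)" "P0 D i = K" shows "is_iso K (un i x)"
  using PUn_iso[OF assms(1)] assms fun_cat_iso_iff[of "PUn D i" "P0 D i" "P0 D i"]
  by (auto simp: iso2_def)

lemma ph_iso [simp]:
  assumes "m \<in> Ar1 J" "n \<in> Ar1 J" "Trg1 J m = Src1 J n" "x \<in> Ob (P0 D (Src1 J m))" "P0 D (Trg1 J n) = K"
  shows "is_iso K (ph n m x)"
  using PCp_iso[of m "Src1 J m" "Trg1 J m" n "Trg1 J n"] assms
    fun_cat_iso_iff[of "PCp D n m" "P0 D (Src1 J m)" "P0 D (Trg1 J n)"]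
  by (auto simp: iso2_def cell1_def)

lemma P2_Id2_simp [simp]: "m \<in> Ar1 J \<Longrightarrow> P2 D (Id2 J m) = nid (P1 D m)"
  using P2_Id2 by simp

lemma P2_VCmp_simp [simp]: "\<theta> \<in> Ar2 J \<Longrightarrow> \<phi> \<in> Ar2 J \<Longrightarrow> Trg2 J \<theta> = Src2 J \<phi> \<Longrightarrow>
    P2 D (VCmp J \<phi> \<theta>) = nvcmp (P2 D \<phi>) (P2 D \<theta>)"
  using P2_VCmp[of \<theta> "Src2 J \<theta>" "Src2 J \<phi>" \<phi> "Trg2 J \<phi>"] by (simp add: cell2_def)

text \<open>The coherence conditions on \<open>D\<close>, evaluated at an object of a fibre.\<close>

lemma ph_nat:
  assumes "m \<in> Ar1 J" "n \<in> Ar1 J" "Trg1 J m = Src1 J n" "f \<in> Ar (P0 D (Src1 J m))"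
    "Dom (P0 D (Src1 J m)) f = x" "Cod (P0 D (Src1 J m)) f = y" "P0 D (Trg1 J n) = K"
  shows "Cmp K (FAr (P1 D (Cmp1 J n m)) f) (ph n m x) = Cmp K (ph n m y) (FAr (P1 D n) (FAr (P1 D m) f))"
  using ntrans_nat[of "PCp D n m" K "P0 D (Src1 J m)" f x y] assms by simp

lemma un_nat:
  assumes "i \<in> Ob0 J" "f \<in> Ar (P0 D i)" "Dom (P0 D i) f = x" "Cod (P0 D i) f = y" "P0 D i = K"
  shows "Cmp K (FAr (P1 D (Id1 J i)) f) (un i x) = Cmp K (un i y) f"
  using ntrans_nat[of "PUn D i" K "P0 D i" f x y] assms by simp

lemma ph_nat2:
  assumes "\<theta> \<in> Ar2 J" "\<phi> \<in> Ar2 J" "Trg1 J (Src2 J \<theta>) = Src1 J (Src2 J \<phi>)" "x \<in> Ob (P0 D (Src1 J (Src2 J \<theta>)))"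
    "P0 D (Trg1 J (Src2 J \<phi>)) = K"
  shows "Cmp K (ph (Trg2 J \<phi>) (Trg2 J \<theta>) x)
      (Cmp K (NCmp (P2 D \<phi>) (FOb (P1 D (Trg2 J \<theta>)) x)) (FAr (P1 D (Src2 J \<phi>)) (NCmp (P2 D \<theta>) x))) =
    Cmp K (NCmp (P2 D (HCmp J \<phi> \<theta>)) x) (ph (Src2 J \<phi>) (Src2 J \<theta>) x)"
proof -
  have "nvcmp (PCp D (Trg2 J \<phi>) (Trg2 J \<theta>)) (nhcmp (P2 D \<phi>) (P2 D \<theta>)) =
      nvcmp (P2 D (HCmp J \<phi> \<theta>)) (PCp D (Src2 J \<phi>) (Src2 J \<theta>))"
    using PCp_natural[of "Src2 J \<theta>" "Src1 J (Src2 J \<theta>)" "Trg1 J (Src2 J \<theta>)" "Src2 J \<phi>" "Trg1 J (Src2 J \<phi>)"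
      \<theta> "Trg2 J \<theta>" \<phi> "Trg2 J \<phi>"] assms by (simp add: cell1_def cell2_def)
  from arg_cong[OF this, of "\<lambda>\<rho>. NCmp \<rho> x"] show ?thesis
    unfolding assms(5)[symmetric] using assms(1-4) by simp
qed

lemma ph_Asc:
  assumes "f \<in> Ar1 J" "g \<in> Ar1 J" "h \<in> Ar1 J" "Trg1 J f = Src1 J g" "Trg1 J g = Src1 J h"
    "x \<in> Ob (P0 D (Src1 J f))" "P0 D (Trg1 J h) = K"
  shows "Cmp K (NCmp (P2 D (Asc J h g f)) x) (Cmp K (ph (Cmp1 J h g) f x) (ph h g (FOb (P1 D f) x))) =
    Cmp K (ph h (Cmp1 J g f) x) (FAr (P1 D h) (ph g f x))"
proof -
  have "nvcmp (P2 D (Asc J h g f)) (nvcmp (PCp D (Cmp1 J h g) f) (nwhr (PCp D h g) (P1 D f))) =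
      nvcmp (PCp D h (Cmp1 J g f)) (nvcmp (nwhl (P1 D h) (PCp D g f)) (nid (fcmp (P1 D h) (fcmp (P1 D g) (P1 D f)))))"
    using PCp_Asc[of f "Src1 J f" "Trg1 J f" g "Trg1 J g" h "Trg1 J h"] assms by (simp add: cell1_def)
  from arg_cong[OF this, of "\<lambda>\<rho>. NCmp \<rho> x"] show ?thesis
    unfolding assms(7)[symmetric] using assms(1-6) by simp
qed

lemma ph_LUn:
  assumes "f \<in> Ar1 J" "x \<in> Ob (P0 D (Src1 J f))" "P0 D (Trg1 J f) = K" "Trg1 J f = j"
  shows "Cmp K (NCmp (P2 D (LUn J f)) x) (Cmp K (ph (Id1 J j) f x) (un j (FOb (P1 D f) x))) =
    Idt K (FOb (P1 D f) x)"
proof -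
  have "nvcmp (P2 D (LUn J f)) (nvcmp (PCp D (Id1 J j) f) (nwhr (PUn D j) (P1 D f))) = nid (P1 D f)"
    using PCp_LUn[of f "Src1 J f" "Trg1 J f"] assms by (simp add: cell1_def)
  from arg_cong[OF this, of "\<lambda>\<rho>. NCmp \<rho> x"] show ?thesis
    unfolding assms(3,4)[symmetric] using assms(1,2) by simp
qed

lemma ph_RUn:
  assumes "f \<in> Ar1 J" "x \<in> Ob (P0 D (Src1 J f))" "P0 D (Trg1 J f) = K" "Src1 J f = i"
  shows "Cmp K (NCmp (P2 D (RUn J f)) x) (Cmp K (ph f (Id1 J i) x) (FAr (P1 D f) (un i x))) =
    Idt K (FOb (P1 D f) x)"
proof -
  have "nvcmp (P2 D (RUn J f)) (nvcmp (PCp D f (Id1 J i)) (nwhl (P1 D f) (PUn D i))) = nid (P1 D f)"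
    using PCp_RUn[of f "Src1 J f" "Trg1 J f"] assms by (simp add: cell1_def)
  from arg_cong[OF this, of "\<lambda>\<rho>. NCmp \<rho> x"] show ?thesis
    unfolding assms(3,4)[symmetric] using assms(1,2) by simp
qed

text \<open>
  Every 1-cell has this form, because source and target indices are those of \<open>m\<close> and the target
  object is the codomain of \<open>f\<close>. Taking it apart in this way leaves no matching conditions.
\<close>

definition mk :: "'x \<Rightarrow> 'm \<Rightarrow> 'a \<Rightarrow> ('j, 'm, 'x, 'a) el1" where
  "mk x m f = \<lparr>ESrc = (Src1 J m, x), ETrg = (Trg1 J m, Cod (P0 D (Trg1 J m)) f), EBase = m, EFib = f\<rparr>"

definition el1_ok :: "'x \<Rightarrow> 'm \<Rightarrow> 'a \<Rightarrow> bool" where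
  "el1_ok x m f \<longleftrightarrow> m \<in> Ar1 J \<and> x \<in> Ob (P0 D (Src1 J m)) \<and> f \<in> Ar (P0 D (Trg1 J m)) \<and>
     Dom (P0 D (Trg1 J m)) f = FOb (P1 D m) x"

lemma mk_simps [simp]: "ESrc (mk x m f) = (Src1 J m, x)" "ETrg (mk x m f) = (Trg1 J m, Cod (P0 D (Trg1 J m)) f)"
  "EBase (mk x m f) = m" "EFib (mk x m f) = f"
  by (simp_all add: mk_def)

lemma el_simps [simp]: "Src1 E = ESrc" "Trg1 E = ETrg" "Src2 E = CSrc" "Trg2 E = CTrg"
  "Id1 E = el_id J D" "Cmp1 E = el_cmp J D"
  "Id2 E u = \<lparr>CSrc = u, CTrg = u, CBase = Id2 J (EBase u)\<rparr>"
  "VCmp E d c = \<lparr>CSrc = CSrc c, CTrg = CTrg d, CBase = VCmp J (CBase d) (CBase c)\<rparr>"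
  "HCmp E d c = \<lparr>CSrc = el_cmp J D (CSrc d) (CSrc c), CTrg = el_cmp J D (CTrg d) (CTrg c),
        CBase = HCmp J (CBase d) (CBase c)\<rparr>"
  "Asc E w v u = \<lparr>CSrc = el_cmp J D (el_cmp J D w v) u, CTrg = el_cmp J D w (el_cmp J D v u),
        CBase = Asc J (EBase w) (EBase v) (EBase u)\<rparr>"
  "LUn E u = \<lparr>CSrc = el_cmp J D (el_id J D (ETrg u)) u, CTrg = u, CBase = LUn J (EBase u)\<rparr>"
  "RUn E u = \<lparr>CSrc = el_cmp J D u (el_id J D (ESrc u)), CTrg = u, CBase = RUn J (EBase u)\<rparr>"
  "(i, x) \<in> Ob0 E \<longleftrightarrow> i \<in> Ob0 J \<and> x \<in> Ob (P0 D i)"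
  by (simp_all add: elements_def Let_def)

lemma mk_Ar1 [simp]: "mk x m f \<in> Ar1 E \<longleftrightarrow> el1_ok x m f"
  unfolding el1_ok_def elements_def Let_def by (auto simp: cell1_def hom_def)

lemma el1_cases:
  assumes "u \<in> Ar1 E"
  obtains x m f where "u = mk x m f" "el1_ok x m f"
proof
  have *: "snd (ESrc u) \<in> Ob (P0 D (fst (ESrc u)))" "EBase u \<in> Ar1 J" "Src1 J (EBase u) = fst (ESrc u)"
    "Trg1 J (EBase u) = fst (ETrg u)" "EFib u \<in> Ar (P0 D (fst (ETrg u)))"
    "Dom (P0 D (fst (ETrg u))) (EFib u) = FOb (P1 D (EBase u)) (snd (ESrc u))"
    "Cod (P0 D (fst (ETrg u))) (EFib u) = snd (ETrg u)"
    using assms by (auto simp: elements_def Let_def cell1_def hom_def)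
  then show "u = mk (snd (ESrc u)) (EBase u) (EFib u)" by (intro el1.equality) simp_all
  show "el1_ok (snd (ESrc u)) (EBase u) (EFib u)" using * by (simp add: el1_ok_def)
qed

lemma el_id_mk: "i \<in> Ob0 J \<Longrightarrow> x \<in> Ob (P0 D i) \<Longrightarrow>
    el_id J D (i, x) = mk x (Id1 J i) (inv_ar (P0 D i) (un i x)) \<and> el1_ok x (Id1 J i) (inv_ar (P0 D i) (un i x))"
  by (auto simp: el_id_def mk_def el1_ok_def)

lemma el_cmp_mk:
  assumes "el1_ok x m f" "el1_ok y n g" "Trg1 J m = Src1 J n" "Cod (P0 D (Trg1 J m)) f = y" "P0 D (Trg1 J n) = K"
  shows "el_cmp J D (mk y n g) (mk x m f) =
      mk x (Cmp1 J n m) (Cmp K g (Cmp K (FAr (P1 D n) f) (inv_ar K (ph n m x))))"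
    and "el1_ok x (Cmp1 J n m) (Cmp K g (Cmp K (FAr (P1 D n) f) (inv_ar K (ph n m x))))"
  using assms by (auto simp: el_cmp_def mk_def el1_ok_def)

lemma el_id_simps [simp]:
  assumes "a \<in> Ob0 E"
  shows "el_id J D a \<in> Ar1 E" "ESrc (el_id J D a) = a" "ETrg (el_id J D a) = a" "EBase (el_id J D a) = Id1 J (fst a)"
  using assms by (cases a; simp add: el_id_mk; fail)+

lemma el_cmp_EBase [simp]: "ESrc (el_cmp J D v u) = ESrc u" "ETrg (el_cmp J D v u) = ETrg v"
  "EBase (el_cmp J D v u) = Cmp1 J (EBase v) (EBase u)"
  by (simp_all add: el_cmp_def Let_def)

lemma el_cmp_Ar1 [simp]: "u \<in> Ar1 E \<Longrightarrow> v \<in> Ar1 E \<Longrightarrow> ETrg u = ESrc v \<Longrightarrow> el_cmp J D v u \<in> Ar1 E"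
  by (elim el1_cases) (simp add: el_cmp_mk)

lemma el1_base: assumes "u \<in> Ar1 E"
  shows "EBase u \<in> Ar1 J" "Src1 J (EBase u) = fst (ESrc u)" "Trg1 J (EBase u) = fst (ETrg u)"
    "ESrc u \<in> Ob0 E" "ETrg u \<in> Ob0 E"
  using assms by (auto elim!: el1_cases simp: el1_ok_def)

lemma el2_iff: "c \<in> Ar2 E \<longleftrightarrow> CSrc c \<in> Ar1 E \<and> CTrg c \<in> Ar1 E \<and> ESrc (CTrg c) = ESrc (CSrc c) \<and>
    ETrg (CTrg c) = ETrg (CSrc c) \<and> CBase c \<in> Ar2 J \<and> Src2 J (CBase c) = EBase (CSrc c) \<and> Trg2 J (CBase c) = EBase (CTrg c) \<and>
    Cmp (P0 D (fst (ETrg (CSrc c)))) (EFib (CTrg c)) (NCmp (P2 D (CBase c)) (snd (ESrc (CSrc c)))) = EFib (CSrc c)"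
  by (auto simp: elements_def Let_def cell2_def)

lemma el2_Id2: "u \<in> Ar1 E \<Longrightarrow> Id2 E u \<in> Ar2 E"
  by (elim el1_cases) (auto simp: el2_iff el1_ok_def)

lemma el2_VCmp:
  assumes c: "c \<in> Ar2 E" and d: "d \<in> Ar2 E" and e: "CTrg c = CSrc d"
  shows "VCmp E d c \<in> Ar2 E"
proof -
  obtain x m f where u: "CSrc c = mk x m f" "el1_ok x m f" using c by (auto simp: el2_iff elim: el1_cases)
  obtain x' n g where v: "CTrg c = mk x' n g" "el1_ok x' n g" using c by (auto simp: el2_iff elim: el1_cases)
  obtain x'' p h where w: "CTrg d = mk x'' p h" "el1_ok x'' p h" using d by (auto simp: el2_iff elim: el1_cases)
  note F = c[unfolded el2_iff u(1) v(1), simplified] d[unfolded el2_iff e[symmetric] v(1) w(1), simplified]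
  show ?thesis
    using F u v w by (auto simp: el2_iff el1_ok_def simp flip: Cmp_asc)
qed

text \<open>
  With \<open>f = f' \<theta>\<^sub>x\<close> and \<open>g = g' \<phi>\<^sub>y\<close>, the triangle of the horizontal composite follows from the
  naturality of \<open>PCp D\<close> in 2-cells and from the naturality of \<open>\<phi>\<close> at \<open>f'\<close>.
\<close>

lemma el2_HCmp:
  assumes c: "c \<in> Ar2 E" and d: "d \<in> Ar2 E" and e: "ETrg (CSrc c) = ESrc (CSrc d)"
  shows "HCmp E d c \<in> Ar2 E"
proof -
  obtain x m f where u: "CSrc c = mk x m f" "el1_ok x m f" using c by (auto simp: el2_iff elim: el1_cases)
  obtain x' m' f' where u': "CTrg c = mk x' m' f'" "el1_ok x' m' f'" using c by (auto simp: el2_iff elim: el1_cases)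
  obtain y n g where v: "CSrc d = mk y n g" "el1_ok y n g" using d by (auto simp: el2_iff elim: el1_cases)
  obtain y' n' g' where v': "CTrg d = mk y' n' g'" "el1_ok y' n' g'" using d by (auto simp: el2_iff elim: el1_cases)
  define \<theta> \<phi> where tp: "\<theta> = CBase c" "\<phi> = CBase d"
  define K where "K = P0 D (Trg1 J n)"
  note C = c[unfolded el2_iff u(1) u'(1) tp(1)[symmetric], simplified]
    and Dd = d[unfolded el2_iff v(1) v'(1) tp(2)[symmetric], simplified]
  note ok = u(2)[unfolded el1_ok_def] u'(2)[unfolded el1_ok_def] v(2)[unfolded el1_ok_def] v'(2)[unfolded el1_ok_def]
  have e': "Trg1 J m = Src1 J n" "Cod (P0 D (Trg1 J m)) f = y" using e u v by auto
  have tC: "\<theta> \<in> Ar2 J" "Src2 J \<theta> = m" "Trg2 J \<theta> = m'" "x' = x" "Src1 J m' = Src1 J m" "Trg1 J m' = Trg1 J m"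
    "Cod (P0 D (Trg1 J m')) f' = Cod (P0 D (Trg1 J m)) f" "Cmp (P0 D (Trg1 J m)) f' (NCmp (P2 D \<theta>) x) = f"
    using C by blast+
  have tD: "\<phi> \<in> Ar2 J" "Src2 J \<phi> = n" "Trg2 J \<phi> = n'" "y' = y" "Src1 J n' = Src1 J n" "Trg1 J n' = Trg1 J n"
    "Cod (P0 D (Trg1 J n')) g' = Cod (P0 D (Trg1 J n)) g" "Cmp (P0 D (Trg1 J n)) g' (NCmp (P2 D \<phi>) y) = g"
    using Dd by blast+
  have t: "\<theta> \<in> Ar2 J" "Src2 J \<theta> = m" "Trg2 J \<theta> = m'" "\<phi> \<in> Ar2 J" "Src2 J \<phi> = n" "Trg2 J \<phi> = n'"
    "x' = x" "y' = y" "Src1 J m' = Src1 J m" "Trg1 J m' = Trg1 J m" "Src1 J n' = Src1 J n" "Trg1 J n' = Trg1 J n"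
    "Cod (P0 D (Trg1 J m)) f' = y" "Cod (P0 D (Trg1 J n)) g' = Cod (P0 D (Trg1 J n)) g"
    using tC(1-6) tD(1-6) tC(7) tD(7) e' by simp_all
  have f: "f = Cmp (P0 D (Src1 J n)) f' (NCmp (P2 D \<theta>) x)" and g: "g = Cmp K g' (NCmp (P2 D \<phi>) y)"
    using tC(8) tD(8) e'(1) by (simp_all add: K_def)
  have K: "category K" using ok by (auto simp: K_def)
  let ?\<phi>m = "NCmp (P2 D \<phi>) (FOb (P1 D m') x)" and ?nt = "FAr (P1 D n) (NCmp (P2 D \<theta>) x)"
  have "NCmp (P2 D (HCmp J \<phi> \<theta>)) x = Cmp K (Cmp K (NCmp (P2 D (HCmp J \<phi> \<theta>)) x) (ph n m x)) (inv_ar K (ph n m x))"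
    using K ok t e' by (simp add: K_def)
  also have "\<dots> = Cmp K (ph n' m' x) (Cmp K ?\<phi>m (Cmp K ?nt (inv_ar K (ph n m x))))"
    using ph_nat2[of \<theta> \<phi> x K, symmetric] K ok t e' by (simp add: K_def)
  finally have 1: "NCmp (P2 D (HCmp J \<phi> \<theta>)) x = \<dots>" .
  have "Cmp K (FAr (P1 D n') f') ?\<phi>m = Cmp K (NCmp (P2 D \<phi>) y) (FAr (P1 D n) f')"
    using ntrans_nat[of "P2 D \<phi>" K "P0 D (Src1 J n)" f' "FOb (P1 D m') x" y] ok t e' by (simp add: K_def)
  then have 2: "Cmp K (FAr (P1 D n') f') (Cmp K ?\<phi>m (Cmp K ?nt (inv_ar K (ph n m x)))) =
      Cmp K (NCmp (P2 D \<phi>) y) (Cmp K (FAr (P1 D n) f') (Cmp K ?nt (inv_ar K (ph n m x))))"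
    by (rule Cmp_reassoc[OF K]) (use ok t e' in \<open>simp_all add: K_def\<close>)
  have 3: "Cmp K (Cmp K g' (Cmp K (FAr (P1 D n') f') (inv_ar K (ph n' m' x)))) (NCmp (P2 D (HCmp J \<phi> \<theta>)) x) =
      Cmp K g (Cmp K (FAr (P1 D n) f) (inv_ar K (ph n m x)))"
    unfolding 1 g f using K ok t e' 2 by (simp add: K_def)
  have "el_cmp J D (CSrc d) (CSrc c) = mk x (Cmp1 J n m) (Cmp K g (Cmp K (FAr (P1 D n) f) (inv_ar K (ph n m x))))"
    "el_cmp J D (CTrg d) (CTrg c) = mk x (Cmp1 J n' m') (Cmp K g' (Cmp K (FAr (P1 D n') f') (inv_ar K (ph n' m' x))))"
    unfolding u v u' v' using u v u' v' t e' by (auto intro!: el_cmp_mk simp: K_def)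
  moreover have "el_cmp J D (CSrc d) (CSrc c) \<in> Ar1 E" "el_cmp J D (CTrg d) (CTrg c) \<in> Ar1 E"
    using c d e by (auto simp: el2_iff)
  ultimately show ?thesis
    using 3 t e' K ok by (simp add: el2_iff K_def tp[symmetric])
qed

text \<open>
  The associativity axiom of \<open>D\<close> determines \<open>D\<close> of an associator only after composition with two
  structure cells \<open>PCp D\<close>; these are invertible, so the triangle may be checked after it.
\<close>

lemma el2_Asc:
  assumes u: "u \<in> Ar1 E" and v: "v \<in> Ar1 E" and w: "w \<in> Ar1 E" and uv: "ETrg u = ESrc v" and vw: "ETrg v = ESrc w"
  shows "Asc E w v u \<in> Ar2 E"
proof -
  obtain x m f where u': "u = mk x m f" "el1_ok x m f" using u by (rule el1_cases)
  obtain y n g where v': "v = mk y n g" "el1_ok y n g" using v by (rule el1_cases)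
  obtain z p h where w': "w = mk z p h" "el1_ok z p h" using w by (rule el1_cases)
  define K where "K = P0 D (Trg1 J p)"
  note ok = u'(2)[unfolded el1_ok_def] v'(2)[unfolded el1_ok_def] w'(2)[unfolded el1_ok_def]
  have e: "Trg1 J m = Src1 J n" "Cod (P0 D (Src1 J n)) f = y" "Trg1 J n = Src1 J p" "Cod (P0 D (Src1 J p)) g = z"
    using uv vw u' v' w' by auto
  have K: "category K" using ok by (auto simp: K_def)
  let ?vu = "Cmp (P0 D (Trg1 J n)) g (Cmp (P0 D (Trg1 J n)) (FAr (P1 D n) f) (inv_ar (P0 D (Trg1 J n)) (ph n m x)))"
  let ?wv = "Cmp K h (Cmp K (FAr (P1 D p) g) (inv_ar K (ph p n y)))"
  let ?l = "Cmp K ?wv (Cmp K (FAr (P1 D (Cmp1 J p n)) f) (inv_ar K (ph (Cmp1 J p n) m x)))"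
  let ?r = "Cmp K h (Cmp K (FAr (P1 D p) ?vu) (inv_ar K (ph p (Cmp1 J n m) x)))"
  have vu: "el_cmp J D v u = mk x (Cmp1 J n m) ?vu" "el1_ok x (Cmp1 J n m) ?vu"
    unfolding u' v' using el_cmp_mk[OF u'(2) v'(2)] e by auto
  have wv: "el_cmp J D w v = mk y (Cmp1 J p n) ?wv" "el1_ok y (Cmp1 J p n) ?wv"
    unfolding v' w' using el_cmp_mk[OF v'(2) w'(2)] e by (auto simp: K_def)
  have l: "el_cmp J D (el_cmp J D w v) u = mk x (Cmp1 J (Cmp1 J p n) m) ?l" "el1_ok x (Cmp1 J (Cmp1 J p n) m) ?l"
    unfolding wv(1) u'(1) using el_cmp_mk[OF u'(2) wv(2)] e ok by (auto simp: K_def)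
  have r: "el_cmp J D w (el_cmp J D v u) = mk x (Cmp1 J p (Cmp1 J n m)) ?r" "el1_ok x (Cmp1 J p (Cmp1 J n m)) ?r"
    unfolding vu(1) w'(1) using el_cmp_mk[OF vu(2) w'(2)] e ok by (auto simp: K_def)
  let ?a = "NCmp (P2 D (Asc J p n m)) x"
  let ?k = "Cmp K (ph (Cmp1 J p n) m x) (ph p n (FOb (P1 D m) x))"
  have "Cmp K ?r ?a = ?l"
  proof (rule iso_epi[OF K])
    show "is_iso K ?k" using K ok e by (intro is_iso_Cmp) (auto simp: K_def)
    have n: "Cmp K (FAr (P1 D (Cmp1 J p n)) f) (ph p n (FOb (P1 D m) x)) = Cmp K (ph p n y) (FAr (P1 D p) (FAr (P1 D n) f))"
      using ok e by (intro ph_nat) (auto simp: K_def)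
    have "Cmp K (Cmp K ?r ?a) ?k = Cmp K ?r (Cmp K ?a ?k)"
      using K ok e by (simp add: K_def)
    also have "\<dots> = Cmp K ?r (Cmp K (ph p (Cmp1 J n m) x) (FAr (P1 D p) (ph n m x)))"
      using ph_Asc[of m n p x K] ok e by (simp add: K_def)
    also have "\<dots> = Cmp K h (Cmp K (FAr (P1 D p) ?vu) (FAr (P1 D p) (ph n m x)))"
      using K ok e by (simp add: K_def)
    also have "Cmp K (FAr (P1 D p) ?vu) (FAr (P1 D p) (ph n m x)) = FAr (P1 D p) (Cmp (P0 D (Trg1 J n)) ?vu (ph n m x))"
      using FAr_Cmp_simp[of "P1 D p" "P0 D (Src1 J p)" "ph n m x" ?vu] ok e by (simp del: FAr_Cmp_simp add: K_def)
    also have "Cmp (P0 D (Trg1 J n)) ?vu (ph n m x) = Cmp (P0 D (Trg1 J n)) g (FAr (P1 D n) f)"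
      using ok e by simp
    also have "Cmp K h (FAr (P1 D p) \<dots>) = Cmp K h (Cmp K (FAr (P1 D p) g) (FAr (P1 D p) (FAr (P1 D n) f)))"
      using K ok e by (simp add: K_def)
    also have "\<dots> = Cmp K ?wv (Cmp K (ph p n y) (FAr (P1 D p) (FAr (P1 D n) f)))"
      using K ok e by (simp add: K_def)
    also have "\<dots> = Cmp K ?l ?k"
      unfolding n[symmetric] using K ok e by (simp add: K_def)
    finally show "Cmp K (Cmp K ?r ?a) ?k = Cmp K ?l ?k" .
  qed (use K ok e in \<open>simp_all add: K_def\<close>)
  then show ?thesis
    using l r u' v' w' ok e K by (simp add: el2_iff K_def)
qed

text \<open>
  The triangles over the unitors, proved by the same cancellation. They are stated for the fibre
  parts because they also compare composites with vertical 1-cells below.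
\<close>

lemma el_id_cmp_fib:
  assumes ok: "el1_ok x m f" and K: "K = P0 D (Trg1 J m)"
  shows "Cmp K f (NCmp (P2 D (LUn J m)) x) =
    Cmp K (inv_ar K (un (Trg1 J m) (Cod K f))) (Cmp K (FAr (P1 D (Id1 J (Trg1 J m))) f) (inv_ar K (ph (Id1 J (Trg1 J m)) m x)))"
    (is "?L = ?R")
proof -
  let ?j = "Trg1 J m"
  note ok' = ok[unfolded el1_ok_def]
  have cK: "category K" using ok' K by auto
  let ?k = "Cmp K (ph (Id1 J ?j) m x) (un ?j (FOb (P1 D m) x))"
  show ?thesis
  proof (rule iso_epi[OF cK])
    show "is_iso K ?k" using K cK ok' by (intro is_iso_Cmp) auto
    have n: "Cmp K (FAr (P1 D (Id1 J ?j)) f) (un ?j (FOb (P1 D m) x)) = Cmp K (un ?j (Cod K f)) f"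
      using ok' K by (intro un_nat) auto
    have "Cmp K ?L ?k = Cmp K f (Cmp K (NCmp (P2 D (LUn J m)) x) ?k)"
      using cK ok' K by simp
    also have "\<dots> = f" using ph_LUn[of m x K ?j] ok' K cK by simp
    also have "\<dots> = Cmp K (inv_ar K (un ?j (Cod K f))) (Cmp K (un ?j (Cod K f)) f)"
      using cK ok' K by simp
    also have "\<dots> = Cmp K ?R ?k"
      unfolding n[symmetric] using cK ok' K by simp
    finally show "Cmp K ?L ?k = Cmp K ?R ?k" .
  qed (use cK ok' K in simp_all)
qed

lemma el_cmp_id_fib:
  assumes ok: "el1_ok x m f" and K: "K = P0 D (Trg1 J m)"
  shows "Cmp K f (NCmp (P2 D (RUn J m)) x) =
    Cmp K f (Cmp K (FAr (P1 D m) (inv_ar (P0 D (Src1 J m)) (un (Src1 J m) x))) (inv_ar K (ph m (Id1 J (Src1 J m)) x)))"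
    (is "?L = ?R")
proof -
  let ?i = "Src1 J m"
  note ok' = ok[unfolded el1_ok_def]
  have cK: "category K" using ok' K by auto
  have im: "is_iso K (FAr (P1 D m) (un ?i x))"
    using functor_iso[of "P1 D m" "un ?i x"] ok' K by simp
  let ?k = "Cmp K (ph m (Id1 J ?i) x) (FAr (P1 D m) (un ?i x))"
  show ?thesis
  proof (rule iso_epi[OF cK])
    show "is_iso K ?k" using K cK ok' im by (intro is_iso_Cmp) auto
    have "Cmp K ?L ?k = Cmp K f (Cmp K (NCmp (P2 D (RUn J m)) x) ?k)"
      using cK ok' K by simp
    also have "\<dots> = f" using ph_RUn[of m x K ?i] ok' K cK by simp
    also have "\<dots> = Cmp K f (FAr (P1 D m) (Cmp (P0 D ?i) (inv_ar (P0 D ?i) (un ?i x)) (un ?i x)))"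
      using cK ok' K by simp
    also have "\<dots> = Cmp K ?R ?k"
      using cK ok' K by (simp del: inv_ar_simps(4))
    finally show "Cmp K ?L ?k = Cmp K ?R ?k" .
  qed (use cK ok' K in simp_all)
qed

lemma el2_LUn: assumes u: "u \<in> Ar1 E" shows "LUn E u \<in> Ar2 E"
proof -
  obtain x m f where u': "u = mk x m f" "el1_ok x m f" using u by (rule el1_cases)
  note ok = u'(2)[unfolded el1_ok_def]
  have i: "el_id J D (ETrg u) = mk (Cod (P0 D (Trg1 J m)) f) (Id1 J (Trg1 J m)) (inv_ar (P0 D (Trg1 J m)) (un (Trg1 J m) (Cod (P0 D (Trg1 J m)) f)))"
    "el1_ok (Cod (P0 D (Trg1 J m)) f) (Id1 J (Trg1 J m)) (inv_ar (P0 D (Trg1 J m)) (un (Trg1 J m) (Cod (P0 D (Trg1 J m)) f)))"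
    using el_id_mk[of "Trg1 J m" "Cod (P0 D (Trg1 J m)) f"] ok u' by auto
  show ?thesis
    using el_cmp_mk[OF u'(2) i(2)] el_id_cmp_fib[OF u'(2) refl] u' i ok by (simp add: el2_iff)
qed

lemma el2_RUn: assumes u: "u \<in> Ar1 E" shows "RUn E u \<in> Ar2 E"
proof -
  obtain x m f where u': "u = mk x m f" "el1_ok x m f" using u by (rule el1_cases)
  note ok = u'(2)[unfolded el1_ok_def]
  have i: "el_id J D (ESrc u) = mk x (Id1 J (Src1 J m)) (inv_ar (P0 D (Src1 J m)) (un (Src1 J m) x))"
    "el1_ok x (Id1 J (Src1 J m)) (inv_ar (P0 D (Src1 J m)) (un (Src1 J m) x))"
    using el_id_mk[of "Src1 J m" x] ok u' by auto
  show ?thesis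
    using el_cmp_mk[OF i(2) u'(2)] el_cmp_id_fib[OF u'(2) refl] u' i ok by (simp add: el2_iff)
qed

text \<open>The triangle of the inverse 2-cell is that of \<open>c\<close> composed with the inverse.\<close>

lemma el2_iso2:
  assumes E: "\<And>a b. a \<in> Ob0 E \<Longrightarrow> b \<in> Ob0 E \<Longrightarrow> category (hom_cat E a b)"
    and c: "c \<in> Ar2 E" and i: "iso2 J (CBase c)"
  shows "iso2 E c"
proof -
  have C: "CSrc c \<in> Ar1 E" "CTrg c \<in> Ar1 E" "ESrc (CTrg c) = ESrc (CSrc c)" "ETrg (CTrg c) = ETrg (CSrc c)"
    "CBase c \<in> Ar2 J" "Src2 J (CBase c) = EBase (CSrc c)" "Trg2 J (CBase c) = EBase (CTrg c)"
    using c by (auto simp: el2_iff)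
  obtain \<phi> where p: "\<phi> \<in> Ar2 J" "Src2 J \<phi> = Trg2 J (CBase c)" "Trg2 J \<phi> = Src2 J (CBase c)"
    "VCmp J \<phi> (CBase c) = Id2 J (Src2 J (CBase c))" "VCmp J (CBase c) \<phi> = Id2 J (Trg2 J (CBase c))"
    using i C S.iso2_iff by blast
  obtain x m f where u: "CSrc c = mk x m f" "el1_ok x m f" using C(1) by (rule el1_cases)
  obtain x' n g where v: "CTrg c = mk x' n g" "el1_ok x' n g" using C(2) by (rule el1_cases)
  define \<theta> where t: "\<theta> = CBase c"
  note F = c[unfolded el2_iff u(1) v(1) t[symmetric], simplified]
  note ok = u(2)[unfolded el1_ok_def] v(2)[unfolded el1_ok_def]
  have e: "nvcmp (P2 D \<theta>) (P2 D \<phi>) = nid (P1 D n)"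
    using p F ok unfolding t[symmetric] by (metis P2_VCmp_simp P2_Id2_simp)
  have "NCmp (nvcmp (P2 D \<theta>) (P2 D \<phi>)) x = Idt (P0 D (Trg1 J m)) (FOb (P1 D n) x)"
    unfolding e using F ok by simp
  then have "Cmp (P0 D (Trg1 J m)) (NCmp (P2 D \<theta>) x) (NCmp (P2 D \<phi>) x) = Idt (P0 D (Trg1 J m)) (FOb (P1 D n) x)"
    using F ok p t by simp
  moreover have tt: "\<theta> \<in> Ar2 J" "Src2 J \<theta> = m" "Trg2 J \<theta> = n" "Trg1 J n = Trg1 J m" "x' = x" "Src1 J n = Src1 J m"
    "Src2 J \<phi> = n" "Trg2 J \<phi> = m"
    using F p t by simp_all
  moreover have "Cod (P0 D (Trg1 J n)) g = Cod (P0 D (Trg1 J m)) f" using F by blast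
  then have cg: "Cod (P0 D (Trg1 J m)) f = Cod (P0 D (Trg1 J m)) g" using tt(4) by simp
  ultimately have "Cmp (P0 D (Trg1 J m)) (Cmp (P0 D (Trg1 J m)) g (NCmp (P2 D \<theta>) x)) (NCmp (P2 D \<phi>) x) = g"
    using ok p(1) by simp
  then have d: "\<lparr>CSrc = CTrg c, CTrg = CSrc c, CBase = \<phi>\<rparr> \<in> Ar2 E"
    using F ok p t u v cg by (simp add: el2_iff)
  show ?thesis
    unfolding iso2_def is_iso_def inverse_ar_def
    by (rule exI[where x = "\<lparr>CSrc = CTrg c, CTrg = CSrc c, CBase = \<phi>\<rparr>"])
      (use C c d p in \<open>auto simp: hom_cat_def hom_def cell1_def\<close>)
qed

text \<open>
  A 2-cell of elements is a 2-cell of \<open>J\<close> with a property. Hence all equations between 2-cells hold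
  because they hold in \<open>J\<close>, and only the closure of the property under the operations, shown above,
  depends on \<open>D\<close>.
\<close>

lemma elements_bicategory: "bicategory E"
proof -
  have hom: "category (hom_cat E a b)" for a b
  proof (rule categoryI)
    fix c assume "c \<in> Ar (hom_cat E a b)"
    then have c: "c \<in> Ar2 E" "CSrc c \<in> cell1 E a b" "CTrg c \<in> cell1 E a b" by (auto simp: hom_cat_def)
    note C = c[unfolded el2_iff]
    show "Dom (hom_cat E a b) c \<in> Ob (hom_cat E a b)" "Cod (hom_cat E a b) c \<in> Ob (hom_cat E a b)"
      using c by (auto simp: hom_cat_def)
    show "Cmp (hom_cat E a b) (Idt (hom_cat E a b) (Cod (hom_cat E a b) c)) c = c"
      using C by (intro el2.equality) (auto simp: hom_cat_def)
    show "Cmp (hom_cat E a b) c (Idt (hom_cat E a b) (Dom (hom_cat E a b) c)) = c"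
      using C by (intro el2.equality) (auto simp: hom_cat_def)
    fix d assume "d \<in> Ar (hom_cat E a b)" "Cod (hom_cat E a b) c = Dom (hom_cat E a b) d"
    then have d: "d \<in> Ar2 E" "CSrc d \<in> cell1 E a b" "CTrg d \<in> cell1 E a b" "CTrg c = CSrc d" by (auto simp: hom_cat_def)
    note Dd = d[unfolded el2_iff]
    show "Cmp (hom_cat E a b) d c \<in> Ar (hom_cat E a b) \<and> Dom (hom_cat E a b) (Cmp (hom_cat E a b) d c) = Dom (hom_cat E a b) c \<and>
        Cod (hom_cat E a b) (Cmp (hom_cat E a b) d c) = Cod (hom_cat E a b) d"
      using el2_VCmp[OF c(1) d(1,4)] c d by (auto simp: hom_cat_def)
    fix e assume "e \<in> Ar (hom_cat E a b)" "Cod (hom_cat E a b) d = Dom (hom_cat E a b) e"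
    then have e: "e \<in> Ar2 E" "CSrc e \<in> cell1 E a b" "CTrg e \<in> cell1 E a b" "CTrg d = CSrc e" by (auto simp: hom_cat_def)
    note Ee = e[unfolded el2_iff]
    show "Cmp (hom_cat E a b) (Cmp (hom_cat E a b) e d) c = Cmp (hom_cat E a b) e (Cmp (hom_cat E a b) d c)"
      using C Dd Ee S.VCmp_assoc[of "CBase c" "CBase d" "CBase e"] by (simp add: hom_cat_def)
  next
    fix u assume u: "u \<in> Ob (hom_cat E a b)"
    then show "Idt (hom_cat E a b) u \<in> Ar (hom_cat E a b) \<and> Dom (hom_cat E a b) (Idt (hom_cat E a b) u) = u \<and>
        Cod (hom_cat E a b) (Idt (hom_cat E a b) u) = u"
      using el2_Id2[of u] by (auto simp: hom_cat_def cell1_def)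
  qed
  have iso: "iso2 E c" if "c \<in> Ar2 E" "iso2 J (CBase c)" for c
    using that hom by (intro el2_iso2)
  have c1: "u \<in> Ar1 E" "ESrc u = a" "ETrg u = b" "EBase u \<in> cell1 J (fst a) (fst b)" if "u \<in> cell1 E a b" for u a b
    using that el1_base[of u] by (auto simp: cell1_def)
  have c2: "c \<in> Ar2 E" "CSrc c = u" "CTrg c = v" "CBase c \<in> cell2 J (EBase u) (EBase v)"
    "v \<in> Ar1 E" "ESrc v = ESrc u" "ETrg v = ETrg u" if "c \<in> cell2 E u v" for c u v
    using that by (auto simp: cell2_def el2_iff)
  show ?thesis
  proof (rule bicategory.intro)
    show "category (hom_cat E a b)" for a b by (rule hom)
    show "Src1 E u \<in> Ob0 E" "Trg1 E u \<in> Ob0 E" if "u \<in> Ar1 E" for u using el1_base[OF that] by simp_all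
    show "Src2 E c \<in> Ar1 E" "Trg2 E c \<in> Ar1 E" "Src1 E (Trg2 E c) = Src1 E (Src2 E c)"
      "Trg1 E (Trg2 E c) = Trg1 E (Src2 E c)" if "c \<in> Ar2 E" for c
      using that by (simp_all add: el2_iff)
    show "Id1 E a \<in> cell1 E a a" if "a \<in> Ob0 E" for a using that by (simp add: cell1_def)
    fix u a b assume u: "u \<in> cell1 E a b"
    note U = c1[OF u]
    show "LUn E u \<in> cell2 E (Cmp1 E (Id1 E b) u) u" "RUn E u \<in> cell2 E (Cmp1 E u (Id1 E a)) u"
      using el2_LUn[OF U(1)] el2_RUn[OF U(1)] U(2,3) by (auto simp: cell2_def)
    show "iso2 E (LUn E u)" "iso2 E (RUn E u)"
      using el2_LUn[OF U(1)] el2_RUn[OF U(1)] U(1) el1_base[OF U(1)] by (auto intro!: iso)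
    show "VCmp E (LUn E u') (whl E (Id1 E b) \<theta>) = VCmp E \<theta> (LUn E u)"
      "VCmp E (RUn E u') (whr E \<theta> (Id1 E a)) = VCmp E \<theta> (RUn E u)" if "\<theta> \<in> cell2 E u u'" for \<theta> u'
      using S.LUn_natural[OF U(4) c2(4)[OF that]] S.RUn_natural[OF U(4) c2(4)[OF that]] c2[OF that] U el1_base[OF U(1)]
      by simp_all
    fix v c assume v: "v \<in> cell1 E b c"
    note V = c1[OF v]
    show "Cmp1 E v u \<in> cell1 E a c" using U V by (simp add: cell1_def)
    show "HCmp E (Id2 E v) (Id2 E u) = Id2 E (Cmp1 E v u)"
      using S.HCmp_Id2[OF U(4) V(4)] by simp
    show "VCmp E (whl E v (LUn E u)) (Asc E v (Id1 E b) u) = whr E (RUn E v) u"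
      using S.triangle[OF U(4) V(4)] U V el1_base[OF U(1)] by simp
    show "HCmp E \<phi> \<theta> \<in> cell2 E (Cmp1 E v u) (Cmp1 E v' u')" if "\<theta> \<in> cell2 E u u'" "\<phi> \<in> cell2 E v v'" for \<theta> \<phi> u' v'
      using el2_HCmp[OF c2(1)[OF that(1)] c2(1)[OF that(2)]] c2(2,3)[OF that(1)] c2(2,3)[OF that(2)] U V
      by (simp add: cell2_def)
    show "HCmp E (VCmp E \<phi>' \<phi>) (VCmp E \<theta>' \<theta>) = VCmp E (HCmp E \<phi>' \<theta>') (HCmp E \<phi> \<theta>)"
      if "\<theta> \<in> cell2 E u u'" "\<theta>' \<in> cell2 E u' u''" "\<phi> \<in> cell2 E v v'" "\<phi>' \<in> cell2 E v' v''" for \<theta> \<theta>' \<phi> \<phi>' u' u'' v' v''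
      using S.interchange[OF U(4) V(4) c2(4)[OF that(1)] c2(4)[OF that(2)] c2(4)[OF that(3)] c2(4)[OF that(4)]]
      by simp
    fix w d assume w: "w \<in> cell1 E c d"
    note W = c1[OF w]
    have a: "Asc E w v u \<in> Ar2 E" using U V W by (intro el2_Asc) simp_all
    then show "Asc E w v u \<in> cell2 E (Cmp1 E (Cmp1 E w v) u) (Cmp1 E w (Cmp1 E v u))"
      by (simp add: cell2_def)
    show "iso2 E (Asc E w v u)"
      by (rule iso[OF a]) (use U V W el1_base[OF U(1)] el1_base[OF V(1)] el1_base[OF W(1)] in simp)
    show "VCmp E (Asc E w' v' u') (HCmp E (HCmp E \<psi> \<phi>) \<theta>) = VCmp E (HCmp E \<psi> (HCmp E \<phi> \<theta>)) (Asc E w v u)"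
      if "\<theta> \<in> cell2 E u u'" "\<phi> \<in> cell2 E v v'" "\<psi> \<in> cell2 E w w'" for \<theta> \<phi> \<psi> u' v' w'
      using S.Asc_natural[OF U(4) V(4) W(4) c2(4)[OF that(1)] c2(4)[OF that(2)] c2(4)[OF that(3)]]
        c2(2,3)[OF that(1)] c2(2,3)[OF that(2)] c2(2,3)[OF that(3)]
      by simp
    fix t e assume t: "t \<in> cell1 E d e"
    note T = c1[OF t]
    show "VCmp E (Asc E t w (Cmp1 E v u)) (Asc E (Cmp1 E t w) v u) =
      VCmp E (whl E t (Asc E w v u)) (VCmp E (Asc E t (Cmp1 E w v) u) (whr E (Asc E t w v) u))"
      using S.pentagon[OF U(4) V(4) W(4) T(4)] by simp
  qed
qed

end

section \<open>Lax cocones as functors on the category of elements\<close>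

lemma const_psf_simps [simp]: "P0 (const_psf Y b) x = b" "P1 (const_psf Y b) m = Id1 Y b"
  "P2 (const_psf Y b) \<theta> = Id2 Y (Id1 Y b)" "PUn (const_psf Y b) x = Id2 Y (Id1 Y b)"
  "PCp (const_psf Y b) n m = LUn Y (Id1 Y b)"
  by (simp_all add: const_psf_def)

lemma Delta_pseudofunctor: "bicategory J \<Longrightarrow> category B \<Longrightarrow> pseudofunctor J Cat (Delta B)"
  by (intro pseudofunctor.intro pseudofunctor_axioms.intro) (auto simp: cell1_def)

context cat_psf
begin

text \<open>
  \<open>Delta B\<close> is constant and strict, so whiskering with it disappears, and each axiom of a lax
  transformation becomes an equation in \<open>B\<close> for every object of a fibre.
\<close>

lemma lax_iff:
  assumes B: "category B"
  shows "lax_transformation J D (Delta B) \<alpha> \<longleftrightarrow>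
    L0 \<alpha> \<in> extensional (Ob0 J) \<and> L1 \<alpha> \<in> extensional (Ar1 J) \<and>
    (\<forall>i\<in>Ob0 J. is_functor (L0 \<alpha> i) \<and> FSrc (L0 \<alpha> i) = P0 D i \<and> FTrg (L0 \<alpha> i) = B) \<and>
    (\<forall>m\<in>Ar1 J. is_ntrans (L1 \<alpha> m) \<and> NSrc (L1 \<alpha> m) = L0 \<alpha> (Src1 J m) \<and>
      NTrg (L1 \<alpha> m) = fcmp (L0 \<alpha> (Trg1 J m)) (P1 D m)) \<and>
    (\<forall>\<theta>\<in>Ar2 J. \<forall>x\<in>Ob (P0 D (Src1 J (Src2 J \<theta>))).
      Cmp B (FAr (L0 \<alpha> (Trg1 J (Src2 J \<theta>))) (NCmp (P2 D \<theta>) x)) (NCmp (L1 \<alpha> (Src2 J \<theta>)) x) = NCmp (L1 \<alpha> (Trg2 J \<theta>)) x) \<and>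
    (\<forall>i\<in>Ob0 J. \<forall>x\<in>Ob (P0 D i). NCmp (L1 \<alpha> (Id1 J i)) x = FAr (L0 \<alpha> i) (un i x)) \<and>
    (\<forall>m\<in>Ar1 J. \<forall>n\<in>Ar1 J. Trg1 J m = Src1 J n \<longrightarrow> (\<forall>x\<in>Ob (P0 D (Src1 J m)).
      NCmp (L1 \<alpha> (Cmp1 J n m)) x = Cmp B (FAr (L0 \<alpha> (Trg1 J n)) (ph n m x))
        (Cmp B (NCmp (L1 \<alpha> n) (FOb (P1 D m) x)) (NCmp (L1 \<alpha> m) x))))"
    (is "_ \<longleftrightarrow> ?R")
proof
  assume "lax_transformation J D (Delta B) \<alpha>"
  then interpret L: lax_transformation J D "Delta B" \<alpha> .
  have 0: "is_functor (L0 \<alpha> i) \<and> FSrc (L0 \<alpha> i) = P0 D i \<and> FTrg (L0 \<alpha> i) = B" if "i \<in> Ob0 J" for i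
    using L.L0_in[OF that] by simp
  have 1: "is_ntrans (L1 \<alpha> m) \<and> NSrc (L1 \<alpha> m) = L0 \<alpha> (Src1 J m) \<and> NTrg (L1 \<alpha> m) = fcmp (L0 \<alpha> (Trg1 J m)) (P1 D m)"
    if "m \<in> Ar1 J" for m
    using L.L1_in[of m "Src1 J m" "Trg1 J m"] that 0[of "Src1 J m"] by (simp add: cell1_def hom_def)
  have 2: "Cmp B (FAr (L0 \<alpha> (Trg1 J (Src2 J \<theta>))) (NCmp (P2 D \<theta>) x)) (NCmp (L1 \<alpha> (Src2 J \<theta>)) x) = NCmp (L1 \<alpha> (Trg2 J \<theta>)) x"
    if t: "\<theta> \<in> Ar2 J" "x \<in> Ob (P0 D (Src1 J (Src2 J \<theta>)))" for \<theta> x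
  proof -
    have "nvcmp (nwhl (L0 \<alpha> (Trg1 J (Src2 J \<theta>))) (P2 D \<theta>)) (L1 \<alpha> (Src2 J \<theta>)) =
        nvcmp (L1 \<alpha> (Trg2 J \<theta>)) (nwhr (nid (fid B)) (L0 \<alpha> (Src1 J (Src2 J \<theta>))))"
      using L.L1_natural[of "Src2 J \<theta>" "Src1 J (Src2 J \<theta>)" "Trg1 J (Src2 J \<theta>)" \<theta> "Trg2 J \<theta>"] t
      by (simp add: cell1_def cell2_def)
    from arg_cong[OF this, of "\<lambda>\<rho>. NCmp \<rho> x"] show ?thesis
      using t B 0[of "Src1 J (Src2 J \<theta>)"] 0[of "Trg1 J (Src2 J \<theta>)"] 1[of "Src2 J \<theta>"] 1[of "Trg2 J \<theta>"] by simp
  qed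
  have 3: "NCmp (L1 \<alpha> (Id1 J i)) x = FAr (L0 \<alpha> i) (un i x)" if t: "i \<in> Ob0 J" "x \<in> Ob (P0 D i)" for i x
    using arg_cong[OF L.L1_Id1[OF t(1)], of "\<lambda>\<rho>. NCmp \<rho> x"] t B 0[OF t(1)] 1[of "Id1 J i"] by simp
  have 4: "NCmp (L1 \<alpha> (Cmp1 J n m)) x = Cmp B (FAr (L0 \<alpha> (Trg1 J n)) (ph n m x))
        (Cmp B (NCmp (L1 \<alpha> n) (FOb (P1 D m) x)) (NCmp (L1 \<alpha> m) x))"
    if t: "m \<in> Ar1 J" "n \<in> Ar1 J" "Trg1 J m = Src1 J n" "x \<in> Ob (P0 D (Src1 J m))" for m n x
  proof -
    have "nvcmp (L1 \<alpha> (Cmp1 J n m)) (nwhr (nid (fid B)) (L0 \<alpha> (Src1 J m))) =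
      nvcmp (nwhl (L0 \<alpha> (Trg1 J n)) (PCp D n m)) (nvcmp (nwhr (L1 \<alpha> n) (P1 D m)) (nwhl (fid B) (L1 \<alpha> m)))"
      using L.L1_Cmp1[of m "Src1 J m" "Trg1 J m" n "Trg1 J n"] t by (simp add: cell1_def)
    from arg_cong[OF this, of "\<lambda>\<rho>. NCmp \<rho> x"] show ?thesis
      using t B 0[of "Src1 J m"] 0[of "Src1 J n"] 0[of "Trg1 J n"] 1[of m] 1[of n] 1[of "Cmp1 J n m"] by simp
  qed
  show ?R using L.L0_ext L.L1_ext 0 1 2 3 4 by blast
next
  assume R: ?R
  then have 0: "is_functor (L0 \<alpha> i)" "FSrc (L0 \<alpha> i) = P0 D i" "FTrg (L0 \<alpha> i) = B" if "i \<in> Ob0 J" for i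
    using that by blast+
  from R have 1: "is_ntrans (L1 \<alpha> m)" "NSrc (L1 \<alpha> m) = L0 \<alpha> (Src1 J m)" "NTrg (L1 \<alpha> m) = fcmp (L0 \<alpha> (Trg1 J m)) (P1 D m)"
    if "m \<in> Ar1 J" for m using that by blast+
  from R have 2: "Cmp B (FAr (L0 \<alpha> (Trg1 J (Src2 J \<theta>))) (NCmp (P2 D \<theta>) x)) (NCmp (L1 \<alpha> (Src2 J \<theta>)) x) = NCmp (L1 \<alpha> (Trg2 J \<theta>)) x"
    if t: "\<theta> \<in> Ar2 J" "x \<in> Ob (P0 D (Src1 J (Src2 J \<theta>)))" for \<theta> x using that by blast
  from R have 3: "NCmp (L1 \<alpha> (Id1 J i)) x = FAr (L0 \<alpha> i) (un i x)" if t: "i \<in> Ob0 J" "x \<in> Ob (P0 D i)" for i x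
    using that by blast
  from R have 4: "NCmp (L1 \<alpha> (Cmp1 J n m)) x = Cmp B (FAr (L0 \<alpha> (Trg1 J n)) (ph n m x))
        (Cmp B (NCmp (L1 \<alpha> n) (FOb (P1 D m) x)) (NCmp (L1 \<alpha> m) x))"
    if t: "m \<in> Ar1 J" "n \<in> Ar1 J" "Trg1 J m = Src1 J n" "x \<in> Ob (P0 D (Src1 J m))" for m n x
    using that by blast
  show "lax_transformation J D (Delta B) \<alpha>"
  proof (intro lax_transformation.intro lax_transformation_axioms.intro)
    show "pseudofunctor J Cat D" by (rule pseudofunctor_axioms)
    show "pseudofunctor J Cat (Delta B)" by (rule Delta_pseudofunctor[OF S.bicategory_axioms B])
    show "L0 \<alpha> \<in> extensional (Ob0 J)" "L1 \<alpha> \<in> extensional (Ar1 J)" using R by blast+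
    show "L0 \<alpha> i \<in> Ob (fun_cat (P0 D i) (P0 (Delta B) i))" if "i \<in> Ob0 J" for i using 0 that by simp
    show "L1 \<alpha> m \<in> hom (fun_cat (P0 D i) (P0 (Delta B) j)) (fcmp (P1 (Delta B) m) (L0 \<alpha> i)) (fcmp (L0 \<alpha> j) (P1 D m))"
      if "m \<in> cell1 J i j" for m i j
      using that by (auto simp: cell1_def hom_def 0 1)
    show "nvcmp (nwhl (L0 \<alpha> j) (P2 D \<theta>)) (L1 \<alpha> m) = nvcmp (L1 \<alpha> n) (nwhr (P2 (Delta B) \<theta>) (L0 \<alpha> i))"
      if "m \<in> cell1 J i j" "\<theta> \<in> cell2 J m n" for m i j \<theta> n
    proof -
      have [simp]: "m \<in> Ar1 J" "n \<in> Ar1 J" "\<theta> \<in> Ar2 J" "Src2 J \<theta> = m" "Trg2 J \<theta> = n" "Src1 J m = i" "Trg1 J m = j"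
        "Src1 J n = i" "Trg1 J n = j" "i \<in> Ob0 J" "j \<in> Ob0 J"
        using that by (auto simp: cell1_def cell2_def)
      show ?thesis using B 2[of \<theta>] by (intro ntrans_eqI) (simp_all add: 0 1)
    qed
    show "nvcmp (L1 \<alpha> (Id1 J i)) (nwhr (PUn (Delta B) i) (L0 \<alpha> i)) = nwhl (L0 \<alpha> i) (PUn D i)"
      if "i \<in> Ob0 J" for i
      using that B 3[of i] by (intro ntrans_eqI) (simp_all add: 0 1)
    show "nvcmp (L1 \<alpha> (Cmp1 J n m)) (nwhr (PCp (Delta B) n m) (L0 \<alpha> i)) =
        nvcmp (nwhl (L0 \<alpha> k) (PCp D n m)) (nvcmp (nwhr (L1 \<alpha> n) (P1 D m)) (nwhl (P1 (Delta B) n) (L1 \<alpha> m)))"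
      if "m \<in> cell1 J i j" "n \<in> cell1 J j k" for m n i j k
    proof -
      have [simp]: "m \<in> Ar1 J" "n \<in> Ar1 J" "Src1 J m = i" "Trg1 J m = j" "Src1 J n = j" "Trg1 J n = k"
        "i \<in> Ob0 J" "j \<in> Ob0 J" "k \<in> Ob0 J"
        using that by (auto simp: cell1_def)
      show ?thesis using B 4[of m n] by (intro ntrans_eqI) (simp_all add: 0 1)
    qed
  qed
qed

lemma laxD:
  assumes B: "category B" and a: "lax_transformation J D (Delta B) \<alpha>"
  shows "i \<in> Ob0 J \<Longrightarrow> is_functor (L0 \<alpha> i)" "i \<in> Ob0 J \<Longrightarrow> FSrc (L0 \<alpha> i) = P0 D i" "i \<in> Ob0 J \<Longrightarrow> FTrg (L0 \<alpha> i) = B"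
    "m \<in> Ar1 J \<Longrightarrow> is_ntrans (L1 \<alpha> m)" "m \<in> Ar1 J \<Longrightarrow> NSrc (L1 \<alpha> m) = L0 \<alpha> (Src1 J m)"
    "m \<in> Ar1 J \<Longrightarrow> NTrg (L1 \<alpha> m) = fcmp (L0 \<alpha> (Trg1 J m)) (P1 D m)"
    "\<theta> \<in> Ar2 J \<Longrightarrow> x \<in> Ob (P0 D (Src1 J (Src2 J \<theta>))) \<Longrightarrow>
      Cmp B (FAr (L0 \<alpha> (Trg1 J (Src2 J \<theta>))) (NCmp (P2 D \<theta>) x)) (NCmp (L1 \<alpha> (Src2 J \<theta>)) x) = NCmp (L1 \<alpha> (Trg2 J \<theta>)) x"
    "i \<in> Ob0 J \<Longrightarrow> x \<in> Ob (P0 D i) \<Longrightarrow> NCmp (L1 \<alpha> (Id1 J i)) x = FAr (L0 \<alpha> i) (un i x)"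
    "m \<in> Ar1 J \<Longrightarrow> n \<in> Ar1 J \<Longrightarrow> Trg1 J m = Src1 J n \<Longrightarrow> x \<in> Ob (P0 D (Src1 J m)) \<Longrightarrow>
      NCmp (L1 \<alpha> (Cmp1 J n m)) x = Cmp B (FAr (L0 \<alpha> (Trg1 J n)) (ph n m x))
        (Cmp B (NCmp (L1 \<alpha> n) (FOb (P1 D m) x)) (NCmp (L1 \<alpha> m) x))"
    "L0 \<alpha> \<in> extensional (Ob0 J)" "L1 \<alpha> \<in> extensional (Ar1 J)"
  using a unfolding lax_iff[OF B] by blast+

lemma modification_iff:
  assumes B: "category B"
  shows "modification J D (Delta B) \<Gamma> \<longleftrightarrow>
    lax_transformation J D (Delta B) (MSrc \<Gamma>) \<and> lax_transformation J D (Delta B) (MTrg \<Gamma>) \<and>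
    MCmp \<Gamma> \<in> extensional (Ob0 J) \<and>
    (\<forall>i\<in>Ob0 J. is_ntrans (MCmp \<Gamma> i) \<and> NSrc (MCmp \<Gamma> i) = L0 (MSrc \<Gamma>) i \<and> NTrg (MCmp \<Gamma> i) = L0 (MTrg \<Gamma>) i) \<and>
    (\<forall>m\<in>Ar1 J. \<forall>x\<in>Ob (P0 D (Src1 J m)).
      Cmp B (NCmp (L1 (MTrg \<Gamma>) m) x) (NCmp (MCmp \<Gamma> (Src1 J m)) x) =
      Cmp B (NCmp (MCmp \<Gamma> (Trg1 J m)) (FOb (P1 D m) x)) (NCmp (L1 (MSrc \<Gamma>) m) x))"
    (is "_ \<longleftrightarrow> ?R")
proof
  assume "modification J D (Delta B) \<Gamma>"
  then interpret M: modification J D "Delta B" \<Gamma> .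
  note l = M.A.lax_transformation_axioms M.B.lax_transformation_axioms
  note 0 = laxD(1-3)[OF B l(1)] laxD(1-3)[OF B l(2)] and 1 = laxD(4-6)[OF B l(1)] laxD(4-6)[OF B l(2)]
  have 2: "is_ntrans (MCmp \<Gamma> i) \<and> NSrc (MCmp \<Gamma> i) = L0 (MSrc \<Gamma>) i \<and> NTrg (MCmp \<Gamma> i) = L0 (MTrg \<Gamma>) i"
    if "i \<in> Ob0 J" for i
    using M.MCmp_in[OF that] by (simp add: hom_def)
  have 3: "Cmp B (NCmp (L1 (MTrg \<Gamma>) m) x) (NCmp (MCmp \<Gamma> (Src1 J m)) x) =
      Cmp B (NCmp (MCmp \<Gamma> (Trg1 J m)) (FOb (P1 D m) x)) (NCmp (L1 (MSrc \<Gamma>) m) x)"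
    if t: "m \<in> Ar1 J" "x \<in> Ob (P0 D (Src1 J m))" for m x
  proof -
    have "nvcmp (L1 (MTrg \<Gamma>) m) (nwhl (fid B) (MCmp \<Gamma> (Src1 J m))) = nvcmp (nwhr (MCmp \<Gamma> (Trg1 J m)) (P1 D m)) (L1 (MSrc \<Gamma>) m)"
      using M.MCmp_L1[of m "Src1 J m" "Trg1 J m"] t by (simp add: cell1_def)
    from arg_cong[OF this, of "\<lambda>\<rho>. NCmp \<rho> x"] show ?thesis
      using t B 2[of "Src1 J m"] 2[of "Trg1 J m"] by (simp add: 0 1)
  qed
  show ?R using l M.MCmp_ext 2 3 by blast
next
  assume R: ?R
  then have l: "lax_transformation J D (Delta B) (MSrc \<Gamma>)" "lax_transformation J D (Delta B) (MTrg \<Gamma>)" by blast+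
  note 0 = laxD(1-3)[OF B l(1)] laxD(1-3)[OF B l(2)] and 1 = laxD(4-6)[OF B l(1)] laxD(4-6)[OF B l(2)]
  from R have 2: "is_ntrans (MCmp \<Gamma> i)" "NSrc (MCmp \<Gamma> i) = L0 (MSrc \<Gamma>) i" "NTrg (MCmp \<Gamma> i) = L0 (MTrg \<Gamma>) i"
    if "i \<in> Ob0 J" for i using that by blast+
  from R have 3: "Cmp B (NCmp (L1 (MTrg \<Gamma>) m) x) (NCmp (MCmp \<Gamma> (Src1 J m)) x) =
      Cmp B (NCmp (MCmp \<Gamma> (Trg1 J m)) (FOb (P1 D m) x)) (NCmp (L1 (MSrc \<Gamma>) m) x)"
    if t: "m \<in> Ar1 J" "x \<in> Ob (P0 D (Src1 J m))" for m x using that by blast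
  show "modification J D (Delta B) \<Gamma>"
  proof (intro modification.intro modification_axioms.intro l)
    show "MCmp \<Gamma> \<in> extensional (Ob0 J)" using R by blast
    show "MCmp \<Gamma> i \<in> hom (fun_cat (P0 D i) (P0 (Delta B) i)) (L0 (MSrc \<Gamma>) i) (L0 (MTrg \<Gamma>) i)" if "i \<in> Ob0 J" for i
      using that by (simp add: hom_def 0 2)
    show "nvcmp (L1 (MTrg \<Gamma>) m) (nwhl (P1 (Delta B) m) (MCmp \<Gamma> i)) = nvcmp (nwhr (MCmp \<Gamma> j) (P1 D m)) (L1 (MSrc \<Gamma>) m)"
      if "m \<in> cell1 J i j" for m i j
    proof -
      have [simp]: "m \<in> Ar1 J" "Src1 J m = i" "Trg1 J m = j" "i \<in> Ob0 J" "j \<in> Ob0 J"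
        using that by (auto simp: cell1_def)
      show ?thesis using B 3[of m] by (intro ntrans_eqI) (simp_all add: 0 1 2)
    qed
  qed
qed

lemma modificationD:
  assumes B: "category B" and g: "modification J D (Delta B) \<Gamma>"
  shows "lax_transformation J D (Delta B) (MSrc \<Gamma>)" "lax_transformation J D (Delta B) (MTrg \<Gamma>)"
    "MCmp \<Gamma> \<in> extensional (Ob0 J)" "i \<in> Ob0 J \<Longrightarrow> is_ntrans (MCmp \<Gamma> i)"
    "i \<in> Ob0 J \<Longrightarrow> NSrc (MCmp \<Gamma> i) = L0 (MSrc \<Gamma>) i" "i \<in> Ob0 J \<Longrightarrow> NTrg (MCmp \<Gamma> i) = L0 (MTrg \<Gamma>) i"
    "m \<in> Ar1 J \<Longrightarrow> x \<in> Ob (P0 D (Src1 J m)) \<Longrightarrow> Cmp B (NCmp (L1 (MTrg \<Gamma>) m) x) (NCmp (MCmp \<Gamma> (Src1 J m)) x) =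
      Cmp B (NCmp (MCmp \<Gamma> (Trg1 J m)) (FOb (P1 D m) x)) (NCmp (L1 (MSrc \<Gamma>) m) x)"
  using g unfolding modification_iff[OF B] by blast+

sublocale E: bicategory E
  by (rule elements_bicategory)

abbreviation "cl u \<equiv> pi_class E u"

text \<open>
  Every 1-cell of elements is, up to a 2-cell, a vertical one after the opcartesian lift of its
  base; this is why a functor on \<open>pi_cat E\<close> is the same as a lax cocone. The isomorphism
  \<open>un\<close> enters into \<open>vert\<close> because the base of a vertical 1-cell is an identity, and
  \<open>1\<^sub>*x\<close> is only isomorphic to \<open>x\<close>.
\<close>

definition vert :: "'j \<Rightarrow> 'a \<Rightarrow> ('j, 'm, 'x, 'a) el1" where
  "vert i f = mk (Dom (P0 D i) f) (Id1 J i) (Cmp (P0 D i) f (inv_ar (P0 D i) (un i (Dom (P0 D i) f))))"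

definition cart :: "'m \<Rightarrow> 'x \<Rightarrow> ('j, 'm, 'x, 'a) el1" where
  "cart m x = mk x m (Idt (P0 D (Trg1 J m)) (FOb (P1 D m) x))"

lemma vert_ok: "i \<in> Ob0 J \<Longrightarrow> f \<in> Ar (P0 D i) \<Longrightarrow>
    el1_ok (Dom (P0 D i) f) (Id1 J i) (Cmp (P0 D i) f (inv_ar (P0 D i) (un i (Dom (P0 D i) f))))"
  by (simp add: el1_ok_def)

lemma vert_simps [simp]: assumes "i \<in> Ob0 J" "f \<in> Ar (P0 D i)"
  shows "vert i f \<in> Ar1 E" "ESrc (vert i f) = (i, Dom (P0 D i) f)" "ETrg (vert i f) = (i, Cod (P0 D i) f)"
  using assms by (simp_all add: vert_def vert_ok)

lemma cart_ok: "m \<in> Ar1 J \<Longrightarrow> x \<in> Ob (P0 D (Src1 J m)) \<Longrightarrow> el1_ok x m (Idt (P0 D (Trg1 J m)) (FOb (P1 D m) x))"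
  by (simp add: el1_ok_def)

lemma cart_simps [simp]: assumes "m \<in> Ar1 J" "x \<in> Ob (P0 D (Src1 J m))"
  shows "cart m x \<in> Ar1 E" "ESrc (cart m x) = (Src1 J m, x)" "ETrg (cart m x) = (Trg1 J m, FOb (P1 D m) x)"
  using assms by (simp_all add: cart_def cart_ok)

lemma cl_eqI:
  assumes "u \<in> Ar1 E" "v \<in> Ar1 E" "ESrc v = ESrc u" "ETrg v = ETrg u" "\<theta> \<in> Ar2 J"
    "Src2 J \<theta> = EBase u" "Trg2 J \<theta> = EBase v"
    "Cmp (P0 D (fst (ETrg u))) (EFib v) (NCmp (P2 D \<theta>) (snd (ESrc u))) = EFib u"
  shows "cl u = cl v"
  by (rule E.pi_class_eqI[where \<theta> = "\<lparr>CSrc = u, CTrg = v, CBase = \<theta>\<rparr>"]) (use assms in \<open>simp_all add: el2_iff\<close>)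

text \<open>Vertical 1-cells act on either side through the fibre, by the unitors \<open>LUn J m\<close> and \<open>RUn J n\<close>.\<close>

lemma cl_vert_cmp:
  assumes ok: "el1_ok x m f" and g: "g \<in> Ar (P0 D (Trg1 J m))" "Dom (P0 D (Trg1 J m)) g = Cod (P0 D (Trg1 J m)) f"
  shows "cl (el_cmp J D (vert (Trg1 J m) g) (mk x m f)) = cl (mk x m (Cmp (P0 D (Trg1 J m)) g f))"
proof -
  define K where "K = P0 D (Trg1 J m)"
  note ok' = ok[unfolded el1_ok_def]
  have K: "category K" using ok' by (auto simp: K_def)
  let ?j = "Trg1 J m"
  have v: "vert ?j g = mk (Cod K f) (Id1 J ?j) (Cmp K g (inv_ar K (un ?j (Cod K f))))"
    "el1_ok (Cod K f) (Id1 J ?j) (Cmp K g (inv_ar K (un ?j (Cod K f))))"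
    using g ok' vert_ok[of ?j g] by (auto simp: vert_def K_def)
  have c: "el_cmp J D (vert ?j g) (mk x m f) = mk x (Cmp1 J (Id1 J ?j) m)
      (Cmp K (Cmp K g (inv_ar K (un ?j (Cod K f)))) (Cmp K (FAr (P1 D (Id1 J ?j)) f) (inv_ar K (ph (Id1 J ?j) m x))))"
    "el1_ok x (Cmp1 J (Id1 J ?j) m) (Cmp K (Cmp K g (inv_ar K (un ?j (Cod K f)))) (Cmp K (FAr (P1 D (Id1 J ?j)) f) (inv_ar K (ph (Id1 J ?j) m x))))"
    unfolding v(1) using el_cmp_mk[OF ok v(2), of K] ok' by (auto simp: K_def)
  have "Cmp K (Cmp K g f) (NCmp (P2 D (LUn J m)) x) = Cmp K g (Cmp K f (NCmp (P2 D (LUn J m)) x))"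
    using K ok' g by (simp add: K_def)
  also have "\<dots> = Cmp K (Cmp K g (inv_ar K (un ?j (Cod K f)))) (Cmp K (FAr (P1 D (Id1 J ?j)) f) (inv_ar K (ph (Id1 J ?j) m x)))"
    unfolding el_id_cmp_fib[OF ok K_def] using K ok' g by (simp add: K_def)
  finally show ?thesis
    using c ok' g K by (intro cl_eqI[where \<theta> = "LUn J m"]) (auto simp: K_def el1_ok_def)
qed

lemma cl_cmp_vert:
  assumes ok: "el1_ok y n h" and f: "f \<in> Ar (P0 D (Src1 J n))" "Cod (P0 D (Src1 J n)) f = y" "Dom (P0 D (Src1 J n)) f = x"
  shows "cl (el_cmp J D (mk y n h) (vert (Src1 J n) f)) = cl (mk x n (Cmp (P0 D (Trg1 J n)) h (FAr (P1 D n) f)))"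
proof -
  define K where "K = P0 D (Trg1 J n)"
  define I where "I = P0 D (Src1 J n)"
  note ok' = ok[unfolded el1_ok_def]
  have K: "category K" using ok' by (auto simp: K_def)
  let ?i = "Src1 J n"
  have v: "vert ?i f = mk x (Id1 J ?i) (Cmp I f (inv_ar I (un ?i x)))"
    "el1_ok x (Id1 J ?i) (Cmp I f (inv_ar I (un ?i x)))"
    using f ok' vert_ok[of ?i f] by (auto simp: vert_def I_def)
  have c: "el_cmp J D (mk y n h) (vert ?i f) = mk x (Cmp1 J n (Id1 J ?i))
      (Cmp K h (Cmp K (FAr (P1 D n) (Cmp I f (inv_ar I (un ?i x)))) (inv_ar K (ph n (Id1 J ?i) x))))"
    "el1_ok x (Cmp1 J n (Id1 J ?i)) (Cmp K h (Cmp K (FAr (P1 D n) (Cmp I f (inv_ar I (un ?i x)))) (inv_ar K (ph n (Id1 J ?i) x))))"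
    unfolding v(1) using el_cmp_mk[OF v(2) ok, of K] ok' f by (auto simp: K_def I_def)
  have ok2: "el1_ok x n (Cmp K h (FAr (P1 D n) f))" using ok' f by (auto simp: el1_ok_def K_def)
  have "Cmp K (Cmp K h (FAr (P1 D n) f)) (NCmp (P2 D (RUn J n)) x) =
      Cmp K h (Cmp K (FAr (P1 D n) (Cmp I f (inv_ar I (un ?i x)))) (inv_ar K (ph n (Id1 J ?i) x)))"
    unfolding el_cmp_id_fib[OF ok2 K_def] using K ok' f by (auto simp: K_def I_def)
  then show ?thesis
    using c ok2 ok' f K by (intro cl_eqI[where \<theta> = "RUn J n"]) (auto simp: K_def I_def el1_ok_def)
qed

lemma cl_2cell:
  assumes t: "\<theta> \<in> Ar2 J" and x: "x \<in> Ob (P0 D (Src1 J (Src2 J \<theta>)))"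
    and g: "g \<in> Ar (P0 D (Trg1 J (Src2 J \<theta>)))" "Dom (P0 D (Trg1 J (Src2 J \<theta>))) g = FOb (P1 D (Trg2 J \<theta>)) x"
  shows "cl (mk x (Src2 J \<theta>) (Cmp (P0 D (Trg1 J (Src2 J \<theta>))) g (NCmp (P2 D \<theta>) x))) = cl (mk x (Trg2 J \<theta>) g)"
  using assms by (intro cl_eqI[where \<theta> = \<theta>]) (simp_all add: el1_ok_def)

lemma cl_decompose:
  assumes ok: "el1_ok x m f"
  shows "cl (mk x m f) = cl (el_cmp J D (vert (Trg1 J m) f) (cart m x))"
proof -
  note ok' = ok[unfolded el1_ok_def]
  show ?thesis
    using cl_vert_cmp[OF cart_ok[of m x], of f] ok' by (simp add: cart_def)
qed

lemma el_cmp_cart: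
  assumes "m \<in> Ar1 J" "n \<in> Ar1 J" "Trg1 J m = Src1 J n" "x \<in> Ob (P0 D (Src1 J m))"
  shows "el_cmp J D (cart n (FOb (P1 D m) x)) (cart m x) = mk x (Cmp1 J n m) (inv_ar (P0 D (Trg1 J n)) (ph n m x))"
  unfolding cart_def using assms el_cmp_mk(1)[OF cart_ok[of m x] cart_ok[of n "FOb (P1 D m) x"], of "P0 D (Trg1 J n)"]
  by simp

lemma vert_un: "i \<in> Ob0 J \<Longrightarrow> x \<in> Ob (P0 D i) \<Longrightarrow> vert i (un i x) = cart (Id1 J i) x"
  by (simp add: vert_def cart_def)

lemma vert_Idt: "i \<in> Ob0 J \<Longrightarrow> x \<in> Ob (P0 D i) \<Longrightarrow> vert i (Idt (P0 D i) x) = el_id J D (i, x)"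
  by (simp add: vert_def el_id_mk)

end

context cat_psf
begin

definition lax_of :: "('j \<times> 'x, ('j, 'm, 'x, 'a) el1 set, 'p, 'b) func \<Rightarrow> ('j, 'm, 'x, 'a, 'p, 'b) lax" where
  "lax_of G = (let F = (\<lambda>i. functor_of (P0 D i) (FTrg G) (\<lambda>x. FOb G (i, x)) (\<lambda>f. FAr G (cl (vert i f)))) in
    \<lparr>L0 = (\<lambda>i\<in>Ob0 J. F i),
     L1 = (\<lambda>m\<in>Ar1 J. \<lparr>NSrc = F (Src1 J m), NTrg = fcmp (F (Trg1 J m)) (P1 D m),
       NCmp = (\<lambda>x\<in>Ob (P0 D (Src1 J m)). FAr G (cl (cart m x)))\<rparr>)\<rparr>)"

definition mod_of :: "('j \<times> 'x, ('j, 'm, 'x, 'a) el1 set, 'p, 'b) ntrans \<Rightarrow> ('j, 'm, 'x, 'a, 'p, 'b) modif" where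
  "mod_of \<tau> = \<lparr>MSrc = lax_of (NSrc \<tau>), MTrg = lax_of (NTrg \<tau>),
     MCmp = (\<lambda>i\<in>Ob0 J. \<lparr>NSrc = L0 (lax_of (NSrc \<tau>)) i, NTrg = L0 (lax_of (NTrg \<tau>)) i,
       NCmp = (\<lambda>x\<in>Ob (P0 D i). NCmp \<tau> (i, x))\<rparr>)\<rparr>"

text \<open>
  The inverses: a lax cocone acts on \<open>(m, f)\<close> through the decomposition of this 1-cell into
  \<open>vert j f\<close> and \<open>cart m x\<close>.
\<close>

definition glue :: "('p, 'b) cat \<Rightarrow> ('j, 'm, 'x, 'a, 'p, 'b) lax \<Rightarrow> ('j \<times> 'x, ('j, 'm, 'x, 'a) el1 set, 'p, 'b) func" where
  "glue B \<alpha> = E.pi_lift B (\<lambda>a. FOb (L0 \<alpha> (fst a)) (snd a))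
     (\<lambda>u. Cmp B (FAr (L0 \<alpha> (fst (ETrg u))) (EFib u)) (NCmp (L1 \<alpha> (EBase u)) (snd (ESrc u))))"

definition glue_mod :: "('p, 'b) cat \<Rightarrow> ('j, 'm, 'x, 'a, 'p, 'b) modif \<Rightarrow> ('j \<times> 'x, ('j, 'm, 'x, 'a) el1 set, 'p, 'b) ntrans" where
  "glue_mod B \<Gamma> = \<lparr>NSrc = glue B (MSrc \<Gamma>), NTrg = glue B (MTrg \<Gamma>),
     NCmp = (\<lambda>a\<in>Ob0 E. NCmp (MCmp \<Gamma> (fst a)) (snd a))\<rparr>"

lemma lax_of_simps [simp]:
  "i \<in> Ob0 J \<Longrightarrow> FSrc (L0 (lax_of G) i) = P0 D i" "i \<in> Ob0 J \<Longrightarrow> FTrg (L0 (lax_of G) i) = FTrg G"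
  "i \<in> Ob0 J \<Longrightarrow> x \<in> Ob (P0 D i) \<Longrightarrow> FOb (L0 (lax_of G) i) x = FOb G (i, x)"
  "i \<in> Ob0 J \<Longrightarrow> f \<in> Ar (P0 D i) \<Longrightarrow> FAr (L0 (lax_of G) i) f = FAr G (cl (vert i f))"
  "m \<in> Ar1 J \<Longrightarrow> NSrc (L1 (lax_of G) m) = L0 (lax_of G) (Src1 J m)"
  "m \<in> Ar1 J \<Longrightarrow> NTrg (L1 (lax_of G) m) = fcmp (L0 (lax_of G) (Trg1 J m)) (P1 D m)"
  "m \<in> Ar1 J \<Longrightarrow> x \<in> Ob (P0 D (Src1 J m)) \<Longrightarrow> NCmp (L1 (lax_of G) m) x = FAr G (cl (cart m x))"
  "L0 (lax_of G) \<in> extensional (Ob0 J)" "L1 (lax_of G) \<in> extensional (Ar1 J)"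
  by (simp_all add: lax_of_def Let_def)

lemma mod_of_simps [simp]: "MSrc (mod_of \<tau>) = lax_of (NSrc \<tau>)" "MTrg (mod_of \<tau>) = lax_of (NTrg \<tau>)"
  "i \<in> Ob0 J \<Longrightarrow> NSrc (MCmp (mod_of \<tau>) i) = L0 (lax_of (NSrc \<tau>)) i"
  "i \<in> Ob0 J \<Longrightarrow> NTrg (MCmp (mod_of \<tau>) i) = L0 (lax_of (NTrg \<tau>)) i"
  "i \<in> Ob0 J \<Longrightarrow> x \<in> Ob (P0 D i) \<Longrightarrow> NCmp (MCmp (mod_of \<tau>) i) x = NCmp \<tau> (i, x)"
  "MCmp (mod_of \<tau>) \<in> extensional (Ob0 J)"
  by (simp_all add: mod_of_def)

lemma lax_eqI:
  fixes \<alpha> \<beta> :: "('j, 'm, 'x, 'a, 'p, 'b) lax"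
  assumes B: "category B" and a: "lax_transformation J D (Delta B) \<alpha>" and b: "lax_transformation J D (Delta B) \<beta>"
    and 0: "\<And>i x. i \<in> Ob0 J \<Longrightarrow> x \<in> Ob (P0 D i) \<Longrightarrow> FOb (L0 \<alpha> i) x = FOb (L0 \<beta> i) x"
    and 1: "\<And>i f. i \<in> Ob0 J \<Longrightarrow> f \<in> Ar (P0 D i) \<Longrightarrow> FAr (L0 \<alpha> i) f = FAr (L0 \<beta> i) f"
    and 2: "\<And>m x. m \<in> Ar1 J \<Longrightarrow> x \<in> Ob (P0 D (Src1 J m)) \<Longrightarrow> NCmp (L1 \<alpha> m) x = NCmp (L1 \<beta> m) x"
  shows "\<alpha> = \<beta>"
proof (rule lax.equality)
  note A = laxD[OF B a] and Bb = laxD[OF B b]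
  have L: "L0 \<alpha> i = L0 \<beta> i" if "i \<in> Ob0 J" for i
    using that A(1-3) Bb(1-3) 0 1 by (intro functor_eqI) simp_all
  show "L0 \<alpha> = L0 \<beta>" by (rule extensionalityI[OF A(10) Bb(10) L])
  have "L1 \<alpha> m = L1 \<beta> m" if "m \<in> Ar1 J" for m
    using that A(1-6) Bb(1-6) L 2 by (intro ntrans_eqI) simp_all
  then show "L1 \<alpha> = L1 \<beta>" by (rule extensionalityI[OF A(11) Bb(11)])
qed simp

lemma modification_eqI:
  fixes \<Gamma> \<Delta> :: "('j, 'm, 'x, 'a, 'p, 'b) modif"
  assumes B: "category B" and a: "modification J D (Delta B) \<Gamma>" and b: "modification J D (Delta B) \<Delta>"
    and e: "MSrc \<Gamma> = MSrc \<Delta>" "MTrg \<Gamma> = MTrg \<Delta>"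
    and 0: "\<And>i x. i \<in> Ob0 J \<Longrightarrow> x \<in> Ob (P0 D i) \<Longrightarrow> NCmp (MCmp \<Gamma> i) x = NCmp (MCmp \<Delta> i) x"
  shows "\<Gamma> = \<Delta>"
proof (rule modif.equality)
  note A = modificationD[OF B a] and Bb = modificationD[OF B b]
  have "MCmp \<Gamma> i = MCmp \<Delta> i" if "i \<in> Ob0 J" for i
    using that A(4-6) Bb(4-6) e 0 laxD(2)[OF B Bb(1)] by (intro ntrans_eqI) simp_all
  then show "MCmp \<Gamma> = MCmp \<Delta>" by (rule extensionalityI[OF A(3) Bb(3)])
qed (use e in auto)

context
  fixes G :: "('j \<times> 'x, ('j, 'm, 'x, 'a) el1 set, 'p, 'b) func" and B
  assumes G: "is_functor G" "FSrc G = pi_cat E" "FTrg G = B"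
begin

lemma G_Ar [simp]: assumes "u \<in> Ar1 E"
  shows "FAr G (cl u) \<in> Ar B" "Dom B (FAr G (cl u)) = FOb G (ESrc u)" "Cod B (FAr G (cl u)) = FOb G (ETrg u)"
  using G assms by simp_all

lemma G_cmp: "u \<in> Ar1 E \<Longrightarrow> v \<in> Ar1 E \<Longrightarrow> ETrg u = ESrc v \<Longrightarrow>
    FAr G (cl (el_cmp J D v u)) = Cmp B (FAr G (cl v)) (FAr G (cl u))"
  using pi_functor_Cmp1[OF elements_bicategory G(1,2), of u v] G(3) by simp

lemma G_id: "a \<in> Ob0 E \<Longrightarrow> FAr G (cl (el_id J D a)) = Idt B (FOb G a)"
  using pi_functor_Id1[OF elements_bicategory G(1,2), of a] G(3) by simp

lemma G_vert:
  assumes "el1_ok x m f" "g \<in> Ar (P0 D (Trg1 J m))" "Dom (P0 D (Trg1 J m)) g = Cod (P0 D (Trg1 J m)) f" "Trg1 J m = j"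
  shows "Cmp B (FAr G (cl (vert j g))) (FAr G (cl (mk x m f))) = FAr G (cl (mk x m (Cmp (P0 D j) g f)))"
proof -
  have "m \<in> Ar1 J" using assms(1) by (simp add: el1_ok_def)
  then show ?thesis
    unfolding assms(4)[symmetric] cl_vert_cmp[OF assms(1-3), symmetric]
    using assms(1-3) by (intro G_cmp[symmetric]) simp_all
qed

lemma G_vert':
  assumes "el1_ok y n h" "f \<in> Ar (P0 D (Src1 J n))" "Cod (P0 D (Src1 J n)) f = y" "Dom (P0 D (Src1 J n)) f = x" "Src1 J n = i"
  shows "Cmp B (FAr G (cl (mk y n h))) (FAr G (cl (vert i f))) = FAr G (cl (mk x n (Cmp (P0 D (Trg1 J n)) h (FAr (P1 D n) f))))"
proof -
  have "n \<in> Ar1 J" using assms(1) by (simp add: el1_ok_def)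
  then show ?thesis
    unfolding assms(5)[symmetric] cl_cmp_vert[OF assms(1-4), symmetric]
    using assms(1-4) by (intro G_cmp[symmetric]) simp_all
qed

lemma G_decompose: assumes "el1_ok x m f"
  shows "FAr G (cl (mk x m f)) = Cmp B (FAr G (cl (vert (Trg1 J m) f))) (FAr G (cl (cart m x)))"
proof -
  have "m \<in> Ar1 J" "x \<in> Ob (P0 D (Src1 J m))" "f \<in> Ar (P0 D (Trg1 J m))" "Dom (P0 D (Trg1 J m)) f = FOb (P1 D m) x"
    using assms by (simp_all add: el1_ok_def)
  then show ?thesis unfolding cl_decompose[OF assms] by (intro G_cmp) simp_all
qed

lemma lax_of_functor [simp]: "i \<in> Ob0 J \<Longrightarrow> is_functor (L0 (lax_of G) i)"
proof (rule functorI[where C = "P0 D i" and B = B])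
  assume i: "i \<in> Ob0 J"
  show "FOb (L0 (lax_of G) i) \<in> extensional (Ob (P0 D i))" "FAr (L0 (lax_of G) i) \<in> extensional (Ar (P0 D i))"
    using i by (simp_all add: lax_of_def Let_def)
  show "FAr (L0 (lax_of G) i) (Idt (P0 D i) x) = Idt B (FOb (L0 (lax_of G) i) x)" if "x \<in> Ob (P0 D i)" for x
    using i that by (simp add: vert_Idt G_id)
  fix f g assume fg: "f \<in> Ar (P0 D i)" "g \<in> Ar (P0 D i)" "Cod (P0 D i) f = Dom (P0 D i) g"
  have v: "FAr G (cl (vert i f)) = FAr G (cl (mk (Dom (P0 D i) f) (Id1 J i) (Cmp (P0 D i) f (inv_ar (P0 D i) (un i (Dom (P0 D i) f))))))"
    by (simp add: vert_def)
  have "Cmp B (FAr G (cl (vert i g))) (FAr G (cl (vert i f))) = FAr G (cl (vert i (Cmp (P0 D i) g f)))"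
    unfolding v using fg i G_vert[OF vert_ok[OF i fg(1)], of g i] by (simp add: vert_def)
  then show "FAr (L0 (lax_of G) i) (Cmp (P0 D i) g f) = Cmp B (FAr (L0 (lax_of G) i) g) (FAr (L0 (lax_of G) i) f)"
    using i fg by simp
qed (use G in \<open>auto simp: functor_cats\<close>)

text \<open>
  Naturality of \<open>L1\<close> says that vertical 1-cells slide past opcartesian lifts; the other axioms hold
  because a 2-cell \<open>\<theta>\<close> connects \<open>(m, \<theta>\<^sub>x)\<close> with \<open>cart n x\<close>, because \<open>vert i (un i x)\<close> is the lift of an
  identity, and because \<open>ph n m x\<close> corrects the composite of two lifts to a lift.
\<close>

lemma lax_of_lax: "lax_transformation J D (Delta B) (lax_of G)"
proof -
  have B: "category B" using G by auto
  have 1: "is_ntrans (L1 (lax_of G) m)" if m: "m \<in> Ar1 J" for m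
  proof (rule ntransI[where C = "P0 D (Src1 J m)" and B = B])
    show "NCmp (L1 (lax_of G) m) \<in> extensional (Ob (P0 D (Src1 J m)))"
      using m by (simp add: lax_of_def Let_def)
    fix f assume f: "f \<in> Ar (P0 D (Src1 J m))"
    let ?x = "Dom (P0 D (Src1 J m)) f" and ?y = "Cod (P0 D (Src1 J m)) f"
    have "Cmp B (FAr G (cl (vert (Trg1 J m) (FAr (P1 D m) f)))) (FAr G (cl (cart m ?x))) = FAr G (cl (mk ?x m (FAr (P1 D m) f)))"
      using m f G_vert[OF cart_ok[of m ?x], of "FAr (P1 D m) f"] by (simp add: cart_def)
    also have "\<dots> = Cmp B (FAr G (cl (cart m ?y))) (FAr G (cl (vert (Src1 J m) f)))"
      using m f G_vert'[OF cart_ok[of m ?y], of f] by (simp add: cart_def)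
    finally show "Cmp B (FAr (fcmp (L0 (lax_of G) (Trg1 J m)) (P1 D m)) f) (NCmp (L1 (lax_of G) m) ?x) =
        Cmp B (NCmp (L1 (lax_of G) m) ?y) (FAr (L0 (lax_of G) (Src1 J m)) f)"
      using m f by simp
  qed (use m G in simp_all)
  have 2: "Cmp B (FAr G (cl (vert (Trg1 J (Src2 J \<theta>)) (NCmp (P2 D \<theta>) x)))) (FAr G (cl (cart (Src2 J \<theta>) x))) = FAr G (cl (cart (Trg2 J \<theta>) x))"
    if t: "\<theta> \<in> Ar2 J" "x \<in> Ob (P0 D (Src1 J (Src2 J \<theta>)))" for \<theta> x
  proof -
    have "Cmp B (FAr G (cl (vert (Trg1 J (Src2 J \<theta>)) (NCmp (P2 D \<theta>) x)))) (FAr G (cl (cart (Src2 J \<theta>) x))) =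
        FAr G (cl (mk x (Src2 J \<theta>) (NCmp (P2 D \<theta>) x)))"
      using t G_vert[OF cart_ok[of "Src2 J \<theta>" x], of "NCmp (P2 D \<theta>) x"] by (simp add: cart_def)
    also have "\<dots> = FAr G (cl (cart (Trg2 J \<theta>) x))"
      using cl_2cell[OF t, of "Idt (P0 D (Trg1 J (Src2 J \<theta>))) (FOb (P1 D (Trg2 J \<theta>)) x)"] t by (simp add: cart_def)
    finally show ?thesis .
  qed
  have 4: "FAr G (cl (cart (Cmp1 J n m) x)) = Cmp B (FAr G (cl (vert (Trg1 J n) (ph n m x))))
      (Cmp B (FAr G (cl (cart n (FOb (P1 D m) x)))) (FAr G (cl (cart m x))))"
    if t: "m \<in> Ar1 J" "n \<in> Ar1 J" "Trg1 J m = Src1 J n" "x \<in> Ob (P0 D (Src1 J m))" for m n x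
  proof -
    have "Cmp B (FAr G (cl (cart n (FOb (P1 D m) x)))) (FAr G (cl (cart m x))) =
        FAr G (cl (mk x (Cmp1 J n m) (inv_ar (P0 D (Trg1 J n)) (ph n m x))))"
      unfolding el_cmp_cart[OF t, symmetric] using t by (intro G_cmp[symmetric]) simp_all
    moreover have "el1_ok x (Cmp1 J n m) (inv_ar (P0 D (Trg1 J n)) (ph n m x))"
      using t by (simp add: el1_ok_def)
    ultimately show ?thesis
      using t G_vert[of x "Cmp1 J n m" "inv_ar (P0 D (Trg1 J n)) (ph n m x)" "ph n m x" "Trg1 J n"]
      by (simp add: cart_def)
  qed
  show ?thesis
    unfolding lax_iff[OF B] using G 1 2 4 by (simp add: vert_un)
qed

end

text \<open>
  Conversely, the axiom on 2-cells makes \<open>glue\<close> well defined on connected components, the unit axiom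
  makes it preserve identities, and the composition axiom, with the naturality of \<open>L1\<close>,
  composites.
\<close>

lemma glue_functor:
  assumes B: "category B" and a: "lax_transformation J D (Delta B) \<alpha>"
  shows "is_functor (glue B \<alpha>)"
    and "el1_ok x m f \<Longrightarrow> FAr (glue B \<alpha>) (cl (mk x m f)) = Cmp B (FAr (L0 \<alpha> (Trg1 J m)) f) (NCmp (L1 \<alpha> m) x)"
proof -
  note [simp] = laxD(1-6)[OF B a] and N2 = laxD(7)[OF B a] and N1 = laxD(8)[OF B a] and N4 = laxD(9)[OF B a]
  let ?k = "\<lambda>a. FOb (L0 \<alpha> (fst a)) (snd a)"
  let ?h = "\<lambda>u. Cmp B (FAr (L0 \<alpha> (fst (ETrg u))) (EFib u)) (NCmp (L1 \<alpha> (EBase u)) (snd (ESrc u)))"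
  have k: "?k a \<in> Ob B" if "a \<in> Ob0 E" for a using that by (cases a) simp
  have h: "?h u \<in> Ar B \<and> Dom B (?h u) = ?k (Src1 E u) \<and> Cod B (?h u) = ?k (Trg1 E u)" if "u \<in> Ar1 E" for u
    using that B by (elim el1_cases) (simp add: el1_ok_def)
  have inv: "?h (Src2 E c) = ?h (Trg2 E c)" if c: "c \<in> Ar2 E" for c
  proof -
    obtain x m f where u: "CSrc c = mk x m f" "el1_ok x m f" using c by (auto simp: el2_iff elim: el1_cases)
    obtain x' n g where v: "CTrg c = mk x' n g" "el1_ok x' n g" using c by (auto simp: el2_iff elim: el1_cases)
    define \<theta> where t: "\<theta> = CBase c"
    note C = c[unfolded el2_iff u(1) v(1) t[symmetric], simplified]
    have C': "x' = x" "Trg1 J n = Trg1 J m" "\<theta> \<in> Ar2 J" "Src2 J \<theta> = m" "Trg2 J \<theta> = n"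
      "Cmp (P0 D (Trg1 J m)) g (NCmp (P2 D \<theta>) x) = f" using C by blast+
    note ok = u(2)[unfolded el1_ok_def] v(2)[unfolded el1_ok_def]
    have "Cmp B (FAr (L0 \<alpha> (Trg1 J m)) (Cmp (P0 D (Trg1 J m)) g (NCmp (P2 D \<theta>) x))) (NCmp (L1 \<alpha> m) x) =
        Cmp B (FAr (L0 \<alpha> (Trg1 J m)) g) (Cmp B (FAr (L0 \<alpha> (Trg1 J m)) (NCmp (P2 D \<theta>) x)) (NCmp (L1 \<alpha> m) x))"
      using C'(1-5) ok B by simp
    also have "\<dots> = Cmp B (FAr (L0 \<alpha> (Trg1 J m)) g) (NCmp (L1 \<alpha> n) x)"
      using N2[of \<theta> x] C'(1-5) ok by simp
    finally show ?thesis using C' u v by simp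
  qed
  have idt: "?h (Id1 E a) = Idt B (?k a)" if a': "a \<in> Ob0 E" for a
  proof -
    obtain i x where a: "a = (i, x)" "i \<in> Ob0 J" "x \<in> Ob (P0 D i)" using a' by (cases a) simp
    have "Cmp B (FAr (L0 \<alpha> i) (inv_ar (P0 D i) (un i x))) (FAr (L0 \<alpha> i) (un i x)) =
        FAr (L0 \<alpha> i) (Cmp (P0 D i) (inv_ar (P0 D i) (un i x)) (un i x))"
      using a FAr_Cmp_simp[of "L0 \<alpha> i" "P0 D i" "un i x" "inv_ar (P0 D i) (un i x)"] by (simp del: FAr_Cmp_simp)
    then show ?thesis using a by (simp add: el_id_mk N1)
  qed
  have cmp: "?h (Cmp1 E v u) = Cmp B (?h v) (?h u)" if u: "u \<in> Ar1 E" and v: "v \<in> Ar1 E" and uv: "Trg1 E u = Src1 E v" for u v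
  proof -
    obtain x m f where u': "u = mk x m f" "el1_ok x m f" using u by (rule el1_cases)
    obtain y n g where v': "v = mk y n g" "el1_ok y n g" using v by (rule el1_cases)
    note ok = u'(2)[unfolded el1_ok_def] v'(2)[unfolded el1_ok_def]
    define K where "K = P0 D (Trg1 J n)"
    have K: "category K" using ok by (auto simp: K_def)
    have e: "Trg1 J m = Src1 J n" "Cod (P0 D (Src1 J n)) f = y" using uv u' v' by auto
    let ?F = "FAr (L0 \<alpha> (Trg1 J n))"
    let ?p = "ph n m x"
    have fn: "is_functor (L0 \<alpha> (Trg1 J n))" "FSrc (L0 \<alpha> (Trg1 J n)) = K" "FTrg (L0 \<alpha> (Trg1 J n)) = B"
      using ok by (simp_all add: K_def)
    have i: "Cmp B (?F (inv_ar K ?p)) (?F ?p) = Idt B (FOb (L0 \<alpha> (Trg1 J n)) (FOb (P1 D n) (FOb (P1 D m) x)))"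
      using ok e fn K FAr_Cmp_simp[of "L0 \<alpha> (Trg1 J n)" K ?p "inv_ar K ?p"] by (simp del: FAr_Cmp_simp add: K_def)
    have i': "Cmp B (?F (inv_ar K ?p)) (Cmp B (?F ?p) w) = w"
      if "w \<in> Ar B" "Cod B w = FOb (L0 \<alpha> (Trg1 J n)) (FOb (P1 D n) (FOb (P1 D m) x))" for w
    proof -
      have "Cmp B (Cmp B (?F (inv_ar K ?p)) (?F ?p)) w = w" unfolding i using that B by simp
      then show ?thesis using ok e K B that by (simp add: K_def)
    qed
    have n: "Cmp B (?F (FAr (P1 D n) f)) (NCmp (L1 \<alpha> n) (FOb (P1 D m) x)) = Cmp B (NCmp (L1 \<alpha> n) y) (FAr (L0 \<alpha> (Src1 J n)) f)"
      using ntrans_nat[of "L1 \<alpha> n" B "P0 D (Src1 J n)" f "FOb (P1 D m) x" y] ok e by simp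
    have "?h (Cmp1 E v u) = Cmp B (?F (Cmp K g (Cmp K (FAr (P1 D n) f) (inv_ar K ?p)))) (NCmp (L1 \<alpha> (Cmp1 J n m)) x)"
      using el_cmp_mk(1)[OF u'(2) v'(2), of K] u' v' e ok by (simp add: K_def)
    also have "\<dots> = Cmp B (?F g) (Cmp B (?F (FAr (P1 D n) f)) (Cmp B (NCmp (L1 \<alpha> n) (FOb (P1 D m) x)) (NCmp (L1 \<alpha> m) x)))"
      using ok e K B i' by (simp add: N4 K_def)
    also have "Cmp B (?F (FAr (P1 D n) f)) (Cmp B (NCmp (L1 \<alpha> n) (FOb (P1 D m) x)) (NCmp (L1 \<alpha> m) x)) =
        Cmp B (NCmp (L1 \<alpha> n) y) (Cmp B (FAr (L0 \<alpha> (Src1 J n)) f) (NCmp (L1 \<alpha> m) x))"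
      by (rule Cmp_reassoc[OF B n]) (use ok e in simp_all)
    finally show ?thesis using ok e B u' v' by (simp add: K_def)
  qed
  show "is_functor (glue B \<alpha>)"
    unfolding glue_def by (rule E.pi_lift_functor[OF B k h inv idt cmp])
  show "FAr (glue B \<alpha>) (cl (mk x m f)) = Cmp B (FAr (L0 \<alpha> (Trg1 J m)) f) (NCmp (L1 \<alpha> m) x)" if "el1_ok x m f"
    unfolding glue_def using E.pi_lift_functor(2)[OF B k h inv idt cmp, of "mk x m f"] that by simp
qed

lemma glue_simps [simp]: "FSrc (glue B \<alpha>) = pi_cat E" "FTrg (glue B \<alpha>) = B"
  "(i, x) \<in> Ob0 E \<Longrightarrow> FOb (glue B \<alpha>) (i, x) = FOb (L0 \<alpha> i) x"
  unfolding glue_def by simp_all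

lemma glue_lax_of:
  assumes G: "is_functor G" "FSrc G = pi_cat E" "FTrg G = B"
  shows "glue B (lax_of G) = G"
proof (rule E.pi_functor_eqI)
  have B: "category B" using G by auto
  note L = lax_of_lax[OF G]
  show "is_functor (glue B (lax_of G))" by (rule glue_functor(1)[OF B L])
  show "FOb (glue B (lax_of G)) a = FOb G a" if "a \<in> Ob0 E" for a using that by (cases a) simp
  show "FAr (glue B (lax_of G)) (cl u) = FAr G (cl u)" if u: "u \<in> Ar1 E" for u
  proof -
    obtain x m f where u': "u = mk x m f" "el1_ok x m f" using u by (rule el1_cases)
    note ok = u'(2)[unfolded el1_ok_def]
    show ?thesis
      unfolding u'(1) glue_functor(2)[OF B L u'(2)] G_decompose[OF G u'(2)] using ok by simp
  qed
qed (use G in auto)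

lemma lax_of_glue:
  assumes B: "category B" and a: "lax_transformation J D (Delta B) \<alpha>"
  shows "lax_of (glue B \<alpha>) = \<alpha>"
proof (rule lax_eqI[OF B _ a])
  note [simp] = laxD(1-6)[OF B a] and N1 = laxD(8)[OF B a]
  show "lax_transformation J D (Delta B) (lax_of (glue B \<alpha>))"
    using glue_functor(1)[OF B a] by (intro lax_of_lax) simp_all
  show "FOb (L0 (lax_of (glue B \<alpha>)) i) x = FOb (L0 \<alpha> i) x" if "i \<in> Ob0 J" "x \<in> Ob (P0 D i)" for i x
    using that by simp
  show "FAr (L0 (lax_of (glue B \<alpha>)) i) f = FAr (L0 \<alpha> i) f" if i: "i \<in> Ob0 J" and f: "f \<in> Ar (P0 D i)" for i f
  proof -
    let ?x = "Dom (P0 D i) f" and ?u = "inv_ar (P0 D i) (un i (Dom (P0 D i) f))"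
    have "FAr (L0 (lax_of (glue B \<alpha>)) i) f = Cmp B (FAr (L0 \<alpha> i) (Cmp (P0 D i) f ?u)) (FAr (L0 \<alpha> i) (un i ?x))"
      using i f glue_functor(2)[OF B a vert_ok[OF i f]] by (simp add: vert_def N1 del: FAr_Cmp_simp)
    also have "\<dots> = FAr (L0 \<alpha> i) (Cmp (P0 D i) (Cmp (P0 D i) f ?u) (un i ?x))"
      using i f FAr_Cmp_simp[of "L0 \<alpha> i" "P0 D i" "un i ?x" "Cmp (P0 D i) f ?u"] by (simp del: FAr_Cmp_simp Cmp_asc)
    also have "\<dots> = FAr (L0 \<alpha> i) f" using i f by (simp del: FAr_Cmp_simp)
    finally show ?thesis .
  qed
  show "NCmp (L1 (lax_of (glue B \<alpha>)) m) x = NCmp (L1 \<alpha> m) x" if m: "m \<in> Ar1 J" "x \<in> Ob (P0 D (Src1 J m))" for m x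
    using m B glue_functor(2)[OF B a cart_ok[OF m]] by (simp add: cart_def)
qed

lemma mod_of_modification:
  assumes t: "is_ntrans \<tau>" "FSrc (NSrc \<tau>) = pi_cat E" "FTrg (NSrc \<tau>) = B"
  shows "modification J D (Delta B) (mod_of \<tau>)"
proof -
  have B: "category B" using t functor_cats(2)[of "NSrc \<tau>"] by auto
  have G: "is_functor (NSrc \<tau>)" "FSrc (NSrc \<tau>) = pi_cat E" "FTrg (NSrc \<tau>) = B"
    and H: "is_functor (NTrg \<tau>)" "FSrc (NTrg \<tau>) = pi_cat E" "FTrg (NTrg \<tau>) = B" using t by simp_all
  have n: "Cmp B (FAr (NTrg \<tau>) (cl u)) (NCmp \<tau> (ESrc u)) = Cmp B (NCmp \<tau> (ETrg u)) (FAr (NSrc \<tau>) (cl u))" if "u \<in> Ar1 E" for u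
    using E.pi_ntrans_nat[OF t that] by simp
  have "is_ntrans (MCmp (mod_of \<tau>) i)" if i: "i \<in> Ob0 J" for i
  proof (rule ntransI[where C = "P0 D i" and B = B])
    show "is_functor (L0 (lax_of (NSrc \<tau>)) i)" "is_functor (L0 (lax_of (NTrg \<tau>)) i)"
      using lax_of_functor[OF G i] lax_of_functor[OF H i] .
    show "NCmp (MCmp (mod_of \<tau>) i) \<in> extensional (Ob (P0 D i))" using i by (simp add: mod_of_def)
    fix f assume "f \<in> Ar (P0 D i)"
    then show "Cmp B (FAr (L0 (lax_of (NTrg \<tau>)) i) f) (NCmp (MCmp (mod_of \<tau>) i) (Dom (P0 D i) f)) =
        Cmp B (NCmp (MCmp (mod_of \<tau>) i) (Cod (P0 D i) f)) (FAr (L0 (lax_of (NSrc \<tau>)) i) f)"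
      using i n[of "vert i f"] by simp
  qed (use i t G H in simp_all)
  moreover have "Cmp B (FAr (NTrg \<tau>) (cl (cart m x))) (NCmp \<tau> (Src1 J m, x)) =
      Cmp B (NCmp \<tau> (Trg1 J m, FOb (P1 D m) x)) (FAr (NSrc \<tau>) (cl (cart m x)))" if "m \<in> Ar1 J" "x \<in> Ob (P0 D (Src1 J m))" for m x
    using n[of "cart m x"] that by simp
  ultimately show ?thesis
    unfolding modification_iff[OF B] using lax_of_lax[OF G] lax_of_lax[OF H] by simp
qed

lemma glue_mod_simps [simp]: "NSrc (glue_mod B \<Gamma>) = glue B (MSrc \<Gamma>)" "NTrg (glue_mod B \<Gamma>) = glue B (MTrg \<Gamma>)"
  "(i, x) \<in> Ob0 E \<Longrightarrow> NCmp (glue_mod B \<Gamma>) (i, x) = NCmp (MCmp \<Gamma> i) x"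
  by (simp_all add: glue_mod_def del: el_simps)

text \<open>
  Naturality at a vertical 1-cell is naturality within a fibre, naturality at an opcartesian lift is
  the modification axiom; a general 1-cell is composed of these.
\<close>

lemma glue_mod_ntrans:
  assumes B: "category B" and g: "modification J D (Delta B) \<Gamma>"
  shows "is_ntrans (glue_mod B \<Gamma>)"
proof -
  note a = modificationD(1)[OF B g] and b = modificationD(2)[OF B g] and n = modificationD(7)[OF B g]
  note [simp] = laxD(1-6)[OF B a] laxD(1-6)[OF B b] modificationD(4-6)[OF B g]
  show ?thesis
  proof (rule E.pi_ntransI[where B = B and G = "glue B (MSrc \<Gamma>)" and H = "glue B (MTrg \<Gamma>)"])
    show "is_functor (glue B (MSrc \<Gamma>))" "is_functor (glue B (MTrg \<Gamma>))" using glue_functor(1)[OF B] a b by auto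
    show "NCmp (glue_mod B \<Gamma>) \<in> extensional (Ob0 E)" by (simp add: glue_mod_def)
    show "NCmp (glue_mod B \<Gamma>) c \<in> Ar B \<and> Dom B (NCmp (glue_mod B \<Gamma>) c) = FOb (glue B (MSrc \<Gamma>)) c \<and>
        Cod B (NCmp (glue_mod B \<Gamma>) c) = FOb (glue B (MTrg \<Gamma>)) c" if "c \<in> Ob0 E" for c
      using that by (cases c) simp
    fix u assume "u \<in> Ar1 E"
    then obtain x m f where u': "u = mk x m f" "el1_ok x m f" by (rule el1_cases)
    note ok = u'(2)[unfolded el1_ok_def]
    let ?j = "Trg1 J m" and ?y = "Cod (P0 D (Trg1 J m)) f" and ?mx = "FOb (P1 D m) x"
    have "Cmp B (Cmp B (FAr (L0 (MTrg \<Gamma>) ?j) f) (NCmp (L1 (MTrg \<Gamma>) m) x)) (NCmp (MCmp \<Gamma> (Src1 J m)) x) =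
        Cmp B (FAr (L0 (MTrg \<Gamma>) ?j) f) (Cmp B (NCmp (MCmp \<Gamma> ?j) ?mx) (NCmp (L1 (MSrc \<Gamma>) m) x))"
      using ok B by (simp add: n)
    also have "\<dots> = Cmp B (NCmp (MCmp \<Gamma> ?j) ?y) (Cmp B (FAr (L0 (MSrc \<Gamma>) ?j) f) (NCmp (L1 (MSrc \<Gamma>) m) x))"
    proof (rule Cmp_reassoc[OF B])
      show "Cmp B (FAr (L0 (MTrg \<Gamma>) ?j) f) (NCmp (MCmp \<Gamma> ?j) ?mx) = Cmp B (NCmp (MCmp \<Gamma> ?j) ?y) (FAr (L0 (MSrc \<Gamma>) ?j) f)"
        using ntrans_nat[of "MCmp \<Gamma> ?j" B "P0 D ?j" f ?mx ?y] ok by simp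
    qed (use ok in simp_all)
    finally show "Cmp B (FAr (glue B (MTrg \<Gamma>)) (cl u)) (NCmp (glue_mod B \<Gamma>) (Src1 E u)) =
        Cmp B (NCmp (glue_mod B \<Gamma>) (Trg1 E u)) (FAr (glue B (MSrc \<Gamma>)) (cl u))"
      unfolding u'(1) glue_functor(2)[OF B a u'(2)] glue_functor(2)[OF B b u'(2)]
      using ok by simp
  qed simp_all
qed

end

lemma Lax_simps [simp]:
  "\<alpha> \<in> Ob (Lax J D E) \<longleftrightarrow> lax_transformation J D E \<alpha>" "\<Gamma> \<in> Ar (Lax J D E) \<longleftrightarrow> modification J D E \<Gamma>"
  "Dom (Lax J D E) = MSrc" "Cod (Lax J D E) = MTrg"
  "Idt (Lax J D E) \<alpha> = \<lparr>MSrc = \<alpha>, MTrg = \<alpha>, MCmp = (\<lambda>i\<in>Ob0 J. nid (L0 \<alpha> i))\<rparr>"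
  "Cmp (Lax J D E) \<Delta> \<Gamma> = \<lparr>MSrc = MSrc \<Gamma>, MTrg = MTrg \<Delta>, MCmp = (\<lambda>i\<in>Ob0 J. nvcmp (MCmp \<Delta> i) (MCmp \<Gamma> i))\<rparr>"
  by (simp_all add: Lax_def)

context cat_psf
begin

lemma mod_of_components:
  assumes t: "is_ntrans \<tau>" "FSrc (NSrc \<tau>) = pi_cat E" "FTrg (NSrc \<tau>) = B" and i: "i \<in> Ob0 J"
  shows "is_ntrans (MCmp (mod_of \<tau>) i)"
proof -
  have B: "category B" using t functor_cats(2)[of "NSrc \<tau>"] by auto
  show ?thesis by (rule modificationD(4)[OF B mod_of_modification[OF t] i])
qed

text \<open>Needed for identities and composites in \<open>Lax\<close>, which are at first mere records.\<close>

lemma modif_raw_eqI: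
  assumes "MSrc \<Gamma> = MSrc \<Delta>" "MTrg \<Gamma> = MTrg \<Delta>" "MCmp \<Gamma> \<in> extensional (Ob0 J)" "MCmp \<Delta> \<in> extensional (Ob0 J)"
    and "\<And>i. i \<in> Ob0 J \<Longrightarrow> MCmp \<Gamma> i = MCmp \<Delta> i"
  shows "\<Gamma> = (\<Delta> :: ('j, 'm, 'x, 'a, 'p, 'b) modif)"
  using assms by (intro modif.equality extensionalityI[of "MCmp \<Gamma>" "Ob0 J"]) simp_all

lemma fun_cat_iso_Lax:
  fixes B :: "('p, 'b) cat"
  assumes B: "category B"
  shows "cat_iso (fun_cat (pi_cat E) B) (Lax J D (Delta B)) lax_of mod_of"
proof (rule cat_isoI[where f' = "glue B" and g' = "glue_mod B"])
  fix \<tau> :: "('j \<times> 'x, ('j, 'm, 'x, 'a) el1 set, 'p, 'b) ntrans"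
  assume t': "\<tau> \<in> Ar (fun_cat (pi_cat E) B)"
  then have t: "is_ntrans \<tau>" "FSrc (NSrc \<tau>) = pi_cat E" "FTrg (NSrc \<tau>) = B" by simp_all
  then have G: "is_functor (NSrc \<tau>)" "FSrc (NSrc \<tau>) = pi_cat E" "FTrg (NSrc \<tau>) = B"
    and H: "is_functor (NTrg \<tau>)" "FSrc (NTrg \<tau>) = pi_cat E" "FTrg (NTrg \<tau>) = B" by simp_all
  note m = mod_of_modification[OF t]
  show "mod_of \<tau> \<in> Ar (Lax J D (Delta B))" using m by simp
  show "glue_mod B (mod_of \<tau>) = \<tau>"
    using glue_mod_ntrans[OF B m] t
    by (intro ntrans_eqI) (auto simp: glue_lax_of[OF G] glue_lax_of[OF H])
  fix \<sigma> assume s': "\<sigma> \<in> Ar (fun_cat (pi_cat E) B)" "Cod (fun_cat (pi_cat E) B) \<tau> = Dom (fun_cat (pi_cat E) B) \<sigma>"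
  then have s: "is_ntrans \<sigma>" "FSrc (NSrc \<sigma>) = pi_cat E" "FTrg (NSrc \<sigma>) = B" and e: "NTrg \<tau> = NSrc \<sigma>" by simp_all
  have st: "is_ntrans (nvcmp \<sigma> \<tau>)" "FSrc (NSrc (nvcmp \<sigma> \<tau>)) = pi_cat E" "FTrg (NSrc (nvcmp \<sigma> \<tau>)) = B"
    using s t e by simp_all
  show "mod_of (Cmp (fun_cat (pi_cat E) B) \<sigma> \<tau>) = Cmp (Lax J D (Delta B)) (mod_of \<sigma>) (mod_of \<tau>)"
  proof (rule modif_raw_eqI)
    fix i assume i: "i \<in> Ob0 J"
    have "MCmp (mod_of (nvcmp \<sigma> \<tau>)) i = nvcmp (MCmp (mod_of \<sigma>) i) (MCmp (mod_of \<tau>) i)"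
      using i e t s mod_of_components[OF t i] mod_of_components[OF s i] mod_of_components[OF st i]
      by (intro ntrans_eqI) simp_all
    then show "MCmp (mod_of (Cmp (fun_cat (pi_cat E) B) \<sigma> \<tau>)) i = MCmp (Cmp (Lax J D (Delta B)) (mod_of \<sigma>) (mod_of \<tau>)) i"
      using i by simp
  qed simp_all
next
  fix G :: "('j \<times> 'x, ('j, 'm, 'x, 'a) el1 set, 'p, 'b) func"
  assume "G \<in> Ob (fun_cat (pi_cat E) B)"
  then have G: "is_functor G" "FSrc G = pi_cat E" "FTrg G = B" by simp_all
  show "lax_of G \<in> Ob (Lax J D (Delta B))" using lax_of_lax[OF G] by simp
  show "glue B (lax_of G) = G" by (rule glue_lax_of[OF G])
  have n: "is_ntrans (nid G)" "FSrc (NSrc (nid G)) = pi_cat E" "FTrg (NSrc (nid G)) = B" using G by simp_all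
  show "mod_of (Idt (fun_cat (pi_cat E) B) G) = Idt (Lax J D (Delta B)) (lax_of G)"
  proof (rule modif_raw_eqI)
    fix i assume i: "i \<in> Ob0 J"
    have "MCmp (mod_of (nid G)) i = nid (L0 (lax_of G) i)"
      using i G mod_of_components[OF n i] lax_of_functor[OF G i] by (intro ntrans_eqI) simp_all
    then show "MCmp (mod_of (Idt (fun_cat (pi_cat E) B) G)) i = MCmp (Idt (Lax J D (Delta B)) (lax_of G)) i"
      using i by simp
  qed simp_all
next
  fix \<alpha> :: "('j, 'm, 'x, 'a, 'p, 'b) lax" assume "\<alpha> \<in> Ob (Lax J D (Delta B))"
  then have a: "lax_transformation J D (Delta B) \<alpha>" by simp
  show "glue B \<alpha> \<in> Ob (fun_cat (pi_cat E) B)" using glue_functor(1)[OF B a] by simp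
  show "lax_of (glue B \<alpha>) = \<alpha>" by (rule lax_of_glue[OF B a])
next
  fix \<Gamma> :: "('j, 'm, 'x, 'a, 'p, 'b) modif" assume "\<Gamma> \<in> Ar (Lax J D (Delta B))"
  then have g: "modification J D (Delta B) \<Gamma>" by simp
  note a = modificationD(1)[OF B g] and b = modificationD(2)[OF B g]
  show gl: "glue_mod B \<Gamma> \<in> Ar (fun_cat (pi_cat E) B)" using glue_mod_ntrans[OF B g] by simp
  show "mod_of (glue_mod B \<Gamma>) = \<Gamma>"
    by (rule modification_eqI[OF B mod_of_modification g]) (use gl lax_of_glue[OF B a] lax_of_glue[OF B b] in simp_all)
qed simp_all

text \<open>
  The lifts \<open>cart m x\<close> are opcartesian, and an opcartesian 1-cell is the composite of such a lift with
  the vertical 1-cell of an isomorphism in a fibre, which every functor inverts.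
\<close>

lemma lax_of_invertible_iff:
  assumes G: "is_functor G" "FSrc G = pi_cat E" "FTrg G = B"
  shows "(\<forall>s\<in>pi_class E ` opcartesian J D. is_iso B (FAr G s)) \<longleftrightarrow> (\<forall>m\<in>Ar1 J. invertible_ntrans (L1 (lax_of G) m))"
proof -
  have B: "category B" using G by auto
  have inv: "invertible_ntrans (L1 (lax_of G) m) \<longleftrightarrow> (\<forall>x\<in>Ob (P0 D (Src1 J m)). is_iso B (FAr G (cl (cart m x))))"
    if m: "m \<in> Ar1 J" for m
  proof -
    have "is_ntrans (L1 (lax_of G) m)" using laxD(4)[OF B lax_of_lax[OF G] m] .
    then show ?thesis
      unfolding invertible_ntrans_def using m G by (simp add: fun_cat_iso_iff)
  qed
  show ?thesis
  proof (intro iffI ballI)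
    fix m assume op: "\<forall>s\<in>pi_class E ` opcartesian J D. is_iso B (FAr G s)" and m: "m \<in> Ar1 J"
    have "cart m x \<in> opcartesian J D" if "x \<in> Ob (P0 D (Src1 J m))" for x
      using that m cart_ok[OF m that] by (simp add: opcartesian_def cart_def)
    then show "invertible_ntrans (L1 (lax_of G) m)" using op by (auto simp: inv[OF m])
  next
    fix s assume ps: "\<forall>m\<in>Ar1 J. invertible_ntrans (L1 (lax_of G) m)" and "s \<in> pi_class E ` opcartesian J D"
    then obtain u where s: "s = cl u" and u: "u \<in> Ar1 E" "is_iso (P0 D (fst (ETrg u))) (EFib u)"
      by (auto simp: opcartesian_def)
    obtain x m f where u': "u = mk x m f" "el1_ok x m f" using u(1) by (rule el1_cases)
    note ok = u'(2)[unfolded el1_ok_def]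
    have "is_iso B (FAr (L0 (lax_of G) (Trg1 J m)) f)"
      using functor_iso[of "L0 (lax_of G) (Trg1 J m)" f] lax_of_functor[OF G, of "Trg1 J m"] ok u(2) G(3)
      by (simp add: u'(1))
    then have "is_iso B (FAr G (cl (vert (Trg1 J m) f)))" using ok by simp
    moreover have "is_iso B (FAr G (cl (cart m x)))" using ps ok inv[of m] by simp
    ultimately show "is_iso B (FAr G s)"
      unfolding s u'(1) G_decompose[OF G u'(2)] using ok B G by (intro is_iso_Cmp) simp_all
  qed
qed

lemma fun_cat_inv_iso_Ps:
  assumes B: "category B"
  shows "cat_iso (fun_cat_inv (pi_cat E) (pi_class E ` opcartesian J D) B) (Ps J D (Delta B)) lax_of mod_of"
  unfolding fun_cat_inv_def Ps_def
  by (intro cat_iso_full_sub fun_cat_iso_Lax[OF B] lax_of_invertible_iff) simp_all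

end

section \<open>The universal property of the category of fractions\<close>

text \<open>
  The value of a zigzag under a functor that inverts its backward steps. The end \<open>y\<close> is an argument
  because an empty zigzag does not show where it lives.
\<close>

fun zev :: "('o, 'a, 'p, 'b) func \<Rightarrow> 'o \<Rightarrow> 'a zig list \<Rightarrow> 'b" where
  "zev G y [] = Idt (FTrg G) (FOb G y)"
| "zev G y (Fwd f # zs) = Cmp (FTrg G) (zev G y zs) (FAr G f)"
| "zev G y (Bwd s # zs) = Cmp (FTrg G) (zev G y zs) (inv_ar (FTrg G) (FAr G s))"

lemma zev_append_cong: "zev G y w = zev G y w' \<Longrightarrow> zev G y (us @ w) = zev G y (us @ w')"
proof (induction us)
  case (Cons z us) then show ?case by (cases z) auto
qed simp

lemma zstep_append: "zstep C S u v \<Longrightarrow> zstep C S (p @ u @ q) (p @ v @ q)"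
proof (induction rule: zstep.induct)
  case (zcmp us f g vs) then show ?case using zstep.zcmp[of C S "p @ us" f g "vs @ q"] by simp
next
  case (zidt x us vs) then show ?case using zstep.zidt[of x C S "p @ us" "vs @ q"] by simp
next
  case (zfb us s vs) then show ?case using zstep.zfb[of C S "p @ us" s "vs @ q"] by simp
next
  case (zbf us s vs) then show ?case using zstep.zbf[of C S "p @ us" s "vs @ q"] by simp
qed

locale localization =
  fixes C :: "('o, 'a) cat" and S :: "'a set"
  assumes C [simp]: "category C" and S: "S \<subseteq> Ar C"
begin

abbreviation "zz x u y \<equiv> zigzag C S x u y"
abbreviation "zc x y u \<equiv> zclass C S x y u"
abbreviation "L \<equiv> fractions C S"
abbreviation "ar x u y \<equiv> (x, zclass C S x y u, y)"

lemma zigzag_Ob: "zz x u y \<Longrightarrow> x \<in> Ob C \<and> y \<in> Ob C"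
  by (induction u arbitrary: x rule: list.induct) (auto simp: C elim: zigzag.elims)

lemma zigzag_append: "zz x (u @ v) z \<longleftrightarrow> (\<exists>y. zz x u y \<and> zz y v z)"
proof (induction u arbitrary: x)
  case Nil then show ?case using zigzag_Ob by auto
next
  case (Cons a u) then show ?case by (cases a) auto
qed

lemma zclass_invariant:
  assumes u: "zz x u y" and v: "v \<in> zc x y u"
    and inv: "\<And>a b. zz x a y \<Longrightarrow> zz x b y \<Longrightarrow> zstep C S a b \<Longrightarrow> h a = h b"
  shows "zz x v y \<and> h v = h u"
proof -
  have "(u, v) \<in> (zrel C S x y \<union> (zrel C S x y)\<inverse>)\<^sup>*" using v by (simp add: zclass_def)
  then show ?thesis
  proof induction
    case base then show ?case using u by simp
  next
    case (step a b)
    have "zz x a y \<and> zz x b y \<and> (zstep C S a b \<or> zstep C S b a)" using step(2) by (auto simp: zrel_def)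
    then show ?case using step(3) inv[of a b] inv[of b a] by auto
  qed
qed

lemma zclass_self [simp]: "u \<in> zc x y u"
  by (simp add: zclass_def)

lemma zclass_step:
  assumes "zz x u y" "zz x v y" "zstep C S u v"
  shows "zc x y u = zc x y v"
proof -
  let ?R = "zrel C S x y \<union> (zrel C S x y)\<inverse>"
  have uv: "(u, v) \<in> ?R" "(v, u) \<in> ?R" using assms by (auto simp: zrel_def)
  have "(u, w) \<in> ?R\<^sup>* \<longleftrightarrow> (v, w) \<in> ?R\<^sup>*" for w
    using uv by (meson converse_rtrancl_into_rtrancl)
  then show ?thesis by (auto simp: zclass_def)
qed

lemma zclass_append:
  assumes u: "zz x u y" and v: "zz y v z" and u': "u' \<in> zc x y u" and v': "v' \<in> zc y z v"
  shows "zc x z (u' @ v') = zc x z (u @ v)"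
proof -
  have 1: "zz x u' y \<and> zc x z (u' @ v) = zc x z (u @ v)"
  proof (rule zclass_invariant[OF u u', where h = "\<lambda>u. zc x z (u @ v)"])
    fix a b assume ab: "zz x a y" "zz x b y" "zstep C S a b"
    then have "zz x (a @ v) z" "zz x (b @ v) z" using v zigzag_append by blast+
    then show "zc x z (a @ v) = zc x z (b @ v)" using zstep_append[OF ab(3), of "[]" v] by (intro zclass_step) simp_all
  qed
  have "zz y v' z \<and> zc x z (u' @ v') = zc x z (u' @ v)"
  proof (rule zclass_invariant[OF v v', where h = "\<lambda>v. zc x z (u' @ v)"])
    fix a b assume ab: "zz y a z" "zz y b z" "zstep C S a b"
    then have "zz x (u' @ a) z" "zz x (u' @ b) z" using 1 zigzag_append by blast+
    then show "zc x z (u' @ a) = zc x z (u' @ b)" using zstep_append[OF ab(3), of u' "[]"] by (intro zclass_step) simp_all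
  qed
  then show ?thesis using 1 by simp
qed

lemma L_simps [simp]: "Ob L = Ob C" "Dom L (x, P, y) = x" "Cod L (x, P, y) = y" "Idt L x = ar x [] x"
  by (simp_all add: fractions_def)

lemma L_Ar: "a \<in> Ar L \<longleftrightarrow> (\<exists>x u y. zz x u y \<and> a = ar x u y)"
  by (auto simp: fractions_def)

lemma ar_Ar [simp]: "zz x u y \<Longrightarrow> ar x u y \<in> Ar L"
  using L_Ar by blast

lemma L_Cmp [simp]:
  assumes u: "zz x u y" and v: "zz y v z"
  shows "Cmp L (ar y v z) (ar x u y) = ar x (u @ v) z"
proof -
  have "(\<Union>u'\<in>zc x y u. \<Union>v'\<in>zc y z v. zc x z (u' @ v')) = zc x z (u @ v)"
  proof -
    have "(\<Union>u'\<in>zc x y u. \<Union>v'\<in>zc y z v. zc x z (u' @ v')) = (\<Union>u'\<in>zc x y u. \<Union>v'\<in>zc y z v. zc x z (u @ v))"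
      by (intro SUP_cong refl zclass_append[OF u v])
    moreover have "zc x y u \<noteq> {}" "zc y z v \<noteq> {}" using zclass_self[of u x y] zclass_self[of v y z] by blast+
    ultimately show ?thesis by simp
  qed
  then show ?thesis by (simp add: fractions_def)
qed

lemma L_category [simp]: "category L"
proof (rule categoryI)
  fix a assume "a \<in> Ar L"
  then obtain x u y where a: "zz x u y" "a = ar x u y" using L_Ar by blast
  have ob: "x \<in> Ob C" "y \<in> Ob C" using a zigzag_Ob by auto
  show "Dom L a \<in> Ob L" "Cod L a \<in> Ob L" using a ob by simp_all
  show "Cmp L (Idt L (Cod L a)) a = a" "Cmp L a (Idt L (Dom L a)) = a"
    using a ob L_Cmp[of x u y "[]" y] L_Cmp[of x "[]" x u y] by simp_all
  fix b assume b': "b \<in> Ar L" "Cod L a = Dom L b"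
  then obtain y' v z where "zz y' v z" "b = ar y' v z" using L_Ar by blast
  with b'(2) a(2) have b: "zz y v z" "b = ar y v z" by simp_all
  have uv: "zz x (u @ v) z" using a b zigzag_append by blast
  show "Cmp L b a \<in> Ar L \<and> Dom L (Cmp L b a) = Dom L a \<and> Cod L (Cmp L b a) = Cod L b"
    using a b uv by simp
  fix c assume c': "c \<in> Ar L" "Cod L b = Dom L c"
  then obtain z' w t where "zz z' w t" "c = ar z' w t" using L_Ar by blast
  with c'(2) b(2) have c: "zz z w t" "c = ar z w t" by simp_all
  have vw: "zz y (v @ w) t" using b c zigzag_append by blast
  show "Cmp L (Cmp L c b) a = Cmp L c (Cmp L b a)" using a b c uv vw by simp
next
  fix x assume "x \<in> Ob L"
  then show "Idt L x \<in> Ar L \<and> Dom L (Idt L x) = x \<and> Cod L (Idt L x) = x" by simp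
qed

definition to_fractions :: "('o, 'a, 'o, 'o \<times> 'a zig list set \<times> 'o) func" where
  "to_fractions = functor_of C L (\<lambda>x. x) (\<lambda>f. ar (Dom C f) [Fwd f] (Cod C f))"

lemma to_fractions_simps [simp]: "FSrc to_fractions = C" "FTrg to_fractions = L" "x \<in> Ob C \<Longrightarrow> FOb to_fractions x = x"
  "f \<in> Ar C \<Longrightarrow> FAr to_fractions f = ar (Dom C f) [Fwd f] (Cod C f)"
  by (simp_all add: to_fractions_def)

lemma to_fractions_functor [simp]: "is_functor to_fractions"
proof (rule functorI[where C = C and B = L])
  show "FOb to_fractions \<in> extensional (Ob C)" "FAr to_fractions \<in> extensional (Ar C)" by (simp_all add: to_fractions_def)
  show "FAr to_fractions (Idt C x) = Idt L (FOb to_fractions x)" if "x \<in> Ob C" for x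
  proof -
    have "zc x x [Fwd (Idt C x)] = zc x x []"
      using that zstep.zidt[of x C S "[]" "[]"] by (intro zclass_step) simp_all
    then show ?thesis using that by simp
  qed
  show "FAr to_fractions (Cmp C g f) = Cmp L (FAr to_fractions g) (FAr to_fractions f)" if "f \<in> Ar C" "g \<in> Ar C" "Cod C f = Dom C g" for f g
  proof -
    have "zc (Dom C f) (Cod C g) [Fwd f, Fwd g] = zc (Dom C f) (Cod C g) [Fwd (Cmp C g f)]"
      using that zstep.zcmp[of C S "[]" f g "[]"] by (intro zclass_step) simp_all
    then show ?thesis using that by simp
  qed
qed simp_all

lemma to_fractions_inverse: assumes "s \<in> S"
  shows "inverse_ar L (FAr to_fractions s) (ar (Cod C s) [Bwd s] (Dom C s))"
proof -
  have s: "s \<in> Ar C" using assms S by auto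
  have "zc (Dom C s) (Dom C s) [Fwd s, Bwd s] = zc (Dom C s) (Dom C s) []"
    using s assms zstep.zfb[of C S "[]" s "[]"] by (intro zclass_step) simp_all
  moreover have "zc (Cod C s) (Cod C s) [Bwd s, Fwd s] = zc (Cod C s) (Cod C s) []"
    using s assms zstep.zbf[of C S "[]" s "[]"] by (intro zclass_step) simp_all
  ultimately show ?thesis using s assms by (simp add: inverse_ar_def hom_def)
qed

context
  fixes G :: "('o, 'a, 'p, 'b) func" and B
  assumes G: "is_functor G" "FSrc G = C" "FTrg G = B" and inv: "\<And>s. s \<in> S \<Longrightarrow> is_iso B (FAr G s)"
begin

lemma zev_simps:
  "zz x u y \<Longrightarrow> zev G y u \<in> Ar B \<and> Dom B (zev G y u) = FOb G x \<and> Cod B (zev G y u) = FOb G y"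
proof (induction u arbitrary: x)
  case (Cons z u)
  have "category B" using G by auto
  then show ?case using Cons G inv by (cases z) auto
qed (use G in auto)

lemma zev_append: "zz x u y \<Longrightarrow> zz y v z \<Longrightarrow> zev G z (u @ v) = Cmp B (zev G z v) (zev G y u)"
proof (induction u arbitrary: x)
  case Nil
  then show ?case using G zev_simps[of y v z] functor_cats(2)[OF G(1,3)] by simp
next
  case (Cons a u)
  have B: "category B" using G by auto
  show ?case
    using Cons G inv B zev_simps[of _ u y] zev_simps[OF Cons.prems(2)] by (cases a) auto
qed

lemma zev_step: assumes "zstep C S u v" "zz x u y" shows "zev G y u = zev G y v"
proof -
  have B: "category B" using G by auto
  show ?thesis using assms
  proof cases
    case (zcmp us f g vs)
    then obtain a where "zz a ([Fwd f, Fwd g] @ vs) y" using assms zigzag_append by blast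
    then have "zev G y ([Fwd f, Fwd g] @ vs) = zev G y ([Fwd (Cmp C g f)] @ vs)"
      using G B zev_simps[of "Cod C g" vs y] by auto
    then show ?thesis unfolding zcmp by (rule zev_append_cong)
  next
    case (zidt a us vs)
    then obtain a' where "zz a' ([Fwd (Idt C a)] @ vs) y" using assms zigzag_append by blast
    then have "zev G y ([Fwd (Idt C a)] @ vs) = zev G y vs"
      using G B zidt zev_simps[of a vs y] by auto
    then show ?thesis unfolding zidt by (rule zev_append_cong)
  next
    case (zfb us s vs)
    then obtain a where "zz a ([Fwd s, Bwd s] @ vs) y" using assms zigzag_append by blast
    then have "zev G y ([Fwd s, Bwd s] @ vs) = zev G y vs"
      using G B inv zev_simps[of "Dom C s" vs y] by auto
    then show ?thesis unfolding zfb by (rule zev_append_cong)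
  next
    case (zbf us s vs)
    then obtain a where "zz a ([Bwd s, Fwd s] @ vs) y" using assms zigzag_append by blast
    then have "zev G y ([Bwd s, Fwd s] @ vs) = zev G y vs"
      using G B inv zev_simps[of "Cod C s" vs y] by auto
    then show ?thesis unfolding zbf by (rule zev_append_cong)
  qed
qed

definition ext :: "('o, 'o \<times> 'a zig list set \<times> 'o, 'p, 'b) func" where
  "ext = functor_of L B (FOb G) (\<lambda>(x, P, y). the_elem (zev G y ` P))"

lemma ext_Ar: assumes "zz x u y" shows "FAr ext (ar x u y) = zev G y u"
proof -
  have "zev G y v = zev G y u" if "v \<in> zc x y u" for v
    using zclass_invariant[OF assms that, of "zev G y"] zev_step by blast
  then have "zev G y ` zc x y u = {zev G y u}" using zclass_self[of u x y] by blast
  then show ?thesis using assms by (simp add: ext_def)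
qed

lemma ext_simps: "FSrc ext = L" "FTrg ext = B" "x \<in> Ob C \<Longrightarrow> FOb ext x = FOb G x"
  by (simp_all add: ext_def)

lemma ext_functor: "is_functor ext"
proof (rule functorI[where C = L and B = B])
  have B: "category B" using G by auto
  then show "category B" .
  show "FOb ext \<in> extensional (Ob L)" "FAr ext \<in> extensional (Ar L)" by (simp_all add: ext_def)
  fix a assume "a \<in> Ar L"
  then obtain x u y where a: "zz x u y" "a = ar x u y" using L_Ar by blast
  have ob: "x \<in> Ob C" "y \<in> Ob C" using a zigzag_Ob by auto
  show "FAr ext a \<in> Ar B \<and> Dom B (FAr ext a) = FOb ext (Dom L a) \<and> Cod B (FAr ext a) = FOb ext (Cod L a)"
    using a ob zev_simps[OF a(1)] by (simp add: ext_Ar ext_simps)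
  fix b assume b': "b \<in> Ar L" "Cod L a = Dom L b"
  then obtain y' v z where "zz y' v z" "b = ar y' v z" using L_Ar by blast
  with b'(2) a(2) have b: "zz y v z" "b = ar y v z" by simp_all
  have uv: "zz x (u @ v) z" using a b zigzag_append by blast
  show "FAr ext (Cmp L b a) = Cmp B (FAr ext b) (FAr ext a)"
    using a b uv zev_append[OF a(1) b(1)] by (simp add: ext_Ar)
next
  fix x assume "x \<in> Ob L"
  then show "FOb ext x \<in> Ob B" "FAr ext (Idt L x) = Idt B (FOb ext x)"
    using G by (simp_all add: ext_simps ext_Ar)
qed (use ext_simps in simp_all)

lemma ext_to_fractions: "fcmp ext to_fractions = G"
proof (rule functor_eqI)
  have B: "category B" using G by auto
  show "FAr (fcmp ext to_fractions) f = FAr G f" if "f \<in> Ar (FSrc G)" for f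
    using that G B by (simp add: ext_Ar)
qed (use G ext_functor ext_simps in simp_all)

end

text \<open>
  Uniqueness in the universal property: an arrow of the category of fractions is a composite of
  images of arrows and of inverses of such images.
\<close>

lemma zev_to_fractions:
  assumes H: "is_functor H" "FSrc H = L" and u: "zz x u y"
  shows "zev (fcmp H to_fractions) y u = FAr H (ar x u y)"
  using u
proof (induction u arbitrary: x)
  case Nil
  then have "x = y" "y \<in> Ob C" by auto
  then show ?case using H FAr_Idt_simp[of H L y] by simp
next
  case (Cons a u)
  show ?case
  proof (cases a)
    case (Fwd f)
    have f: "f \<in> Ar C" "Dom C f = x" "zz (Cod C f) u y" using Cons(2) Fwd by auto
    have "FAr H (Cmp L (ar (Cod C f) u y) (ar x [Fwd f] (Cod C f))) =
        Cmp (FTrg H) (FAr H (ar (Cod C f) u y)) (FAr H (ar x [Fwd f] (Cod C f)))"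
      using f H by (intro FAr_Cmp_simp) simp_all
    then show ?thesis using Fwd f Cons(1)[OF f(3)] by simp
  next
    case (Bwd s)
    have s: "s \<in> Ar C" "s \<in> S" "Cod C s = x" "zz (Dom C s) u y" using Cons(2) Bwd by auto
    have i: "FAr H (ar (Cod C s) [Bwd s] (Dom C s)) = inv_ar (FTrg H) (FAr H (FAr to_fractions s))"
      using functor_inv_ar[OF H(1), of "FAr to_fractions s"] inv_ar_eq[OF L_category to_fractions_inverse[OF s(2)]] to_fractions_inverse[OF s(2)] H(2)
      by (auto simp: is_iso_def)
    have "FAr H (Cmp L (ar (Dom C s) u y) (ar x [Bwd s] (Dom C s))) =
        Cmp (FTrg H) (FAr H (ar (Dom C s) u y)) (FAr H (ar x [Bwd s] (Dom C s)))"
      using s H by (intro FAr_Cmp_simp) simp_all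
    then show ?thesis using Bwd s i Cons(1)[OF s(4)] by simp
  qed
qed

lemma inverts_to_fractions:
  assumes H: "is_functor H" "FSrc H = L" "FTrg H = B" and s: "s \<in> S"
  shows "is_iso B (FAr (fcmp H to_fractions) s)"
proof -
  have "s \<in> Ar C" using s S by auto
  moreover have "is_iso L (FAr to_fractions s)" using to_fractions_inverse[OF s] by (auto simp: is_iso_def)
  ultimately show ?thesis using functor_iso[OF H(1), of "FAr to_fractions s"] H by simp
qed

lemma ext_of_to_fractions:
  assumes H: "is_functor H" "FSrc H = L" "FTrg H = B"
  shows "ext (fcmp H to_fractions) B = H"
proof (rule functor_eqI)
  have G: "is_functor (fcmp H to_fractions)" "FSrc (fcmp H to_fractions) = C" "FTrg (fcmp H to_fractions) = B" using H by simp_all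
  note i = inverts_to_fractions[OF H]
  show "is_functor (ext (fcmp H to_fractions) B)" by (rule ext_functor[OF G i])
  show "FSrc (ext (fcmp H to_fractions) B) = FSrc H" "FTrg (ext (fcmp H to_fractions) B) = FTrg H"
    using ext_simps[OF G i] H by simp_all
  show "FOb (ext (fcmp H to_fractions) B) x = FOb H x" if "x \<in> Ob (FSrc H)" for x
    using ext_simps[OF G i] H that by simp
  show "FAr (ext (fcmp H to_fractions) B) a = FAr H a" if "a \<in> Ar (FSrc H)" for a
    using that H ext_Ar[OF G i] zev_to_fractions[OF H(1,2)] by (auto simp: L_Ar)
qed (use H in auto)

lemma fun_cat_inv_simps:
  "G \<in> Ob (fun_cat_inv C S B) \<longleftrightarrow> is_functor G \<and> FSrc G = C \<and> FTrg G = B \<and> (\<forall>s\<in>S. is_iso B (FAr G s))"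
  "\<tau> \<in> Ar (fun_cat_inv C S B) \<longleftrightarrow> is_ntrans \<tau> \<and> FSrc (NSrc \<tau>) = C \<and> FTrg (NSrc \<tau>) = B \<and>
    (\<forall>s\<in>S. is_iso B (FAr (NSrc \<tau>) s)) \<and> (\<forall>s\<in>S. is_iso B (FAr (NTrg \<tau>) s))"
  "Dom (fun_cat_inv C S B) = NSrc" "Cod (fun_cat_inv C S B) = NTrg"
  "Idt (fun_cat_inv C S B) = nid" "Cmp (fun_cat_inv C S B) = nvcmp"
  by (auto simp: fun_cat_inv_def)

definition ext_nat :: "('p, 'b) cat \<Rightarrow> ('o, 'a, 'p, 'b) ntrans \<Rightarrow> ('o, 'o \<times> 'a zig list set \<times> 'o, 'p, 'b) ntrans" where
  "ext_nat B \<tau> = \<lparr>NSrc = ext (NSrc \<tau>) B, NTrg = ext (NTrg \<tau>) B, NCmp = NCmp \<tau>\<rparr>"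

text \<open>Naturality with respect to arrows implies naturality with respect to their formal inverses.\<close>

lemma zev_natural:
  assumes t: "is_ntrans \<tau>" "FSrc (NSrc \<tau>) = C" "FTrg (NSrc \<tau>) = B"
    and F: "\<And>s. s \<in> S \<Longrightarrow> is_iso B (FAr (NSrc \<tau>) s)" and G: "\<And>s. s \<in> S \<Longrightarrow> is_iso B (FAr (NTrg \<tau>) s)"
    and u: "zz x u y"
  shows "Cmp B (zev (NTrg \<tau>) y u) (NCmp \<tau> x) = Cmp B (NCmp \<tau> y) (zev (NSrc \<tau>) y u)"
  using u
proof (induction u arbitrary: x)
  case Nil
  have "category B" using t functor_cats(2)[of "NSrc \<tau>"] by auto
  moreover have "x = y" "y \<in> Ob C" using Nil by auto
  ultimately show ?case using t by simp
next
  case (Cons a u)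
  have B: "category B" using t functor_cats(2)[of "NSrc \<tau>"] by auto
  have f: "is_functor (NSrc \<tau>)" "FSrc (NSrc \<tau>) = C" "FTrg (NSrc \<tau>) = B"
    and g: "is_functor (NTrg \<tau>)" "FSrc (NTrg \<tau>) = C" "FTrg (NTrg \<tau>) = B" using t by simp_all
  have y: "y \<in> Ob C" using zigzag_Ob[OF Cons(2)] by simp
  obtain x' f' g' where x': "zz x' u y" "x' \<in> Ob C"
    and z: "zev (NSrc \<tau>) y (a # u) = Cmp B (zev (NSrc \<tau>) y u) f'" "zev (NTrg \<tau>) y (a # u) = Cmp B (zev (NTrg \<tau>) y u) g'"
    and ft: "f' \<in> Ar B" "Dom B f' = FOb (NSrc \<tau>) x" "Cod B f' = FOb (NSrc \<tau>) x'"
    and gt: "g' \<in> Ar B" "Dom B g' = FOb (NTrg \<tau>) x" "Cod B g' = FOb (NTrg \<tau>) x'"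
    and n: "Cmp B g' (NCmp \<tau> x) = Cmp B (NCmp \<tau> x') f'" and x: "x \<in> Ob C"
  proof (cases a)
    case (Fwd h)
    have h: "h \<in> Ar C" "Dom C h = x" "zz (Cod C h) u y" using Cons(2) Fwd by auto
    show thesis
      using h f g Fwd ntrans_nat[OF t(1,3,2) h(1,2) refl] by (intro that[of "Cod C h" "FAr (NSrc \<tau>) h" "FAr (NTrg \<tau>) h"]) auto
  next
    case (Bwd h)
    have h: "h \<in> Ar C" "h \<in> S" "Cod C h = x" "zz (Dom C h) u y" using Cons(2) Bwd by auto
    have x: "x \<in> Ob C" "Dom C h \<in> Ob C" using h by auto
    let ?F = "FAr (NSrc \<tau>) h" and ?G = "FAr (NTrg \<tau>) h" and ?x' = "Dom C h"
    note i = F[OF h(2)] G[OF h(2)]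
    have "Cmp B (inv_ar B ?G) (NCmp \<tau> x) = Cmp B (inv_ar B ?G) (Cmp B (Cmp B (NCmp \<tau> x) ?F) (inv_ar B ?F))"
      using B i h t f g x by simp
    also have "Cmp B (NCmp \<tau> x) ?F = Cmp B ?G (NCmp \<tau> ?x')"
      using ntrans_nat[OF t(1,3,2) h(1) refl h(3)] by simp
    also have "Cmp B (inv_ar B ?G) (Cmp B (Cmp B ?G (NCmp \<tau> ?x')) (inv_ar B ?F)) = Cmp B (NCmp \<tau> ?x') (inv_ar B ?F)"
      using B i h t f g x by simp
    finally show thesis
      using h f g Bwd B i x by (intro that[of ?x' "inv_ar B ?F" "inv_ar B ?G"]) auto
  qed
  note zf = zev_simps[OF f F x'(1)] and zg = zev_simps[OF g G x'(1)]
  have "Cmp B (Cmp B (zev (NTrg \<tau>) y u) g') (NCmp \<tau> x) = Cmp B (zev (NTrg \<tau>) y u) (Cmp B (NCmp \<tau> x') f')"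
    using B t gt zg x n by simp
  also have "\<dots> = Cmp B (NCmp \<tau> y) (Cmp B (zev (NSrc \<tau>) y u) f')"
    by (rule Cmp_reassoc[OF B Cons(1)[OF x'(1)]]) (use t ft zf zg x' y in simp_all)
  finally show ?case unfolding z .
qed

lemma ext_nat_ntrans:
  assumes t: "is_ntrans \<tau>" "FSrc (NSrc \<tau>) = C" "FTrg (NSrc \<tau>) = B"
    and F: "\<And>s. s \<in> S \<Longrightarrow> is_iso B (FAr (NSrc \<tau>) s)" and G: "\<And>s. s \<in> S \<Longrightarrow> is_iso B (FAr (NTrg \<tau>) s)"
  shows "is_ntrans (ext_nat B \<tau>)"
proof -
  have f: "is_functor (NSrc \<tau>)" "FSrc (NSrc \<tau>) = C" "FTrg (NSrc \<tau>) = B"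
    and g: "is_functor (NTrg \<tau>)" "FSrc (NTrg \<tau>) = C" "FTrg (NTrg \<tau>) = B" using t by simp_all
  note ef = ext_functor[OF f F] ext_simps[OF f F] and eg = ext_functor[OF g G] ext_simps[OF g G]
  show ?thesis
  proof (rule ntransI[OF ef(1) eg(1), where C = L and B = B])
    show "NCmp (ext_nat B \<tau>) \<in> extensional (Ob L)" using t by (simp add: ext_nat_def)
    fix a assume "a \<in> Ar L"
    then obtain x u y where a: "zz x u y" "a = ar x u y" using L_Ar by blast
    show "Cmp B (FAr (ext (NTrg \<tau>) B) a) (NCmp (ext_nat B \<tau>) (Dom L a)) =
        Cmp B (NCmp (ext_nat B \<tau>) (Cod L a)) (FAr (ext (NSrc \<tau>) B) a)"
      using zev_natural[OF t F G a(1)] a ext_Ar[OF f F a(1)] ext_Ar[OF g G a(1)] by (simp add: ext_nat_def)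
  qed (use ef eg t in \<open>simp_all add: ext_nat_def\<close>)
qed

lemma fun_cat_fractions_iso:
  fixes B :: "('p, 'b) cat"
  assumes B: "category B"
  shows "cat_iso (fun_cat L B) (fun_cat_inv C S B) (\<lambda>H. fcmp H to_fractions) (\<lambda>\<tau>. nwhr \<tau> to_fractions)"
proof (rule cat_isoI[where f' = "\<lambda>G. ext G B" and g' = "ext_nat B"])
  fix H :: "('o, 'o \<times> 'a zig list set \<times> 'o, 'p, 'b) func" assume "H \<in> Ob (fun_cat L B)"
  then have H: "is_functor H" "FSrc H = L" "FTrg H = B" by simp_all
  show "fcmp H to_fractions \<in> Ob (fun_cat_inv C S B)" using H inverts_to_fractions[OF H] by (simp add: fun_cat_inv_simps)
  show "ext (fcmp H to_fractions) B = H" by (rule ext_of_to_fractions[OF H])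
  show "nwhr (Idt (fun_cat L B) H) to_fractions = Idt (fun_cat_inv C S B) (fcmp H to_fractions)" using H by (simp add: fun_cat_inv_simps)
next
  fix G :: "('o, 'a, 'p, 'b) func" assume "G \<in> Ob (fun_cat_inv C S B)"
  then have G: "is_functor G" "FSrc G = C" "FTrg G = B" and i: "\<And>s. s \<in> S \<Longrightarrow> is_iso B (FAr G s)"
    by (simp_all add: fun_cat_inv_simps)
  show "ext G B \<in> Ob (fun_cat L B)" using ext_functor[OF G i] ext_simps[OF G i] by simp
  show "fcmp (ext G B) to_fractions = G" by (rule ext_to_fractions[OF G i])
next
  fix \<tau> :: "('o, 'o \<times> 'a zig list set \<times> 'o, 'p, 'b) ntrans" assume "\<tau> \<in> Ar (fun_cat L B)"
  then have t: "is_ntrans \<tau>" "FSrc (NSrc \<tau>) = L" "FTrg (NSrc \<tau>) = B" by simp_all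
  have F: "is_functor (NSrc \<tau>)" "FSrc (NSrc \<tau>) = L" "FTrg (NSrc \<tau>) = B"
    and G: "is_functor (NTrg \<tau>)" "FSrc (NTrg \<tau>) = L" "FTrg (NTrg \<tau>) = B" using t by simp_all
  have w: "is_ntrans (nwhr \<tau> to_fractions)" using t by simp
  show w': "nwhr \<tau> to_fractions \<in> Ar (fun_cat_inv C S B)"
    using t w inverts_to_fractions[OF F] inverts_to_fractions[OF G] by (simp add: fun_cat_inv_simps)
  have "is_ntrans (ext_nat B (nwhr \<tau> to_fractions))"
    using w' by (intro ext_nat_ntrans) (simp_all add: fun_cat_inv_simps)
  then show "ext_nat B (nwhr \<tau> to_fractions) = \<tau>"
    using t B ext_of_to_fractions[OF F] ext_of_to_fractions[OF G] FAr_Idt_simp[OF F(1,2)]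
    by (intro ntrans_eqI) (simp_all add: ext_nat_def)
  fix \<sigma> assume "\<sigma> \<in> Ar (fun_cat L B)" "Cod (fun_cat L B) \<tau> = Dom (fun_cat L B) \<sigma>"
  then show "nwhr (Cmp (fun_cat L B) \<sigma> \<tau>) to_fractions = Cmp (fun_cat_inv C S B) (nwhr \<sigma> to_fractions) (nwhr \<tau> to_fractions)"
    using t nhcmp_interchange[of "nid to_fractions" "nid to_fractions" \<tau> \<sigma>] by (simp add: fun_cat_inv_simps)
next
  fix \<tau> :: "('o, 'a, 'p, 'b) ntrans" assume t': "\<tau> \<in> Ar (fun_cat_inv C S B)"
  then have t: "is_ntrans \<tau>" "FSrc (NSrc \<tau>) = C" "FTrg (NSrc \<tau>) = B"
    and i: "\<And>s. s \<in> S \<Longrightarrow> is_iso B (FAr (NSrc \<tau>) s)" "\<And>s. s \<in> S \<Longrightarrow> is_iso B (FAr (NTrg \<tau>) s)"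
    by (simp_all add: fun_cat_inv_simps)
  have f: "is_functor (NSrc \<tau>)" "FSrc (NSrc \<tau>) = C" "FTrg (NSrc \<tau>) = B"
    and g: "is_functor (NTrg \<tau>)" "FSrc (NTrg \<tau>) = C" "FTrg (NTrg \<tau>) = B" using t by simp_all
  have e: "is_ntrans (ext_nat B \<tau>)" "NSrc (ext_nat B \<tau>) = ext (NSrc \<tau>) B" "NTrg (ext_nat B \<tau>) = ext (NTrg \<tau>) B"
    "NCmp (ext_nat B \<tau>) = NCmp \<tau>"
    using ext_nat_ntrans[OF t i] by (simp_all add: ext_nat_def)
  note ef = ext_functor[OF f i(1)] ext_simps[OF f i(1)]
  show "ext_nat B \<tau> \<in> Ar (fun_cat L B)" using e ef by simp
  show "nwhr (ext_nat B \<tau>) to_fractions = \<tau>"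
    using e ef t B ext_to_fractions[OF f i(1)] ext_to_fractions[OF g i(2)] FAr_Idt_simp[OF ef(1,2)]
    by (intro ntrans_eqI) simp_all
qed (simp_all add: fun_cat_inv_simps)

end

section \<open>Representability\<close>

lemma strict_pseudofunctor:
  fixes P :: "(('p, 'b) cat, ('p, 'b, 'p, 'b) func, ('p, 'b, 'p, 'b) ntrans,
    ('q, 'c) cat, ('q, 'c, 'q, 'c) func, ('q, 'c, 'q, 'c) ntrans) psf"
  assumes P0: "\<And>B. category B \<Longrightarrow> category (P0 P B)"
    and P1: "\<And>F. is_functor F \<Longrightarrow> is_functor (P1 P F)" "\<And>F. is_functor F \<Longrightarrow> FSrc (P1 P F) = P0 P (FSrc F)"
      "\<And>F. is_functor F \<Longrightarrow> FTrg (P1 P F) = P0 P (FTrg F)"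
    and fid: "\<And>B. category B \<Longrightarrow> P1 P (fid B) = fid (P0 P B)"
    and fcmp: "\<And>F G. is_functor F \<Longrightarrow> is_functor G \<Longrightarrow> FSrc G = FTrg F \<Longrightarrow> P1 P (fcmp G F) = fcmp (P1 P G) (P1 P F)"
    and P2: "\<And>\<sigma>. is_ntrans \<sigma> \<Longrightarrow> is_ntrans (P2 P \<sigma>)" "\<And>\<sigma>. is_ntrans \<sigma> \<Longrightarrow> NSrc (P2 P \<sigma>) = P1 P (NSrc \<sigma>)"
      "\<And>\<sigma>. is_ntrans \<sigma> \<Longrightarrow> NTrg (P2 P \<sigma>) = P1 P (NTrg \<sigma>)"
    and nid: "\<And>F. is_functor F \<Longrightarrow> P2 P (nid F) = nid (P1 P F)"
    and nvcmp: "\<And>\<sigma> \<tau>. is_ntrans \<sigma> \<Longrightarrow> is_ntrans \<tau> \<Longrightarrow> NSrc \<sigma> = NTrg \<tau> \<Longrightarrow> P2 P (nvcmp \<sigma> \<tau>) = nvcmp (P2 P \<sigma>) (P2 P \<tau>)"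
    and nhcmp: "\<And>\<sigma> \<tau>. is_ntrans \<sigma> \<Longrightarrow> is_ntrans \<tau> \<Longrightarrow> FSrc (NSrc \<sigma>) = FTrg (NSrc \<tau>) \<Longrightarrow> P2 P (nhcmp \<sigma> \<tau>) = nhcmp (P2 P \<sigma>) (P2 P \<tau>)"
    and PUn: "\<And>B. PUn P B = nid (fid (P0 P B))" and PCp: "\<And>F G. PCp P G F = nid (P1 P (fcmp G F))"
  shows "pseudofunctor Cat Cat P"
  by (intro pseudofunctor.intro pseudofunctor_axioms.intro)
    (auto simp: P0 P1 fid fcmp P2 nid nvcmp nhcmp PUn PCp)

lemma postcomp_simps [simp]: "FSrc (postcomp C F) = fun_cat C (FSrc F)" "FTrg (postcomp C F) = fun_cat C (FTrg F)"
  "is_functor G \<Longrightarrow> FSrc G = C \<Longrightarrow> FTrg G = FSrc F \<Longrightarrow> FOb (postcomp C F) G = fcmp F G"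
  "is_ntrans \<tau> \<Longrightarrow> FSrc (NSrc \<tau>) = C \<Longrightarrow> FTrg (NSrc \<tau>) = FSrc F \<Longrightarrow> FAr (postcomp C F) \<tau> = nwhl F \<tau>"
  by (simp_all add: postcomp_def)

lemma nwhl_nvcmp: "is_functor F \<Longrightarrow> is_ntrans \<sigma> \<Longrightarrow> is_ntrans \<tau> \<Longrightarrow> NSrc \<sigma> = NTrg \<tau> \<Longrightarrow> FSrc F = FTrg (NSrc \<tau>) \<Longrightarrow>
    nwhl F (nvcmp \<sigma> \<tau>) = nvcmp (nwhl F \<sigma>) (nwhl F \<tau>)"
  by (rule ntrans_eqI) auto

lemma nwhr_nvcmp: "is_functor G \<Longrightarrow> is_ntrans \<sigma> \<Longrightarrow> is_ntrans \<tau> \<Longrightarrow> NSrc \<sigma> = NTrg \<tau> \<Longrightarrow> FTrg G = FSrc (NSrc \<tau>) \<Longrightarrow>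
    nwhr (nvcmp \<sigma> \<tau>) G = nvcmp (nwhr \<sigma> G) (nwhr \<tau> G)"
  by (rule ntrans_eqI) auto

text \<open>The action of the 2-cell \<open>\<sigma>\<close> on \<open>[C, -]\<close> is natural by this exchange law.\<close>

lemma whisker_exchange:
  assumes "is_ntrans \<sigma>" "is_ntrans \<tau>" "FSrc (NSrc \<sigma>) = FTrg (NSrc \<tau>)"
  shows "nvcmp (nwhl (NTrg \<sigma>) \<tau>) (nwhr \<sigma> (NSrc \<tau>)) = nvcmp (nwhr \<sigma> (NTrg \<tau>)) (nwhl (NSrc \<sigma>) \<tau>)"
  using assms ntrans_nat[of \<sigma> "FTrg (NSrc \<sigma>)" "FSrc (NSrc \<sigma>)" "NCmp \<tau> _"]
  by (intro ntrans_eqI) auto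

lemma nwhr_nhcmp:
  assumes "is_ntrans \<sigma>" "is_ntrans \<tau>" "FSrc (NSrc \<sigma>) = FTrg (NSrc \<tau>)" "is_functor G" "FTrg G = FSrc (NSrc \<tau>)"
  shows "nwhr (nhcmp \<sigma> \<tau>) G = nvcmp (nwhr \<sigma> (fcmp (NTrg \<tau>) G)) (nwhl (NSrc \<sigma>) (nwhr \<tau> G))"
  using assms by (intro ntrans_eqI) auto

lemma hom_from_simps [simp]: "P0 (hom_from C) = fun_cat C" "P1 (hom_from C) = postcomp C"
  "NSrc (P2 (hom_from C) \<sigma>) = postcomp C (NSrc \<sigma>)" "NTrg (P2 (hom_from C) \<sigma>) = postcomp C (NTrg \<sigma>)"
  "is_functor G \<Longrightarrow> FSrc G = C \<Longrightarrow> FTrg G = FSrc (NSrc \<sigma>) \<Longrightarrow> NCmp (P2 (hom_from C) \<sigma>) G = nwhr \<sigma> G"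
  "NCmp (P2 (hom_from C) \<sigma>) \<in> extensional (Ob (fun_cat C (FSrc (NSrc \<sigma>))))"
  "PUn (hom_from C) B = nid (fid (fun_cat C B))" "PCp (hom_from C) G' F' = nid (postcomp C (fcmp G' F'))"
  by (simp_all add: hom_from_def)

text \<open>
  If categories \<open>P0 P B\<close> are isomorphic to \<open>[C, B]\<close> compatibly with the action of functors and
  transformations, then \<open>P\<close> inherits strict 2-functoriality from \<open>[C, -]\<close> and is represented by \<open>C\<close>.
\<close>

locale strict_representation =
  fixes C :: "('y, 'd) cat"
    and P :: "(('p, 'b) cat, ('p, 'b, 'p, 'b) func, ('p, 'b, 'p, 'b) ntrans,
      ('q, 'c) cat, ('q, 'c, 'q, 'c) func, ('q, 'c, 'q, 'c) ntrans) psf"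
    and f :: "('y, 'd, 'p, 'b) func \<Rightarrow> 'q" and g :: "('y, 'd, 'p, 'b) ntrans \<Rightarrow> 'c"
  assumes iso: "category B \<Longrightarrow> cat_iso (fun_cat C B) (P0 P B) f g"
    and P1_shape: "is_functor F \<Longrightarrow> FSrc (P1 P F) = P0 P (FSrc F)" "is_functor F \<Longrightarrow> FTrg (P1 P F) = P0 P (FTrg F)"
      "is_functor F \<Longrightarrow> FOb (P1 P F) \<in> extensional (Ob (P0 P (FSrc F)))"
      "is_functor F \<Longrightarrow> FAr (P1 P F) \<in> extensional (Ar (P0 P (FSrc F)))"
    and P1_f: "is_functor F \<Longrightarrow> is_functor G \<Longrightarrow> FSrc G = C \<Longrightarrow> FTrg G = FSrc F \<Longrightarrow> FOb (P1 P F) (f G) = f (fcmp F G)"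
    and P1_g: "is_functor F \<Longrightarrow> is_ntrans \<tau> \<Longrightarrow> FSrc (NSrc \<tau>) = C \<Longrightarrow> FTrg (NSrc \<tau>) = FSrc F \<Longrightarrow>
      FAr (P1 P F) (g \<tau>) = g (nwhl F \<tau>)"
    and P2_shape: "is_ntrans \<sigma> \<Longrightarrow> NSrc (P2 P \<sigma>) = P1 P (NSrc \<sigma>)" "is_ntrans \<sigma> \<Longrightarrow> NTrg (P2 P \<sigma>) = P1 P (NTrg \<sigma>)"
      "is_ntrans \<sigma> \<Longrightarrow> NCmp (P2 P \<sigma>) \<in> extensional (Ob (P0 P (FSrc (NSrc \<sigma>))))"
    and P2_f: "is_ntrans \<sigma> \<Longrightarrow> is_functor G \<Longrightarrow> FSrc G = C \<Longrightarrow> FTrg G = FSrc (NSrc \<sigma>) \<Longrightarrow> NCmp (P2 P \<sigma>) (f G) = g (nwhr \<sigma> G)"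
    and PUn: "PUn P B = nid (fid (P0 P B))" and PCp: "PCp P G' F' = nid (P1 P (fcmp G' F'))"
    and C [simp]: "category C"
begin

lemma P0_category [simp]: "category B \<Longrightarrow> category (P0 P B)"
  using iso cat_iso_category by blast

lemma f_Ob [simp]: "is_functor G \<Longrightarrow> FSrc G = C \<Longrightarrow> FTrg G = B \<Longrightarrow> f G \<in> Ob (P0 P B)"
  using cat_isoD(2)[OF iso, of B G] by auto

lemma g_Ar [simp]: assumes "is_ntrans \<tau>" "FSrc (NSrc \<tau>) = C" "FTrg (NSrc \<tau>) = B"
  shows "g \<tau> \<in> Ar (P0 P B)" "Dom (P0 P B) (g \<tau>) = f (NSrc \<tau>)" "Cod (P0 P B) (g \<tau>) = f (NTrg \<tau>)"
proof -
  have "category B" using assms functor_cats(2)[of "NSrc \<tau>"] by auto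
  then show "g \<tau> \<in> Ar (P0 P B)" "Dom (P0 P B) (g \<tau>) = f (NSrc \<tau>)" "Cod (P0 P B) (g \<tau>) = f (NTrg \<tau>)"
    using cat_isoD(3-5)[OF iso, of B \<tau>] assms by auto
qed

lemma g_nid: "is_functor G \<Longrightarrow> FSrc G = C \<Longrightarrow> FTrg G = B \<Longrightarrow> Idt (P0 P B) (f G) = g (nid G)"
  using cat_isoD(6)[OF iso, of B G] by auto

lemma g_nvcmp: assumes "is_ntrans \<tau>" "is_ntrans \<sigma>" "FSrc (NSrc \<tau>) = C" "FTrg (NSrc \<tau>) = B" "NSrc \<sigma> = NTrg \<tau>"
  shows "Cmp (P0 P B) (g \<sigma>) (g \<tau>) = g (nvcmp \<sigma> \<tau>)"
proof -
  have "category B" using assms functor_cats(2)[of "NSrc \<tau>"] by auto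
  then show ?thesis using cat_isoD(7)[OF iso, of B \<tau> \<sigma>] assms by auto
qed

lemma Ob_cases:
  assumes "category B" "y \<in> Ob (P0 P B)"
  obtains G where "is_functor G" "FSrc G = C" "FTrg G = B" "y = f G"
proof -
  have "y \<in> f ` Ob (fun_cat C B)" using cat_isoD(10)[OF iso[OF assms(1)]] assms(2) by simp
  then show thesis using that by auto
qed

lemma Ar_cases:
  assumes "category B" "a \<in> Ar (P0 P B)"
  obtains \<tau> where "is_ntrans \<tau>" "FSrc (NSrc \<tau>) = C" "FTrg (NSrc \<tau>) = B" "a = g \<tau>"
proof -
  have "a \<in> g ` Ar (fun_cat C B)" using cat_isoD(11)[OF iso[OF assms(1)]] assms(2) by simp
  then show thesis using that by auto
qed

lemma f_inj: "f G = f H \<Longrightarrow> is_functor G \<Longrightarrow> FSrc G = C \<Longrightarrow> FTrg G = B \<Longrightarrow> is_functor H \<Longrightarrow> FSrc H = C \<Longrightarrow> FTrg H = B \<Longrightarrow> G = H"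
  using cat_isoD(8)[OF iso, of B] functor_cats(2)[of G B] by (auto simp: inj_on_def)

lemma P1_functor:
  assumes F: "is_functor F"
  shows "is_functor (P1 P F)"
proof (rule functorI[where C = "P0 P (FSrc F)" and B = "P0 P (FTrg F)"])
  have cs: "category (FSrc F)" "category (FTrg F)" using F by simp_all
  then show "category (P0 P (FSrc F))" "category (P0 P (FTrg F))" by simp_all
  show "FOb (P1 P F) x \<in> Ob (P0 P (FTrg F))" if "x \<in> Ob (P0 P (FSrc F))" for x
    using cs(1) that by (rule Ob_cases) (simp add: F P1_f)
  show "FAr (P1 P F) (Idt (P0 P (FSrc F)) x) = Idt (P0 P (FTrg F)) (FOb (P1 P F) x)" if "x \<in> Ob (P0 P (FSrc F))" for x
    using cs(1) that by (rule Ob_cases) (simp add: F P1_f P1_g g_nid)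
  fix a assume "a \<in> Ar (P0 P (FSrc F))"
  with cs(1) obtain \<tau> where t: "is_ntrans \<tau>" "FSrc (NSrc \<tau>) = C" "FTrg (NSrc \<tau>) = FSrc F" "a = g \<tau>" by (rule Ar_cases)
  show "FAr (P1 P F) a \<in> Ar (P0 P (FTrg F)) \<and> Dom (P0 P (FTrg F)) (FAr (P1 P F) a) = FOb (P1 P F) (Dom (P0 P (FSrc F)) a) \<and>
      Cod (P0 P (FTrg F)) (FAr (P1 P F) a) = FOb (P1 P F) (Cod (P0 P (FSrc F)) a)"
    using t F by (simp add: P1_f P1_g)
  fix b assume "b \<in> Ar (P0 P (FSrc F))"
  with cs(1) obtain \<sigma> where s: "is_ntrans \<sigma>" "FSrc (NSrc \<sigma>) = C" "FTrg (NSrc \<sigma>) = FSrc F" "b = g \<sigma>" by (rule Ar_cases)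
  assume "Cod (P0 P (FSrc F)) a = Dom (P0 P (FSrc F)) b"
  then have "f (NTrg \<tau>) = f (NSrc \<sigma>)" using s t by simp
  then have e: "NSrc \<sigma> = NTrg \<tau>" using s t by (intro f_inj[where B = "FSrc F"]) simp_all
  show "FAr (P1 P F) (Cmp (P0 P (FSrc F)) b a) = Cmp (P0 P (FTrg F)) (FAr (P1 P F) b) (FAr (P1 P F) a)"
    using s t F e by (simp add: g_nvcmp P1_g nwhl_nvcmp)
qed (use F P1_shape in simp_all)

lemma P2_ntrans:
  assumes s: "is_ntrans \<sigma>"
  shows "is_ntrans (P2 P \<sigma>)"
proof (rule ntransI[where C = "P0 P (FSrc (NSrc \<sigma>))" and B = "P0 P (FTrg (NSrc \<sigma>))"])
  have cs: "category (FSrc (NSrc \<sigma>))" using s by simp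
  show "NCmp (P2 P \<sigma>) x \<in> Ar (P0 P (FTrg (NSrc \<sigma>))) \<and> Dom (P0 P (FTrg (NSrc \<sigma>))) (NCmp (P2 P \<sigma>) x) = FOb (P1 P (NSrc \<sigma>)) x \<and>
      Cod (P0 P (FTrg (NSrc \<sigma>))) (NCmp (P2 P \<sigma>) x) = FOb (P1 P (NTrg \<sigma>)) x" if "x \<in> Ob (P0 P (FSrc (NSrc \<sigma>)))" for x
    using cs that by (rule Ob_cases) (simp add: s P2_f P1_f)
  fix a assume "a \<in> Ar (P0 P (FSrc (NSrc \<sigma>)))"
  with cs obtain \<tau> where t: "is_ntrans \<tau>" "FSrc (NSrc \<tau>) = C" "FTrg (NSrc \<tau>) = FSrc (NSrc \<sigma>)" "a = g \<tau>" by (rule Ar_cases)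
  show "Cmp (P0 P (FTrg (NSrc \<sigma>))) (FAr (P1 P (NTrg \<sigma>)) a) (NCmp (P2 P \<sigma>) (Dom (P0 P (FSrc (NSrc \<sigma>))) a)) =
      Cmp (P0 P (FTrg (NSrc \<sigma>))) (NCmp (P2 P \<sigma>) (Cod (P0 P (FSrc (NSrc \<sigma>))) a)) (FAr (P1 P (NSrc \<sigma>)) a)"
    using s t whisker_exchange[of \<sigma> \<tau>] by (simp add: P2_f P1_g g_nvcmp)
qed (use s P1_shape P2_shape P1_functor in simp_all)

lemma P1_fid: assumes B: "category B" shows "P1 P (fid B) = fid (P0 P B)"
proof (rule functor_eqI)
  show "FOb (P1 P (fid B)) x = FOb (fid (P0 P B)) x" if "x \<in> Ob (FSrc (fid (P0 P B)))" for x
    using B that[unfolded fid_simps] by (rule Ob_cases) (simp add: B P1_f)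
  show "FAr (P1 P (fid B)) a = FAr (fid (P0 P B)) a" if "a \<in> Ar (FSrc (fid (P0 P B)))" for a
    using B that[unfolded fid_simps] by (rule Ar_cases) (simp add: B P1_g)
qed (use B P1_functor P1_shape in simp_all)

lemma P1_fcmp:
  assumes FG: "is_functor F" "is_functor G" "FSrc G = FTrg F"
  shows "P1 P (fcmp G F) = fcmp (P1 P G) (P1 P F)"
proof (rule functor_eqI)
  have B: "category (FSrc F)" and s: "FSrc (fcmp (P1 P G) (P1 P F)) = P0 P (FSrc F)" using FG P1_shape by simp_all
  show "FOb (P1 P (fcmp G F)) x = FOb (fcmp (P1 P G) (P1 P F)) x" if "x \<in> Ob (FSrc (fcmp (P1 P G) (P1 P F)))" for x
    using B that[unfolded s] by (rule Ob_cases) (simp add: FG P1_f P1_shape)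
  show "FAr (P1 P (fcmp G F)) a = FAr (fcmp (P1 P G) (P1 P F)) a" if a: "a \<in> Ar (FSrc (fcmp (P1 P G) (P1 P F)))" for a
  proof -
    obtain \<tau> where t: "is_ntrans \<tau>" "FSrc (NSrc \<tau>) = C" "FTrg (NSrc \<tau>) = FSrc F" "a = g \<tau>"
      using B a[unfolded s] by (rule Ar_cases)
    have "nwhl (fcmp G F) \<tau> = nwhl G (nwhl F \<tau>)" using FG t by (intro ntrans_eqI) simp_all
    then show ?thesis using t FG by (simp add: P1_g P1_shape)
  qed
qed (use FG P1_functor P1_shape in simp_all)

lemma P_pseudofunctor: "pseudofunctor Cat Cat P"
proof (rule strict_pseudofunctor)
  show "P1 P (fid B) = fid (P0 P B)" if "category B" for B using that by (rule P1_fid)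
  show "P1 P (fcmp G F) = fcmp (P1 P G) (P1 P F)" if "is_functor F" "is_functor G" "FSrc G = FTrg F" for F G
    using that by (rule P1_fcmp)
  show "P2 P (nid F) = nid (P1 P F)" if F: "is_functor F" for F
  proof (rule ntrans_eqI)
    have B: "category (FSrc F)" and s: "FSrc (NSrc (nid (P1 P F))) = P0 P (FSrc F)" using F P1_shape by simp_all
    show "NCmp (P2 P (nid F)) x = NCmp (nid (P1 P F)) x" if "x \<in> Ob (FSrc (NSrc (nid (P1 P F))))" for x
      using B that[unfolded s] by (rule Ob_cases) (simp add: F P1_f P2_f P1_shape g_nid)
  qed (use F P1_functor P2_ntrans P2_shape in simp_all)
  show "P2 P (nvcmp \<sigma> \<tau>) = nvcmp (P2 P \<sigma>) (P2 P \<tau>)" if st: "is_ntrans \<sigma>" "is_ntrans \<tau>" "NSrc \<sigma> = NTrg \<tau>" for \<sigma> \<tau>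
  proof (rule ntrans_eqI)
    have B: "category (FSrc (NSrc \<tau>))" and s: "FSrc (NSrc (nvcmp (P2 P \<sigma>) (P2 P \<tau>))) = P0 P (FSrc (NSrc \<tau>))"
      using st P1_shape P2_shape by simp_all
    show "NCmp (P2 P (nvcmp \<sigma> \<tau>)) x = NCmp (nvcmp (P2 P \<sigma>) (P2 P \<tau>)) x" if "x \<in> Ob (FSrc (NSrc (nvcmp (P2 P \<sigma>) (P2 P \<tau>))))" for x
      using B that[unfolded s] by (rule Ob_cases) (simp add: st P1_f P2_f P1_shape P2_shape g_nvcmp nwhr_nvcmp)
  qed (use st P1_functor P2_ntrans P2_shape in simp_all)
  show "P2 P (nhcmp \<sigma> \<tau>) = nhcmp (P2 P \<sigma>) (P2 P \<tau>)" if st: "is_ntrans \<sigma>" "is_ntrans \<tau>" "FSrc (NSrc \<sigma>) = FTrg (NSrc \<tau>)" for \<sigma> \<tau>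
  proof (rule ntrans_eqI)
    have B: "category (FSrc (NSrc \<tau>))" and s: "FSrc (NSrc (nhcmp (P2 P \<sigma>) (P2 P \<tau>))) = P0 P (FSrc (NSrc \<tau>))"
      using st P1_shape P2_shape by simp_all
    show "NCmp (P2 P (nhcmp \<sigma> \<tau>)) x = NCmp (nhcmp (P2 P \<sigma>) (P2 P \<tau>)) x" if "x \<in> Ob (FSrc (NSrc (nhcmp (P2 P \<sigma>) (P2 P \<tau>))))" for x
      using B that[unfolded s] by (rule Ob_cases) (simp add: st P1_f P1_g P2_f P1_shape P2_shape g_nvcmp nwhr_nhcmp)
    show "NSrc (P2 P (nhcmp \<sigma> \<tau>)) = NSrc (nhcmp (P2 P \<sigma>) (P2 P \<tau>))" "NTrg (P2 P (nhcmp \<sigma> \<tau>)) = NTrg (nhcmp (P2 P \<sigma>) (P2 P \<tau>))"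
      using st P2_shape by (simp_all add: P1_fcmp)
  qed (use st P1_functor P2_ntrans P2_shape P1_shape in simp_all)
qed (use P1_functor P2_ntrans P1_shape P2_shape PUn PCp in simp_all)

definition comparison :: "('p, 'b) cat \<Rightarrow> (('y, 'd, 'p, 'b) func, ('y, 'd, 'p, 'b) ntrans, 'q, 'c) func" where
  "comparison B = functor_of (fun_cat C B) (P0 P B) f g"

lemma comparison_functor: "category B \<Longrightarrow> is_functor (comparison B)"
  unfolding comparison_def by (rule cat_iso_functor[OF iso])

lemma comparison_simps [simp]: "FSrc (comparison B) = fun_cat C B" "FTrg (comparison B) = P0 P B"
  "is_functor G \<Longrightarrow> FSrc G = C \<Longrightarrow> FTrg G = B \<Longrightarrow> FOb (comparison B) G = f G"
  "is_ntrans \<tau> \<Longrightarrow> FSrc (NSrc \<tau>) = C \<Longrightarrow> FTrg (NSrc \<tau>) = B \<Longrightarrow> FAr (comparison B) \<tau> = g \<tau>"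
  by (simp_all add: comparison_def)

end

lemma hom_from_strict_representation:
  "category C \<Longrightarrow> strict_representation C (hom_from C) (\<lambda>G. G) (\<lambda>\<tau>. \<tau>)"
  by (rule strict_representation.intro) (auto simp: cat_iso_def bij_betw_def postcomp_def)

lemma invertible_nid: "is_functor F \<Longrightarrow> invertible_ntrans (nid F)"
  unfolding invertible_ntrans_def by (auto simp: fun_cat_iso_iff)

text \<open>The comparison squares commute strictly, so identities serve as the structure cells.\<close>

lemma (in strict_representation) represents: "represents C P"
proof -
  interpret H: strict_representation C "hom_from C" "\<lambda>G :: ('y, 'd, 'p, 'b) func. G" "\<lambda>\<tau>. \<tau>"
    by (rule hom_from_strict_representation) simp
  have H1: "is_functor (postcomp C F)" if "is_functor F" for F :: "('p, 'b, 'p, 'b) func"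
    using H.P1_functor[OF that] by simp
  have H2: "is_ntrans (P2 (hom_from C) \<sigma>)" if "is_ntrans \<sigma>" for \<sigma> :: "('p, 'b, 'p, 'b) ntrans"
    by (rule H.P2_ntrans[OF that])
  have square: "fcmp (P1 P F) (comparison (FSrc F)) = fcmp (comparison (FTrg F)) (postcomp C F)" if F: "is_functor F" for F
    using F P1_functor[OF F] H1[OF F]
    by (intro functor_eqI) (auto simp: comparison_functor P1_shape P1_f P1_g)
  define \<alpha> :: "(('p, 'b) cat, ('p, 'b, 'p, 'b) func, ('y, 'd, 'p, 'b) func, ('y, 'd, 'p, 'b) ntrans, 'q, 'c) lax"
    where "\<alpha> = \<lparr>L0 = (\<lambda>B\<in>Ob0 Cat. comparison B), L1 = (\<lambda>F\<in>Ar1 Cat. nid (fcmp (P1 P F) (comparison (FSrc F))))\<rparr>"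
  have L0: "L0 \<alpha> B = comparison B" if "category B" for B using that by (simp add: \<alpha>_def)
  have L1: "L1 \<alpha> F = nid (fcmp (P1 P F) (comparison (FSrc F)))" if "is_functor F" for F using that by (simp add: \<alpha>_def)
  have fc: "is_functor (fcmp (P1 P F) (comparison (FSrc F)))" if "is_functor F" for F
    using that P1_functor[OF that] by (simp add: comparison_functor P1_shape)
  have "lax_transformation Cat (hom_from C) P \<alpha>"
  proof (intro lax_transformation.intro lax_transformation_axioms.intro H.P_pseudofunctor P_pseudofunctor)
    show "L0 \<alpha> \<in> extensional (Ob0 Cat)" "L1 \<alpha> \<in> extensional (Ar1 Cat)" by (simp_all add: \<alpha>_def)
    show "L0 \<alpha> B \<in> Ob (fun_cat (P0 (hom_from C) B) (P0 P B))" if "B \<in> Ob0 Cat" for B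
      using that by (simp add: L0 comparison_functor)
    fix F and A B :: "('p, 'b) cat" assume "F \<in> cell1 Cat A B"
    then have F: "is_functor F" "FSrc F = A" "FTrg F = B" "category A" "category B" by auto
    show "L1 \<alpha> F \<in> hom (fun_cat (P0 (hom_from C) A) (P0 P B)) (fcmp (P1 P F) (L0 \<alpha> A)) (fcmp (L0 \<alpha> B) (P1 (hom_from C) F))"
      using F fc[OF F(1)] square[OF F(1)] by (simp add: L0 L1 hom_def P1_shape)
    show "nvcmp (nwhl (L0 \<alpha> B) (P2 (hom_from C) \<sigma>)) (L1 \<alpha> F) = nvcmp (L1 \<alpha> F') (nwhr (P2 P \<sigma>) (L0 \<alpha> A))"
      if "\<sigma> \<in> cell2 Cat F F'" for \<sigma> F'
    proof -
      have s: "is_ntrans \<sigma>" "NSrc \<sigma> = F" "NTrg \<sigma> = F'" "is_functor F'" "FSrc F' = A" "FTrg F' = B"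
        using that F by auto
      have l: "is_ntrans (nwhl (comparison B) (P2 (hom_from C) \<sigma>))" "is_ntrans (nwhr (P2 P \<sigma>) (comparison A))"
        using s F H2[OF s(1)] P2_ntrans[OF s(1)] by (simp_all add: comparison_functor P1_shape P2_shape)
      have "nwhl (comparison B) (P2 (hom_from C) \<sigma>) = nwhr (P2 P \<sigma>) (comparison A)"
        using s F l square[OF F(1)] square[OF s(4)] P1_functor[OF F(1)]
        by (intro ntrans_eqI) (auto simp: P2_shape P2_f P1_shape P1_g g_nid g_nvcmp)
      then show ?thesis
        using s F l square[OF F(1)] square[OF s(4)] by (simp add: L0 L1 P2_shape)
    qed
    fix G and E :: "('p, 'b) cat" assume "G \<in> cell1 Cat B E"
    then have G: "is_functor G" "FSrc G = B" "FTrg G = E" "category E" by auto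
    have GF: "is_functor (fcmp G F)" using F G by simp
    show "nvcmp (L1 \<alpha> (Cmp1 Cat G F)) (nwhr (PCp P G F) (L0 \<alpha> A)) =
        nvcmp (nwhl (L0 \<alpha> E) (PCp (hom_from C) G F)) (nvcmp (nwhr (L1 \<alpha> G) (P1 (hom_from C) F)) (nwhl (P1 P G) (L1 \<alpha> F)))"
    proof -
      have c: "fcmp (P1 P (fcmp G F)) (comparison A) = fcmp (P1 P G) (fcmp (P1 P F) (comparison A))"
        using F G P1_functor by (simp add: P1_fcmp comparison_functor P1_shape)
      have d: "fcmp (fcmp (P1 P G) (comparison B)) (postcomp C F) = fcmp (P1 P G) (fcmp (P1 P F) (comparison A))"
        using F G P1_functor H1 square[OF F(1)] by (simp add: comparison_functor P1_shape)
      show ?thesis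
        using F G GF fc P1_functor H1 square[OF GF] c d
        by (simp add: L0 L1 PCp P1_shape comparison_functor)
    qed
  next
    fix B :: "('p, 'b) cat" assume "B \<in> Ob0 Cat"
    then have B: "category B" by simp
    have "postcomp C (fid B) = fid (fun_cat C B)" using H.P1_fid[OF B] by simp
    then show "nvcmp (L1 \<alpha> (Id1 Cat B)) (nwhr (PUn P B) (L0 \<alpha> B)) = nwhl (L0 \<alpha> B) (PUn (hom_from C) B)"
      using B by (simp add: L0 L1 PUn P1_fid comparison_functor)
  qed
  moreover have "invertible_ntrans (L1 \<alpha> F)" if F: "is_functor F" for F
    unfolding L1[OF F] by (rule invertible_nid[OF fc[OF F]])
  ultimately have "\<alpha> \<in> Ob (Ps Cat (hom_from C) P)" by (simp add: Ps_def)
  moreover have "equivalence (L0 \<alpha> B)" if "B \<in> Ob0 Cat" for B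
    using that cat_iso_equivalence[OF iso, of B] by (simp add: L0 comparison_def)
  ultimately show ?thesis unfolding represents_def using C by blast
qed

subsection \<open>Lax cocones and cocones are represented\<close>

lemma cocones_simps [simp]: "P0 (cocones X K) = K" "P1 (cocones X K) = post_cocones X K"
  "NSrc (P2 (cocones X K) \<sigma>) = post_cocones X K (NSrc \<sigma>)" "NTrg (P2 (cocones X K) \<sigma>) = post_cocones X K (NTrg \<sigma>)"
  "Y = Ob (K (FSrc (NSrc \<sigma>))) \<Longrightarrow> NCmp (P2 (cocones X K) \<sigma>) \<in> extensional Y"
  "\<alpha> \<in> Ob (K (FSrc (NSrc \<sigma>))) \<Longrightarrow> NCmp (P2 (cocones X K) \<sigma>) \<alpha> =
     \<lparr>MSrc = post_lax X (NSrc \<sigma>) \<alpha>, MTrg = post_lax X (NTrg \<sigma>) \<alpha>, MCmp = (\<lambda>i\<in>Ob0 X. nwhr \<sigma> (L0 \<alpha> i))\<rparr>"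
  "PUn (cocones X K) B = nid (fid (K B))" "PCp (cocones X K) G F = nid (post_cocones X K (fcmp G F))"
  by (simp_all add: cocones_def)

lemma post_cocones_simps [simp]: "FSrc (post_cocones X K F) = K (FSrc F)" "FTrg (post_cocones X K F) = K (FTrg F)"
  "Y = Ob (K (FSrc F)) \<Longrightarrow> FOb (post_cocones X K F) \<in> extensional Y"
  "Z = Ar (K (FSrc F)) \<Longrightarrow> FAr (post_cocones X K F) \<in> extensional Z"
  "\<alpha> \<in> Ob (K (FSrc F)) \<Longrightarrow> FOb (post_cocones X K F) \<alpha> = post_lax X F \<alpha>"
  "\<Gamma> \<in> Ar (K (FSrc F)) \<Longrightarrow> FAr (post_cocones X K F) \<Gamma> = \<lparr>MSrc = post_lax X F (MSrc \<Gamma>), MTrg = post_lax X F (MTrg \<Gamma>),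
        MCmp = (\<lambda>i\<in>Ob0 X. nwhl F (MCmp \<Gamma> i))\<rparr>"
  by (simp_all add: post_cocones_def)

context cat_psf
begin

lemma post_lax_of:
  assumes F: "is_functor F" and G: "is_functor G" "FSrc G = pi_cat E" "FTrg G = FSrc F"
  shows "post_lax J F (lax_of G) = lax_of (fcmp F G)"
proof (rule lax.equality)
  have FG: "is_functor (fcmp F G)" "FSrc (fcmp F G) = pi_cat E" "FTrg (fcmp F G) = FTrg F" using F G by simp_all
  have l: "fcmp F (L0 (lax_of G) i) = L0 (lax_of (fcmp F G)) i" if "i \<in> Ob0 J" for i
    using that F G lax_of_functor[OF G that] lax_of_functor[OF FG that] by (intro functor_eqI) simp_all
  show "L0 (post_lax J F (lax_of G)) = L0 (lax_of (fcmp F G))"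
    by (rule extensionalityI[of _ "Ob0 J"]) (simp_all add: post_lax_def l)
  have "nwhl F (L1 (lax_of G) m) = L1 (lax_of (fcmp F G)) m" if m: "m \<in> Ar1 J" for m
  proof -
    have "is_ntrans (L1 (lax_of G) m)" "is_ntrans (L1 (lax_of (fcmp F G)) m)"
      using laxD(4)[OF _ lax_of_lax[OF G] m] laxD(4)[OF _ lax_of_lax[OF FG] m] F by simp_all
    then show ?thesis
      using m F G lax_of_functor[OF G, of "Trg1 J m"] by (intro ntrans_eqI) (simp_all add: l[symmetric])
  qed
  then show "L1 (post_lax J F (lax_of G)) = L1 (lax_of (fcmp F G))"
    by (intro extensionalityI[of _ "Ar1 J"]) (simp_all add: post_lax_def)
qed simp

lemma post_mod_of:
  assumes F: "is_functor F" and t: "is_ntrans \<tau>" "FSrc (NSrc \<tau>) = pi_cat E" "FTrg (NSrc \<tau>) = FSrc F"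
  shows "\<lparr>MSrc = post_lax J F (MSrc (mod_of \<tau>)), MTrg = post_lax J F (MTrg (mod_of \<tau>)),
     MCmp = (\<lambda>i\<in>Ob0 J. nwhl F (MCmp (mod_of \<tau>) i))\<rparr> = mod_of (nwhl F \<tau>)"
proof (rule modif_raw_eqI)
  have Ft: "is_ntrans (nwhl F \<tau>)" "FSrc (NSrc (nwhl F \<tau>)) = pi_cat E" "FTrg (NSrc (nwhl F \<tau>)) = FTrg F" using F t by simp_all
  have p: "fcmp F (L0 (lax_of G) i) = L0 (lax_of (fcmp F G)) i" if "i \<in> Ob0 J" "G = NSrc \<tau> \<or> G = NTrg \<tau>" for i G
  proof -
    have "post_lax J F (lax_of G) = lax_of (fcmp F G)" using F t that by (intro post_lax_of) auto
    from arg_cong[OF this, of "\<lambda>\<alpha>. L0 \<alpha> i"] show ?thesis using that by (simp add: post_lax_def)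
  qed
  fix i assume i: "i \<in> Ob0 J"
  have "nwhl F (MCmp (mod_of \<tau>) i) = MCmp (mod_of (nwhl F \<tau>)) i"
    using i F t p[OF i] mod_of_components[OF t i] mod_of_components[OF Ft i] by (intro ntrans_eqI) simp_all
  then show "MCmp \<lparr>MSrc = post_lax J F (MSrc (mod_of \<tau>)), MTrg = post_lax J F (MTrg (mod_of \<tau>)),
     MCmp = (\<lambda>i\<in>Ob0 J. nwhl F (MCmp (mod_of \<tau>) i))\<rparr> i = MCmp (mod_of (nwhl F \<tau>)) i"
    using i by simp
qed (use assms in \<open>simp_all add: post_lax_of\<close>)

lemma post_mod_of_nwhr:
  assumes s: "is_ntrans \<sigma>" and G: "is_functor G" "FSrc G = pi_cat E" "FTrg G = FSrc (NSrc \<sigma>)"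
  shows "\<lparr>MSrc = post_lax J (NSrc \<sigma>) (lax_of G), MTrg = post_lax J (NTrg \<sigma>) (lax_of G),
     MCmp = (\<lambda>i\<in>Ob0 J. nwhr \<sigma> (L0 (lax_of G) i))\<rparr> = mod_of (nwhr \<sigma> G)"
proof (rule modif_raw_eqI)
  have sG: "is_ntrans (nwhr \<sigma> G)" "FSrc (NSrc (nwhr \<sigma> G)) = pi_cat E" "FTrg (NSrc (nwhr \<sigma> G)) = FTrg (NSrc \<sigma>)" using s G by simp_all
  have p: "fcmp F (L0 (lax_of G) i) = L0 (lax_of (fcmp F G)) i" if "i \<in> Ob0 J" "F = NSrc \<sigma> \<or> F = NTrg \<sigma>" for i F
  proof -
    have "post_lax J F (lax_of G) = lax_of (fcmp F G)" using s G that by (intro post_lax_of) auto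
    from arg_cong[OF this, of "\<lambda>\<alpha>. L0 \<alpha> i"] show ?thesis using that by (simp add: post_lax_def)
  qed
  fix i assume i: "i \<in> Ob0 J"
  have "nwhr \<sigma> (L0 (lax_of G) i) = MCmp (mod_of (nwhr \<sigma> G)) i"
    using i s G p[OF i] lax_of_functor[OF G i] mod_of_components[OF sG i] by (intro ntrans_eqI) simp_all
  then show "MCmp \<lparr>MSrc = post_lax J (NSrc \<sigma>) (lax_of G), MTrg = post_lax J (NTrg \<sigma>) (lax_of G),
     MCmp = (\<lambda>i\<in>Ob0 J. nwhr \<sigma> (L0 (lax_of G) i))\<rparr> i = MCmp (mod_of (nwhr \<sigma> G)) i"
    using i by simp
qed (use assms in \<open>simp_all add: post_lax_of\<close>)

lemma pi_cat_is_lax_colimit: "is_lax_colimit TYPE('p) TYPE('b) J D (pi_cat E)"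
proof -
  interpret R: strict_representation "pi_cat E" "cocones J (\<lambda>B :: ('p, 'b) cat. Lax J D (Delta B))" lax_of mod_of
  proof (rule strict_representation.intro)
    fix F :: "('p, 'b, 'p, 'b) func" assume F: "is_functor F"
    show "FOb (P1 (cocones J (\<lambda>B. Lax J D (Delta B))) F) (lax_of G) = lax_of (fcmp F G)"
      if "is_functor G" "FSrc G = pi_cat E" "FTrg G = FSrc F" for G
      using F that lax_of_lax[OF that] by (simp add: post_lax_of)
    show "FAr (P1 (cocones J (\<lambda>B. Lax J D (Delta B))) F) (mod_of \<tau>) = mod_of (nwhl F \<tau>)"
      if "is_ntrans \<tau>" "FSrc (NSrc \<tau>) = pi_cat E" "FTrg (NSrc \<tau>) = FSrc F" for \<tau>
      using mod_of_modification[OF that] post_mod_of[OF F that] by simp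
  next
    fix \<sigma> :: "('p, 'b, 'p, 'b) ntrans" assume s: "is_ntrans \<sigma>"
    show "NCmp (P2 (cocones J (\<lambda>B. Lax J D (Delta B))) \<sigma>) (lax_of G) = mod_of (nwhr \<sigma> G)"
      if "is_functor G" "FSrc G = pi_cat E" "FTrg G = FSrc (NSrc \<sigma>)" for G
      using lax_of_lax[OF that] post_mod_of_nwhr[OF s that] by simp
  qed (simp_all add: fun_cat_iso_Lax E.pi_cat_category)
  show ?thesis unfolding is_lax_colimit_def by (rule R.represents)
qed

sublocale Loc: localization "pi_cat E" "pi_class E ` opcartesian J D"
  by (rule localization.intro) (auto simp: E.pi_cat_category E.pi_cat_Ar opcartesian_def)

lemma fun_cat_fractions_iso_Ps:
  "category B \<Longrightarrow> cat_iso (fun_cat Loc.L B) (Ps J D (Delta B)) (lax_of \<circ> (\<lambda>H. fcmp H Loc.to_fractions)) (mod_of \<circ> (\<lambda>\<tau>. nwhr \<tau> Loc.to_fractions))"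
  by (rule cat_iso_trans[OF Loc.fun_cat_fractions_iso fun_cat_inv_iso_Ps])

lemma fractions_is_colimit: "is_colimit TYPE('p) TYPE('b) J D Loc.L"
proof -
  let ?f = "lax_of \<circ> (\<lambda>H. fcmp H Loc.to_fractions)" and ?g = "mod_of \<circ> (\<lambda>\<tau>. nwhr \<tau> Loc.to_fractions)"
  let ?P = "cocones J (\<lambda>B :: ('p, 'b) cat. Ps J D (Delta B))"
  have f: "?f G \<in> Ob (Ps J D (Delta B))" if "is_functor G" "FSrc G = Loc.L" "FTrg G = B" for G and B :: "('p, 'b) cat"
    using cat_isoD(2)[OF fun_cat_fractions_iso_Ps, of B G] that by auto
  have g: "?g \<tau> \<in> Ar (Ps J D (Delta B))" if "is_ntrans \<tau>" "FSrc (NSrc \<tau>) = Loc.L" "FTrg (NSrc \<tau>) = B" for \<tau> and B :: "('p, 'b) cat"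
    using cat_isoD(3)[OF fun_cat_fractions_iso_Ps, of B \<tau>] that functor_cats(2)[of "NSrc \<tau>" B] by auto
  interpret R: strict_representation Loc.L ?P ?f ?g
  proof (rule strict_representation.intro)
    fix F :: "('p, 'b, 'p, 'b) func" assume F: "is_functor F"
    show "FOb (P1 ?P F) (?f G) = ?f (fcmp F G)" if G: "is_functor G" "FSrc G = Loc.L" "FTrg G = FSrc F" for G
      using F f[OF G] G by (simp add: post_lax_of)
    show "FAr (P1 ?P F) (?g \<tau>) = ?g (nwhl F \<tau>)" if t: "is_ntrans \<tau>" "FSrc (NSrc \<tau>) = Loc.L" "FTrg (NSrc \<tau>) = FSrc F" for \<tau>
      using F g[OF t] t post_mod_of[OF F, of "nwhr \<tau> Loc.to_fractions"] by (simp add: nhcmp_assoc)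
  next
    fix \<sigma> :: "('p, 'b, 'p, 'b) ntrans" assume s: "is_ntrans \<sigma>"
    show "NCmp (P2 ?P \<sigma>) (?f G) = ?g (nwhr \<sigma> G)" if G: "is_functor G" "FSrc G = Loc.L" "FTrg G = FSrc (NSrc \<sigma>)" for G
      using f[OF G] G s post_mod_of_nwhr[OF s, of "fcmp G Loc.to_fractions"] by (simp add: nhcmp_assoc)
  qed (simp_all only: cocones_simps post_cocones_simps fun_cat_fractions_iso_Ps Loc.L_category)
  show ?thesis unfolding is_colimit_def by (rule R.represents)
qed

end

theorem mainTheorem10:
  fixes J :: "('j, 'm, 't) bicat"
    and D :: "('j, 'm, 't, ('x, 'a) cat, ('x, 'a, 'x, 'a) func, ('x, 'a, 'x, 'a) ntrans) psf"
    and B :: "('b, 'c) cat"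
  assumes "bicategory J"
    and "pseudofunctor J Cat D"
    and "category B"
  shows "Lax J D (Delta B) \<simeq> psf_cat (elements J D) (disc B) \<and>
    psf_cat (elements J D) (disc B) \<simeq> fun_cat (pi_cat (elements J D)) B \<and>
    Ps J D (Delta B) \<simeq> psf_cat_inv (elements J D) (opcartesian J D) (disc B) \<and>
    psf_cat_inv (elements J D) (opcartesian J D) (disc B) \<simeq>
      fun_cat_inv (pi_cat (elements J D)) (pi_class (elements J D) ` opcartesian J D) B \<and>
    fun_cat_inv (pi_cat (elements J D)) (pi_class (elements J D) ` opcartesian J D) B \<simeq>
      fun_cat (fractions (pi_cat (elements J D)) (pi_class (elements J D) ` opcartesian J D)) B \<and>
    is_lax_colimit TYPE('b) TYPE('c) J D (pi_cat (elements J D)) \<and>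
    is_colimit TYPE('b) TYPE('c) J D
      (fractions (pi_cat (elements J D)) (pi_class (elements J D) ` opcartesian J D))"
proof -
  interpret cat_psf J D by (intro cat_psf.intro assms(2))
  note B = assms(3)
  have op: "opcartesian J D \<subseteq> Ar1 E" by (auto simp: opcartesian_def)
  note lax = fun_cat_iso_Lax[OF B] and psf = fun_cat_iso_psf_cat[OF elements_bicategory B]
    and ps = fun_cat_inv_iso_Ps[OF B] and psf_inv = fun_cat_inv_iso_psf_cat_inv[OF elements_bicategory B op]
  show ?thesis
    using cat_iso_equivalent[OF cat_iso_trans[OF cat_iso_sym[OF lax] psf]] cat_iso_equivalent'[OF psf]
      cat_iso_equivalent[OF cat_iso_trans[OF cat_iso_sym[OF ps] psf_inv]] cat_iso_equivalent'[OF psf_inv]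
      cat_iso_equivalent'[OF Loc.fun_cat_fractions_iso[OF B]] pi_cat_is_lax_colimit fractions_is_colimit
    by blast
qed

end
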